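(* Let $G$ be a finite group. Then for all finite groups $H$ and $K$ we have $$\mathcal{P}_{\mathbb{C}R_{\mathbb{C},G}}(H,K)=\langle \mathcal{P}_{\mathbb{C}R_{\mathbb{C},G}}(1,K)\circ\mathcal{P}_{\mathbb{C}R_{\mathbb{C},G}}(H,1)\rangle,$$ i.e. every morphism $H\to K$ in $\mathcal{P}_{\mathbb{C}R_{\mathbb{C},G}}$ is a $\mathbb{C}$-linear combination of composites $H\to 1\to K$ through the trivial group.
   Context: For a finite group $H$, $R_{\mathbb{C}}(H)$ is the Grothendieck ring of finitely generated $\mathbb{C}H$-modules and $\mathbb{C}R_{\mathbb{C}}(H)=\mathbb{C}\otimes_{\mathbb{Z}}R_{\mathbb{C}}(H)$. The shifted Green biset functor $\mathbb{C}R_{\mathbb{C},G}$ has values $\mathbb{C}R_{\mathbb{C},G}(H)=\mathbb{C}R_{\mathbb{C}}(H\times G)$. The category $\mathcal{P}_{\mathbb{C}R_{\mathbb{C},G}}$ has the finite groups as objects and morphisms from $H$ to $K$ given by $\mathcal{P}_{\mathbb{C}R_{\mathbb{C},G}}(H,K)=\mathbb{C}R_{\mathbb{C}}(K\times H\times G)$. The composite of the classes of a $\mathbb{C}[L\times K\times G]$-module $V$ and a $\mathbb{C}[K\times H\times G]$-module $W$ is $[V]\circ[W]=[(V\otimes_{\mathbb{C}}W)_K]$, the coinvariants under the diagonal action of $K$, with $G$ acting diagonally (on characters: $(\chi\circ\theta)(l,h,g)=\frac{1}{|K|}\sum_{x\in K}\chi(l,x,g)\theta(x,h,g)$), extended $\mathbb{C}$-bilinearly.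 $\langle\,\cdot\,\rangle$ denotes $\mathbb{C}$-linear span. *)

theory Defs
  imports
    "HOL-Algebra.Elementary_Groups"
    "HOL-Algebra.Generated_Groups"
    "HOL-Algebra.Free_Abelian_Groups"
    "Jordan_Normal_Form.Matrix_Kernel"
begin

section \<open>Finitely generated modules over a complex group algebra\<close>

text \<open>
  For a finite group \<open>H\<close>, a finitely generated \<open>\<complex>H\<close>-module is a finite-dimensional complex vector
  space with a linear action of \<open>H\<close>. It is given here on \<open>\<complex>\<^sup>n\<close>, by the pair of \<open>n\<close> and the matrices
  of the group elements; every finitely generated module is isomorphic to one of these. The values
  of the second component outside \<open>carrier H\<close> are irrelevant.
\<close>

type_synonym 'a rep = "nat \<times> ('a \<Rightarrow> complex mat)"

definition reps :: "'a monoid \<Rightarrow> 'a rep set" where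
  "reps H = {(n, \<rho>).
     (\<forall>h\<in>carrier H. \<rho> h \<in> carrier_mat n n) \<and>
     \<rho> \<one>\<^bsub>H\<^esub> = 1\<^sub>m n \<and>
     (\<forall>h\<in>carrier H. \<forall>h'\<in>carrier H. \<rho> (h \<otimes>\<^bsub>H\<^esub> h') = \<rho> h * \<rho> h')}"

definition module_hom :: "'a monoid \<Rightarrow> 'a rep \<Rightarrow> 'a rep \<Rightarrow> complex mat set" where
  "module_hom H V W = {A \<in> carrier_mat (fst W) (fst V).
     \<forall>h\<in>carrier H. A * snd V h = snd W h * A}"

text \<open>There is an exact sequence \<open>0 \<rightarrow> V' \<rightarrow> V \<rightarrow> V'' \<rightarrow> 0\<close> of modules.\<close>

definition short_exact :: "'a monoid \<Rightarrow> 'a rep \<Rightarrow> 'a rep \<Rightarrow> 'a rep \<Rightarrow> bool" where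
  "short_exact H V' V V'' \<longleftrightarrow>
     (\<exists>A\<in>module_hom H V' V. \<exists>B\<in>module_hom H V V''.
        inj_on (\<lambda>v. A *\<^sub>v v) (carrier_vec (fst V')) \<and>
        (\<lambda>v. A *\<^sub>v v) ` carrier_vec (fst V') = mat_kernel B \<and>
        (\<lambda>v. B *\<^sub>v v) ` carrier_vec (fst V) = carrier_vec (fst V''))"


section \<open>The Grothendieck group and its complexification\<close>

text \<open>
  The group \<open>R\<^sub>\<complex>(H)\<close>: the free abelian group on the modules modulo \<open>[V] = [V'] + [V'']\<close> for all
  short exact sequences. Isomorphic modules are identified by the relations for \<open>V'' = 0\<close>. The
  multiplication of the quotient group is the addition of \<open>R\<^sub>\<complex>(H)\<close>; the ring product is not needed.
\<close>

definition exact_relations :: "'a monoid \<Rightarrow> ('a rep \<Rightarrow>\<^sub>0 int) set" where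
  "exact_relations H = generate (free_Abelian_group (reps H))
     {frag_of V - frag_of V' - frag_of V'' | V' V V''.
        V' \<in> reps H \<and> V \<in> reps H \<and> V'' \<in> reps H \<and> short_exact H V' V V''}"

definition grothendieck :: "'a monoid \<Rightarrow> ('a rep \<Rightarrow>\<^sub>0 int) set monoid" where
  "grothendieck H = free_Abelian_group (reps H) Mod exact_relations H"

text \<open>
  Maps on free abelian groups act on quotients as follows. If the map \<open>f\<close> respects the subgroups
  factored out, all the cosets in the union coincide.
\<close>

definition quotient_map1 :: "'c monoid \<Rightarrow> 'c set \<Rightarrow> ('a \<Rightarrow> 'c) \<Rightarrow> 'a set \<Rightarrow> 'c set" where
  "quotient_map1 F N f X = (\<Union>x\<in>X. N #>\<^bsub>F\<^esub> f x)"

definition quotient_map2 ::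
    "'c monoid \<Rightarrow> 'c set \<Rightarrow> ('a \<Rightarrow> 'b \<Rightarrow> 'c) \<Rightarrow> 'a set \<Rightarrow> 'b set \<Rightarrow> 'c set" where
  "quotient_map2 F N f X Y = (\<Union>x\<in>X. \<Union>y\<in>Y. N #>\<^bsub>F\<^esub> f x y)"

text \<open>
  The tensor product \<open>\<complex> \<otimes>\<^sub>\<int> A\<close> for an abelian group \<open>A\<close> written multiplicatively; the generator
  \<open>(c, a)\<close> stands for \<open>c \<otimes> a\<close>. Scalars act on the left factor.
\<close>

definition tensor_relations :: "'a monoid \<Rightarrow> (complex \<times> 'a \<Rightarrow>\<^sub>0 int) set" where
  "tensor_relations A = generate (free_Abelian_group (UNIV \<times> carrier A))
     ({frag_of (c + d, a) - frag_of (c, a) - frag_of (d, a) | c d a. a \<in> carrier A} \<union>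
      {frag_of (c, a \<otimes>\<^bsub>A\<^esub> b) - frag_of (c, a) - frag_of (c, b) | c a b.
         a \<in> carrier A \<and> b \<in> carrier A})"

definition complexification :: "'a monoid \<Rightarrow> (complex, (complex \<times> 'a \<Rightarrow>\<^sub>0 int) set) module" where
  "complexification A =
     (let F = free_Abelian_group (UNIV \<times> carrier A); N = tensor_relations A; Q = F Mod N
      in \<lparr>carrier = carrier Q, mult = undefined, one = undefined, zero = \<one>\<^bsub>Q\<^esub>, add = mult Q,
          smult = (\<lambda>c. quotient_map1 F N (frag_extend (\<lambda>(d, a). frag_of (c * d, a))))\<rparr>)"

type_synonym 'a CR_elem = "(complex \<times> ('a rep \<Rightarrow>\<^sub>0 int) set \<Rightarrow>\<^sub>0 int) set"

definition CR :: "'a monoid \<Rightarrow> (complex, 'a CR_elem) module" where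
  "CR H = complexification (grothendieck H)"


section \<open>The morphisms and their composition\<close>

definition Mor :: "'g monoid \<Rightarrow> 'h monoid \<Rightarrow> 'k monoid \<Rightarrow> (complex, ('k \<times> 'h \<times> 'g) CR_elem) module"
  where "Mor G H K = CR (K \<times>\<times> H \<times>\<times> G)"

text \<open>
  The Kronecker product, that is, the matrix of \<open>A \<otimes> B\<close> when \<open>e\<^sub>i \<otimes> e\<^sub>j\<close> is the basis vector with
  index \<open>i * m + j\<close> of the tensor product, \<open>m\<close> being the dimension of the second factor.
\<close>

definition kronecker :: "complex mat \<Rightarrow> complex mat \<Rightarrow> complex mat" where
  "kronecker A B = mat (dim_row A * dim_row B) (dim_col A * dim_col B)
     (\<lambda>(i, j). A $$ (i div dim_row B, j div dim_col B) * B $$ (i mod dim_row B, j mod dim_col B))"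

text \<open>
  \<open>U\<close> is a model of \<open>(V \<otimes> W)\<^sub>K\<close>: the matrix \<open>Q\<close> maps \<open>V \<otimes> W\<close> onto \<open>U\<close>, its kernel is the span of
  the vectors \<open>x v - v\<close> for the diagonal action of \<open>x \<in> K\<close>, and it transports the action of
  \<open>L \<times> H \<times> G\<close> on \<open>V \<otimes> W\<close>, with \<open>G\<close> acting diagonally, to the action on \<open>U\<close>.
\<close>

definition is_coinvariants ::
    "'g monoid \<Rightarrow> 'h monoid \<Rightarrow> 'k monoid \<Rightarrow> 'l monoid \<Rightarrow>
     ('l \<times> 'k \<times> 'g) rep \<Rightarrow> ('k \<times> 'h \<times> 'g) rep \<Rightarrow> ('l \<times> 'h \<times> 'g) rep \<Rightarrow> bool" where
  "is_coinvariants G H K L V W U \<longleftrightarrow>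
     U \<in> reps (L \<times>\<times> H \<times>\<times> G) \<and>
     (\<exists>Q\<in>carrier_mat (fst U) (fst V * fst W).
        (\<lambda>v. Q *\<^sub>v v) ` carrier_vec (fst V * fst W) = carrier_vec (fst U) \<and>
        mat_kernel Q =
          LinearCombinations.module.span class_ring (module_vec TYPE(complex) (fst V * fst W))
            {kronecker (snd V (\<one>\<^bsub>L\<^esub>, x, \<one>\<^bsub>G\<^esub>)) (snd W (x, \<one>\<^bsub>H\<^esub>, \<one>\<^bsub>G\<^esub>)) *\<^sub>v v - v | x v.
               x \<in> carrier K \<and> v \<in> carrier_vec (fst V * fst W)} \<and>
        (\<forall>l\<in>carrier L. \<forall>h\<in>carrier H. \<forall>g\<in>carrier G.
           Q * kronecker (snd V (l, \<one>\<^bsub>K\<^esub>, g)) (snd W (\<one>\<^bsub>K\<^esub>, h, g)) = snd U (l, h, g) * Q))"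

text \<open>The choice below is immaterial: \<open>U\<close> is unique up to isomorphism.\<close>

definition coinvariants ::
    "'g monoid \<Rightarrow> 'h monoid \<Rightarrow> 'k monoid \<Rightarrow> 'l monoid \<Rightarrow>
     ('l \<times> 'k \<times> 'g) rep \<Rightarrow> ('k \<times> 'h \<times> 'g) rep \<Rightarrow> ('l \<times> 'h \<times> 'g) rep" where
  "coinvariants G H K L V W = (SOME U. is_coinvariants G H K L V W U)"

definition frag_bilinear ::
    "('a \<Rightarrow> 'b \<Rightarrow> 'c) \<Rightarrow> ('a \<Rightarrow>\<^sub>0 int) \<Rightarrow> ('b \<Rightarrow>\<^sub>0 int) \<Rightarrow> ('c \<Rightarrow>\<^sub>0 int)" where
  "frag_bilinear f x y = frag_extend (\<lambda>a. frag_extend (\<lambda>b. frag_of (f a b)) y) x"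

text \<open>The biadditive map \<open>R\<^sub>\<complex>(L \<times> K \<times> G) \<times> R\<^sub>\<complex>(K \<times> H \<times> G) \<rightarrow> R\<^sub>\<complex>(L \<times> H \<times> G)\<close> with
  \<open>([V], [W]) \<mapsto> [(V \<otimes> W)\<^sub>K]\<close>.\<close>

definition grothendieck_comp ::
    "'g monoid \<Rightarrow> 'h monoid \<Rightarrow> 'k monoid \<Rightarrow> 'l monoid \<Rightarrow>
     (('l \<times> 'k \<times> 'g) rep \<Rightarrow>\<^sub>0 int) set \<Rightarrow> (('k \<times> 'h \<times> 'g) rep \<Rightarrow>\<^sub>0 int) set \<Rightarrow>
     (('l \<times> 'h \<times> 'g) rep \<Rightarrow>\<^sub>0 int) set" where
  "grothendieck_comp G H K L =
     quotient_map2 (free_Abelian_group (reps (L \<times>\<times> H \<times>\<times> G))) (exact_relations (L \<times>\<times> H \<times>\<times> G))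
       (frag_bilinear (coinvariants G H K L))"

text \<open>Composition \<open>Mor G K L \<times> Mor G H K \<rightarrow> Mor G H L\<close> is its \<open>\<complex>\<close>-bilinear extension,
  \<open>(c \<otimes> a, d \<otimes> b) \<mapsto> c d \<otimes> (a \<circ> b)\<close>.\<close>

definition Comp ::
    "'g monoid \<Rightarrow> 'h monoid \<Rightarrow> 'k monoid \<Rightarrow> 'l monoid \<Rightarrow>
     ('l \<times> 'k \<times> 'g) CR_elem \<Rightarrow> ('k \<times> 'h \<times> 'g) CR_elem \<Rightarrow> ('l \<times> 'h \<times> 'g) CR_elem" where
  "Comp G H K L =
     (let A = grothendieck (L \<times>\<times> H \<times>\<times> G)
      in quotient_map2 (free_Abelian_group (UNIV \<times> carrier A)) (tensor_relations A)
           (frag_bilinear (\<lambda>(c, a) (d, b). (c * d, grothendieck_comp G H K L a b))))"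

abbreviation one_group :: "unit monoid" where
  "one_group \<equiv> singleton_group ()"

end

theory Submission
  imports Defs "Jordan_Normal_Form.Spectral_Radius"
begin

text \<open>
  A composite through the trivial group is just a tensor product: for modules \<open>V\<close> of
  \<open>K \<times> 1 \<times> G\<close> and \<open>W\<close> of \<open>1 \<times> H \<times> G\<close> there is nothing to divide out, so that
  \<open>[V] \<circ> [W] = [V \<otimes> W]\<close> with \<open>(k, h, g)\<close> acting by \<open>(k, g) \<otimes> (h, g)\<close>. If \<open>G\<close> acts trivially on
  \<open>V\<close>, this is the outer tensor product of a module of \<open>K\<close> and a module of \<open>H \<times> G\<close>. Hence it
  suffices that the classes of such products generate \<open>R\<^sub>\<complex>(K \<times> H \<times> G)\<close>, and they do so already
  over \<open>\<int>\<close>: the relations of exact sequences reduce every class to classes of irreducible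
  modules by induction on the dimension (\<open>rep_class_in_submodule\<close>), and an irreducible module of a
  product \<open>A \<times> B\<close> over the algebraically closed field \<open>\<complex>\<close> is an outer tensor product
  (\<open>irreducible_rep_DirProd\<close>).

  For the latter let \<open>U\<close> be an irreducible \<open>B\<close>-submodule of the irreducible module \<open>M\<close>. Choose an
  injective \<open>B\<close>-homomorphism \<open>E\<close> from a sum of \<open>r\<close> copies of \<open>U\<close> to \<open>M\<close> with \<open>r\<close> maximal. Every
  \<open>B\<close>-homomorphism from \<open>U\<close> to \<open>M\<close> has its image in the image of \<open>E\<close>: otherwise the two images
  intersect trivially, because \<open>U\<close> is irreducible, and a further copy of \<open>U\<close> could be added. The
  action of \<open>A\<close> commutes with that of \<open>B\<close>, so it maps the image of \<open>E\<close> to itself. Pulled back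
  along \<open>E\<close> it commutes with \<open>1 \<otimes> U\<close>, and Schur's lemma turns it into \<open>W \<otimes> 1\<close> for an action \<open>W\<close>
  of \<open>A\<close> on \<open>\<complex>\<^sup>r\<close>. So \<open>E\<close> is a homomorphism \<open>W \<otimes> U \<rightarrow> M\<close>, which is surjective since \<open>M\<close> is
  irreducible.

  The other half of the work shows that the composition is well defined on the classes. Over a
  field every short exact sequence splits as a sequence of vector spaces, and a splitting consists of
  matrix identities (\<open>split_exact\<close>) that are preserved by Kronecker products with an identity
  matrix. Therefore \<open>\<otimes>\<close> is exact in both arguments and respects the relations of the Grothendieck
  group (\<open>grothendieck_comp_rep_class\<close>). The relations of \<open>\<complex> \<otimes>\<^sub>\<int> _\<close> are respected by
  biadditivity (\<open>Comp_tensor_class\<close>). That the span consists of morphisms and is closed under the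
  module operations follows from \<open>complexification_module\<close>.
\<close>

section \<open>Injective matrices and split exact sequences\<close>

lemma mat_eqI_mult_vec:
  fixes A B :: "complex mat"
  assumes A: "A \<in> carrier_mat n p" and B: "B \<in> carrier_mat n p"
    and eq: "\<And>v. v \<in> carrier_vec p \<Longrightarrow> A *\<^sub>v v = B *\<^sub>v v"
  shows "A = B"
proof (rule eq_matI)
  fix i j assume ij: "i < dim_row B" "j < dim_col B"
  have "A *\<^sub>v unit_vec p j = B *\<^sub>v unit_vec p j" by (rule eq) simp
  then have "(A *\<^sub>v unit_vec p j) $ i = (B *\<^sub>v unit_vec p j) $ i" by simp
  then show "A $$ (i, j) = B $$ (i, j)" using ij A B by simp
qed (use A B in auto)

text \<open>The columns of \<open>Z\<close> are preimages of those of \<open>N\<close>. This is the source of all matrices below that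
  are not written down explicitly: one-sided inverses, induced actions, splittings.\<close>

lemma factor_through_image:
  fixes M N :: "complex mat"
  assumes M: "M \<in> carrier_mat n p" and N: "N \<in> carrier_mat n q"
    and im: "\<And>j. j < q \<Longrightarrow> col N j \<in> (\<lambda>v. M *\<^sub>v v) ` carrier_vec p"
  obtains Z where "Z \<in> carrier_mat p q" "N = M * Z"
proof -
  have "\<forall>j. \<exists>z. j < q \<longrightarrow> z \<in> carrier_vec p \<and> M *\<^sub>v z = col N j" using im by force
  then obtain z where z: "\<And>j. j < q \<Longrightarrow> z j \<in> carrier_vec p \<and> M *\<^sub>v z j = col N j" by metis
  define Z where "Z = mat p q (\<lambda>(i, j). z j $ i)"
  have Zc: "Z \<in> carrier_mat p q" unfolding Z_def by simp
  have colZ: "col Z j = z j" if "j < q" for j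
    using z[OF that] that unfolding Z_def by (intro eq_vecI) auto
  have "N = M * Z"
  proof (rule eq_matI)
    fix i j assume ij: "i < dim_row (M * Z)" "j < dim_col (M * Z)"
    then have j: "j < q" and i: "i < n" using Zc M by auto
    have "(M * Z) $$ (i, j) = col (M * Z) j $ i" using ij by simp
    also have "\<dots> = (M *\<^sub>v z j) $ i" using col_mult2[OF M Zc j] colZ[OF j] by simp
    also have "\<dots> = N $$ (i, j)" using z[OF j] i j N by simp
    finally show "N $$ (i, j) = (M * Z) $$ (i, j)" by simp
  qed (use M N Zc in auto)
  then show thesis using that Zc by blast
qed

definition injective_mat :: "complex mat \<Rightarrow> bool" where
  "injective_mat A \<longleftrightarrow> (\<forall>v\<in>carrier_vec (dim_col A). A *\<^sub>v v = 0\<^sub>v (dim_row A) \<longrightarrow> v = 0\<^sub>v (dim_col A))"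

lemma injective_matD:
  assumes "injective_mat A" "A \<in> carrier_mat n p" "v \<in> carrier_vec p" "A *\<^sub>v v = 0\<^sub>v n"
  shows "v = 0\<^sub>v p"
  using assms unfolding injective_mat_def by auto

lemma injective_mat_inj_on:
  assumes inj: "injective_mat A" and A: "A \<in> carrier_mat n p"
  shows "inj_on (\<lambda>v. A *\<^sub>v v) (carrier_vec p)"
proof (rule inj_onI)
  fix v w assume v: "v \<in> carrier_vec p" and w: "w \<in> carrier_vec p" and eq: "A *\<^sub>v v = A *\<^sub>v w"
  have "A *\<^sub>v (v - w) = 0\<^sub>v n" using A v w eq by (simp add: mult_minus_distrib_mat_vec)
  then have 0: "v - w = 0\<^sub>v p" using injective_matD[OF inj A] v w by simp
  have "v $ i = w $ i" if "i < p" for i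
    using arg_cong[OF 0, of "\<lambda>u. u $ i"] v w that by simp
  then show "v = w" using v w by (intro eq_vecI) auto
qed

lemma inj_on_injective_mat:
  assumes inj: "inj_on (\<lambda>v. A *\<^sub>v v) (carrier_vec p)" and A: "A \<in> carrier_mat n p"
  shows "injective_mat A"
  unfolding injective_mat_def
proof (intro ballI impI)
  fix v assume "v \<in> carrier_vec (dim_col A)" "A *\<^sub>v v = 0\<^sub>v (dim_row A)"
  moreover have "A *\<^sub>v 0\<^sub>v p = 0\<^sub>v n" using A by auto
  ultimately show "v = 0\<^sub>v (dim_col A)" using inj_onD[OF inj, of v "0\<^sub>v p"] A by simp
qed

lemma injective_mat_cancel:
  assumes inj: "injective_mat A" and A: "A \<in> carrier_mat n p"
    and B: "B \<in> carrier_mat p q" and C: "C \<in> carrier_mat p q" and eq: "A * B = A * C"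
  shows "B = C"
proof (rule mat_eqI_mult_vec[OF B C])
  fix v :: "complex vec" assume v: "v \<in> carrier_vec q"
  have "A *\<^sub>v (B *\<^sub>v v) = A *\<^sub>v (C *\<^sub>v v)"
    using eq A B C v by (metis assoc_mult_mat_vec)
  then show "B *\<^sub>v v = C *\<^sub>v v"
    using injective_mat_inj_on[OF inj A] B C v by (auto dest: inj_onD)
qed

lemma injective_mat_left_inverse:
  assumes A: "A \<in> carrier_mat n p" and A': "A' \<in> carrier_mat p n" and inv: "A' * A = 1\<^sub>m p"
  shows "injective_mat A"
  unfolding injective_mat_def
proof (intro ballI impI)
  fix v assume v: "v \<in> carrier_vec (dim_col A)" and 0: "A *\<^sub>v v = 0\<^sub>v (dim_row A)"
  have "v = (A' * A) *\<^sub>v v" using v A inv by simp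
  also have "\<dots> = A' *\<^sub>v (A *\<^sub>v v)" using A A' v by (intro assoc_mult_mat_vec) auto
  also have "A *\<^sub>v v = 0\<^sub>v n" using 0 A by simp
  also have "A' *\<^sub>v 0\<^sub>v n = 0\<^sub>v p" using A' by auto
  finally show "v = 0\<^sub>v (dim_col A)" using A by simp
qed

lemma injective_mat_mult:
  assumes A: "injective_mat A" "A \<in> carrier_mat n p" and B: "injective_mat B" "B \<in> carrier_mat p q"
  shows "injective_mat (A * B)"
  unfolding injective_mat_def
proof (intro ballI impI)
  fix v assume "v \<in> carrier_vec (dim_col (A * B))" and 0: "A * B *\<^sub>v v = 0\<^sub>v (dim_row (A * B))"
  then have v: "v \<in> carrier_vec q" using B by simp
  have "A *\<^sub>v (B *\<^sub>v v) = 0\<^sub>v n" using 0 assoc_mult_mat_vec[OF A(2) B(2) v] A by simp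
  then have "B *\<^sub>v v = 0\<^sub>v p" using injective_matD[OF A, of "B *\<^sub>v v"] B v by simp
  then have "v = 0\<^sub>v q" by (rule injective_matD[OF B v])
  then show "v = 0\<^sub>v (dim_col (A * B))" using B by simp
qed

text \<open>If there were more columns than rows, zero rows would complete \<open>A\<close> to a square matrix of
  determinant \<open>0\<close> with the same kernel.\<close>

lemma injective_mat_dim_le:
  assumes inj: "injective_mat A" and A: "A \<in> carrier_mat n p"
  shows "p \<le> n"
proof (rule ccontr)
  assume "\<not> p \<le> n"
  then have np: "n < p" by simp
  define c where "c = (\<lambda>i. if i < n then row A i else 0\<^sub>v p)"
  define A0 where "A0 = mat\<^sub>r p p (\<lambda>i. if i = n then 0\<^sub>v p else c i)"
  have c: "c \<in> {0..<p} \<rightarrow> carrier_vec p" unfolding c_def using A by auto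
  have "det A0 = 0" unfolding A0_def using det_row_0[OF np c] .
  moreover have A0: "A0 \<in> carrier_mat p p" unfolding A0_def by simp
  ultimately obtain v where v: "v \<in> carrier_vec p" "v \<noteq> 0\<^sub>v p" "A0 *\<^sub>v v = 0\<^sub>v p"
    using det_0_iff_vec_prod_zero_field by blast
  have "A *\<^sub>v v = 0\<^sub>v n"
  proof (rule eq_vecI)
    fix i assume "i < dim_vec (0\<^sub>v n :: complex vec)"
    then have i: "i < n" by simp
    have "row A0 i = row A i" unfolding A0_def c_def using i np A by (intro eq_vecI) auto
    then have "(A *\<^sub>v v) $ i = (A0 *\<^sub>v v) $ i" using i np A A0 by simp
    then show "(A *\<^sub>v v) $ i = 0\<^sub>v n $ i" using v i np by simp
  qed (use A in auto)
  then show False using injective_matD[OF inj A] v by blast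
qed

text \<open>The equations of a split exact sequence of vector spaces with maps \<open>A\<close> and \<open>B\<close>, where \<open>A'\<close> is a
  retraction of \<open>A\<close> and \<open>B'\<close> a section of \<open>B\<close>. In this form exactness is visibly preserved by every
  operation that is additive and multiplicative on matrices.\<close>

definition split_exact :: "complex mat \<Rightarrow> complex mat \<Rightarrow> complex mat \<Rightarrow> complex mat \<Rightarrow> bool" where
  "split_exact A B A' B' \<longleftrightarrow> A' * A = 1\<^sub>m (dim_col A) \<and> B * B' = 1\<^sub>m (dim_row B)
     \<and> B * A = 0\<^sub>m (dim_row B) (dim_col A) \<and> A * A' + B' * B = 1\<^sub>m (dim_row A)"

text \<open>Surjectivity provides a section \<open>B'\<close>. The columns of \<open>1 - B' B\<close> lie in the kernel of \<open>B\<close>,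
  which is the image of \<open>A\<close>; so \<open>1 - B' B = A A'\<close>, and \<open>A' A = 1\<close> follows by cancelling \<open>A\<close> in
  \<open>A A' A = A\<close>.\<close>

lemma exact_imp_split_exact:
  assumes A: "A \<in> carrier_mat n p" and B: "B \<in> carrier_mat q n"
    and inj: "inj_on (\<lambda>v. A *\<^sub>v v) (carrier_vec p)"
    and ker: "(\<lambda>v. A *\<^sub>v v) ` carrier_vec p = mat_kernel B"
    and surj: "(\<lambda>v. B *\<^sub>v v) ` carrier_vec n = carrier_vec q"
  obtains A' B' where "A' \<in> carrier_mat p n" "B' \<in> carrier_mat n q" "split_exact A B A' B'"
proof -
  have injA: "injective_mat A" using inj_on_injective_mat[OF inj A] .
  obtain B' where B': "B' \<in> carrier_mat n q" "1\<^sub>m q = B * B'"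
  proof (rule factor_through_image[OF B, of "1\<^sub>m q"])
    show "col (1\<^sub>m q) j \<in> (\<lambda>v. B *\<^sub>v v) ` carrier_vec n" if "j < q" for j
      unfolding surj using that by simp
  qed (use that in auto)
  note BB' = B'(2)[symmetric] and B' = B'(1)
  have BA: "B * A = 0\<^sub>m q p"
  proof (rule mat_eqI_mult_vec)
    fix v :: "complex vec" assume v: "v \<in> carrier_vec p"
    then have "A *\<^sub>v v \<in> mat_kernel B" using ker by blast
    moreover have "0\<^sub>m q p *\<^sub>v v = 0\<^sub>v q" using v by (intro eq_vecI) auto
    ultimately show "B * A *\<^sub>v v = 0\<^sub>m q p *\<^sub>v v" using A B v mat_kernelD[OF B] by simp
  qed (use A B in auto)
  have D: "1\<^sub>m n - B' * B \<in> carrier_mat n n" using mult_carrier_mat[OF B' B] by (rule minus_carrier_mat)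
  have BD: "B * (1\<^sub>m n - B' * B) = 0\<^sub>m q n"
  proof -
    have "B * (1\<^sub>m n - B' * B) = B * 1\<^sub>m n - B * (B' * B)"
      using B B' by (intro mult_minus_distrib_mat) auto
    also have "B * (B' * B) = B" using assoc_mult_mat[OF B B' B] BB' B by simp
    finally show ?thesis using B by simp
  qed
  obtain A' where A': "A' \<in> carrier_mat p n" "1\<^sub>m n - B' * B = A * A'"
  proof (rule factor_through_image[OF A D])
    fix j assume j: "j < n"
    have "B *\<^sub>v col (1\<^sub>m n - B' * B) j = col (B * (1\<^sub>m n - B' * B)) j" using col_mult2[OF B D j] by simp
    also have "\<dots> = 0\<^sub>v q" unfolding BD using j by simp
    finally show "col (1\<^sub>m n - B' * B) j \<in> (\<lambda>v. A *\<^sub>v v) ` carrier_vec p"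
      unfolding ker using D j by (intro mat_kernelI[OF B]) auto
  qed
  have sum: "A * A' + B' * B = 1\<^sub>m n"
    unfolding A'(2)[symmetric] using B B' by (intro eq_matI) auto
  have "A' * A = 1\<^sub>m p"
  proof (rule injective_mat_cancel[OF injA A])
    have "A * (A' * A) = (1\<^sub>m n - B' * B) * A" using assoc_mult_mat[OF A A'(1) A] A'(2) by simp
    also have "\<dots> = 1\<^sub>m n * A - B' * B * A" using A B B' by (intro minus_mult_distrib_mat) auto
    also have "B' * B * A = 0\<^sub>m n p" using A B B' BA by simp
    also have "1\<^sub>m n * A - 0\<^sub>m n p = A * 1\<^sub>m p" using A by (intro eq_matI) auto
    finally show "A * (A' * A) = A * 1\<^sub>m p" .
  qed (use A A'(1) in auto)
  then have "split_exact A B A' B'" unfolding split_exact_def using A B A'(1) B' BB' BA sum by auto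
  then show thesis using that A'(1) B' by blast
qed

lemma split_exact_imp_exact:
  assumes A: "A \<in> carrier_mat n p" and B: "B \<in> carrier_mat q n"
    and A': "A' \<in> carrier_mat p n" and B': "B' \<in> carrier_mat n q" and s: "split_exact A B A' B'"
  shows "inj_on (\<lambda>v. A *\<^sub>v v) (carrier_vec p)"
    and "(\<lambda>v. A *\<^sub>v v) ` carrier_vec p = mat_kernel B"
    and "(\<lambda>v. B *\<^sub>v v) ` carrier_vec n = carrier_vec q"
proof -
  have s: "A' * A = 1\<^sub>m p" "B * B' = 1\<^sub>m q" "B * A = 0\<^sub>m q p" "A * A' + B' * B = 1\<^sub>m n"
    using s A B unfolding split_exact_def by auto
  show "inj_on (\<lambda>v. A *\<^sub>v v) (carrier_vec p)"
    using injective_mat_inj_on[OF injective_mat_left_inverse[OF A A' s(1)] A] .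
  show "(\<lambda>v. B *\<^sub>v v) ` carrier_vec n = carrier_vec q"
  proof (intro equalityI subsetI)
    fix w :: "complex vec" assume w: "w \<in> carrier_vec q"
    have "B *\<^sub>v (B' *\<^sub>v w) = w" using B B' w s(2) by (simp flip: assoc_mult_mat_vec)
    then show "w \<in> (\<lambda>v. B *\<^sub>v v) ` carrier_vec n" using B' w by (metis imageI mult_mat_vec_carrier)
  qed (use B in auto)
  show "(\<lambda>v. A *\<^sub>v v) ` carrier_vec p = mat_kernel B"
  proof (intro equalityI subsetI)
    fix v assume "v \<in> (\<lambda>v. A *\<^sub>v v) ` carrier_vec p"
    then obtain u where u: "u \<in> carrier_vec p" "v = A *\<^sub>v u" by blast
    have "B *\<^sub>v v = (B * A) *\<^sub>v u" using u A B by simp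
    then show "v \<in> mat_kernel B" using u A s(3) by (intro mat_kernelI[OF B]) auto
  next
    fix v assume "v \<in> mat_kernel B"
    then have v: "v \<in> carrier_vec n" "B *\<^sub>v v = 0\<^sub>v q" using mat_kernelD[OF B] by auto
    have "v = (A * A' + B' * B) *\<^sub>v v" using s v by simp
    also have "\<dots> = A * A' *\<^sub>v v + B' * B *\<^sub>v v" using A A' B B' v by (intro add_mult_distrib_mat_vec) auto
    also have "B' * B *\<^sub>v v = B' *\<^sub>v 0\<^sub>v q" using B B' v by simp
    also have "B' *\<^sub>v 0\<^sub>v q = 0\<^sub>v n" using B' by auto
    also have "A * A' *\<^sub>v v = A *\<^sub>v (A' *\<^sub>v v)" using A A' v by simp
    finally have "v = A *\<^sub>v (A' *\<^sub>v v)" using A A' v by simp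
    then show "v \<in> (\<lambda>v. A *\<^sub>v v) ` carrier_vec p" using A' v by (metis imageI mult_mat_vec_carrier)
  qed
qed

section \<open>Kronecker products\<close>

lemma kronecker_carrier:
  "A \<in> carrier_mat a b \<Longrightarrow> B \<in> carrier_mat c d \<Longrightarrow> kronecker A B \<in> carrier_mat (a * c) (b * d)"
  unfolding kronecker_def by auto

lemma kronecker_index:
  "A \<in> carrier_mat a b \<Longrightarrow> B \<in> carrier_mat c d \<Longrightarrow> i < a * c \<Longrightarrow> j < b * d \<Longrightarrow>
    kronecker A B $$ (i, j) = A $$ (i div c, j div d) * B $$ (i mod c, j mod d)"
  unfolding kronecker_def by auto

text \<open>The double sums behind products of Kronecker products, whose indices are \<open>i * d + j\<close>.\<close>

lemma sum_div_mod:
  fixes F :: "nat \<Rightarrow> nat \<Rightarrow> 'a :: comm_monoid_add"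
  shows "(\<Sum>q<b * d. F (q div d) (q mod d)) = (\<Sum>i<b. \<Sum>j<d. F i j)"
proof -
  have "(\<Sum>q<b * d. F (q div d) (q mod d))
      = (\<Sum>i<b. \<Sum>q\<in>{i * d..<i * d + d}. F (q div d) (q mod d))"
    by (rule sum.nat_group[symmetric])
  also have "\<dots> = (\<Sum>i<b. \<Sum>j<d. F i j)"
  proof (rule sum.cong[OF refl])
    fix i
    show "(\<Sum>q\<in>{i * d..<i * d + d}. F (q div d) (q mod d)) = (\<Sum>j<d. F i j)"
      by (rule sum.reindex_bij_witness[of _ "\<lambda>j. i * d + j" "\<lambda>q. q - i * d"])
         (auto simp: div_nat_eqI mult.commute mod_nat_eqI dest!: le_Suc_ex)
  qed
  finally show ?thesis .
qed

lemma div_mod_less_mult: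
  fixes i :: nat assumes "i < a * c" shows "i div c < a" "i mod c < c"
proof -
  have "c > 0" using assms by (cases c) auto
  then show "i div c < a" "i mod c < c" using assms by (auto simp: less_mult_imp_div_less)
qed

lemma kronecker_mult:
  assumes A: "A \<in> carrier_mat a b" and B: "B \<in> carrier_mat c d"
    and C: "C \<in> carrier_mat b e" and D: "D \<in> carrier_mat d f"
  shows "kronecker A B * kronecker C D = kronecker (A * C) (B * D)"
proof (rule eq_matI)
  note AB = kronecker_carrier[OF A B] and CD = kronecker_carrier[OF C D]
  have AC: "A * C \<in> carrier_mat a e" and BD: "B * D \<in> carrier_mat c f" using A B C D by auto
  note R = kronecker_carrier[OF AC BD]
  fix i j assume "i < dim_row (kronecker (A * C) (B * D))" "j < dim_col (kronecker (A * C) (B * D))"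
  then have i: "i < a * c" and j: "j < e * f" using R by auto
  note i' = div_mod_less_mult[OF i] and j' = div_mod_less_mult[OF j]
  have "(kronecker A B * kronecker C D) $$ (i, j)
      = (\<Sum>q<b * d. kronecker A B $$ (i, q) * kronecker C D $$ (q, j))"
    using AB CD i j by (simp add: scalar_prod_def atLeast0LessThan)
  also have "\<dots> = (\<Sum>q<b * d. (A $$ (i div c, q div d) * C $$ (q div d, j div f))
                         * (B $$ (i mod c, q mod d) * D $$ (q mod d, j mod f)))"
    by (rule sum.cong) (use kronecker_index[OF A B i] kronecker_index[OF C D _ j] in auto)
  also have "\<dots> = (\<Sum>k<b. A $$ (i div c, k) * C $$ (k, j div f))
                 * (\<Sum>l<d. B $$ (i mod c, l) * D $$ (l, j mod f))"
    unfolding sum_product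
    by (rule sum_div_mod[of "\<lambda>k l. (A $$ (i div c, k) * C $$ (k, j div f)) * (B $$ (i mod c, l) * D $$ (l, j mod f))"])
  also have "\<dots> = (A * C) $$ (i div c, j div f) * (B * D) $$ (i mod c, j mod f)"
    using A B C D i' j' by (simp add: scalar_prod_def atLeast0LessThan)
  also have "\<dots> = kronecker (A * C) (B * D) $$ (i, j)"
    using kronecker_index[OF AC BD i j] by simp
  finally show "(kronecker A B * kronecker C D) $$ (i, j) = kronecker (A * C) (B * D) $$ (i, j)" .
qed (use kronecker_carrier[OF A B] kronecker_carrier[OF C D] A B C D in \<open>auto simp: kronecker_def\<close>)

lemma kronecker_one: "kronecker (1\<^sub>m a) (1\<^sub>m b) = 1\<^sub>m (a * b)"
proof (rule eq_matI)
  fix i j assume "i < dim_row (1\<^sub>m (a * b) :: complex mat)" "j < dim_col (1\<^sub>m (a * b) :: complex mat)"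
  then have ij: "i < a * b" "j < a * b" by auto
  show "kronecker (1\<^sub>m a) (1\<^sub>m b) $$ (i, j) = 1\<^sub>m (a * b) $$ (i, j)"
    using ij div_mod_less_mult[OF ij(1)] div_mod_less_mult[OF ij(2)]
    by (simp add: kronecker_index[of _ a a _ b b]) (metis div_mult_mod_eq)
qed (auto simp: kronecker_def)

lemma kronecker_zero_left: "B \<in> carrier_mat c d \<Longrightarrow> kronecker (0\<^sub>m a b) B = 0\<^sub>m (a * c) (b * d)"
  by (rule eq_matI) (auto simp: kronecker_def div_mod_less_mult)

lemma kronecker_zero_right: "A \<in> carrier_mat a b \<Longrightarrow> kronecker A (0\<^sub>m c d) = 0\<^sub>m (a * c) (b * d)"
  by (rule eq_matI) (auto simp: kronecker_def div_mod_less_mult)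

lemma kronecker_add_left:
  "A \<in> carrier_mat a b \<Longrightarrow> A' \<in> carrier_mat a b \<Longrightarrow> B \<in> carrier_mat c d \<Longrightarrow>
    kronecker (A + A') B = kronecker A B + kronecker A' B"
  by (rule eq_matI) (auto simp: kronecker_def div_mod_less_mult distrib_left distrib_right)

lemma kronecker_add_right:
  "A \<in> carrier_mat a b \<Longrightarrow> B \<in> carrier_mat c d \<Longrightarrow> B' \<in> carrier_mat c d \<Longrightarrow>
    kronecker A (B + B') = kronecker A B + kronecker A B'"
  by (rule eq_matI) (auto simp: kronecker_def div_mod_less_mult distrib_left distrib_right)

lemma split_exact_kronecker_left:
  assumes A: "A \<in> carrier_mat n p" and B: "B \<in> carrier_mat q n"
    and A': "A' \<in> carrier_mat p n" and B': "B' \<in> carrier_mat n q" and s: "split_exact A B A' B'"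
  shows "split_exact (kronecker A (1\<^sub>m m)) (kronecker B (1\<^sub>m m)) (kronecker A' (1\<^sub>m m)) (kronecker B' (1\<^sub>m m))"
proof -
  let ?I = "1\<^sub>m m :: complex mat"
  have I: "?I \<in> carrier_mat m m" by simp
  have c: "A * A' \<in> carrier_mat n n" "B' * B \<in> carrier_mat n n" using A A' B B' by auto
  show ?thesis
    using s kronecker_carrier[OF A I] kronecker_carrier[OF B I] A B
    unfolding split_exact_def
    by (simp add: kronecker_mult[OF A' I A I] kronecker_mult[OF B I B' I] kronecker_mult[OF B I A I]
        kronecker_mult[OF A I A' I] kronecker_mult[OF B' I B I] kronecker_one kronecker_zero_left[OF I]
        kronecker_add_left[OF c I, symmetric])
qed

lemma split_exact_kronecker_right:
  assumes A: "A \<in> carrier_mat n p" and B: "B \<in> carrier_mat q n"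
    and A': "A' \<in> carrier_mat p n" and B': "B' \<in> carrier_mat n q" and s: "split_exact A B A' B'"
  shows "split_exact (kronecker (1\<^sub>m m) A) (kronecker (1\<^sub>m m) B) (kronecker (1\<^sub>m m) A') (kronecker (1\<^sub>m m) B')"
proof -
  let ?I = "1\<^sub>m m :: complex mat"
  have I: "?I \<in> carrier_mat m m" by simp
  have c: "A * A' \<in> carrier_mat n n" "B' * B \<in> carrier_mat n n" using A A' B B' by auto
  show ?thesis
    using s kronecker_carrier[OF I A] kronecker_carrier[OF I B] A B
    unfolding split_exact_def
    by (simp add: kronecker_mult[OF I A' I A] kronecker_mult[OF I B I B'] kronecker_mult[OF I B I A]
        kronecker_mult[OF I A I A'] kronecker_mult[OF I B' I B] kronecker_one kronecker_zero_right[OF I]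
        kronecker_add_right[OF I c, symmetric])
qed

section \<open>Submodules and quotient modules\<close>

lemma repsD:
  assumes "V \<in> reps H"
  shows "h \<in> carrier H \<Longrightarrow> snd V h \<in> carrier_mat (fst V) (fst V)"
    and "snd V \<one>\<^bsub>H\<^esub> = 1\<^sub>m (fst V)"
    and "h \<in> carrier H \<Longrightarrow> k \<in> carrier H \<Longrightarrow> snd V (h \<otimes>\<^bsub>H\<^esub> k) = snd V h * snd V k"
  using assms unfolding reps_def by auto

lemma repsI:
  assumes "\<And>h. h \<in> carrier H \<Longrightarrow> \<rho> h \<in> carrier_mat n n"
    and "\<rho> \<one>\<^bsub>H\<^esub> = 1\<^sub>m n"
    and "\<And>h k. h \<in> carrier H \<Longrightarrow> k \<in> carrier H \<Longrightarrow> \<rho> (h \<otimes>\<^bsub>H\<^esub> k) = \<rho> h * \<rho> k"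
  shows "(n, \<rho>) \<in> reps H"
  using assms unfolding reps_def by auto

lemma module_homD:
  assumes "A \<in> module_hom H V W"
  shows "A \<in> carrier_mat (fst W) (fst V)"
    and "h \<in> carrier H \<Longrightarrow> A * snd V h = snd W h * A"
  using assms unfolding module_hom_def by auto

lemma module_homI:
  assumes "A \<in> carrier_mat (fst W) (fst V)"
    and "\<And>h. h \<in> carrier H \<Longrightarrow> A * snd V h = snd W h * A"
  shows "A \<in> module_hom H V W"
  using assms unfolding module_hom_def by auto

lemma short_exactI:
  assumes A: "A \<in> module_hom H V' V" and B: "B \<in> module_hom H V V''"
    and A': "A' \<in> carrier_mat (fst V') (fst V)" and B': "B' \<in> carrier_mat (fst V) (fst V'')"
    and s: "split_exact A B A' B'"
  shows "short_exact H V' V V''"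
  unfolding short_exact_def
  using split_exact_imp_exact[OF module_homD(1)[OF A] module_homD(1)[OF B] A' B' s] A B by blast

lemma short_exactE:
  assumes "short_exact H V' V V''"
  obtains A B A' B' where "A \<in> module_hom H V' V" "B \<in> module_hom H V V''"
    "A' \<in> carrier_mat (fst V') (fst V)" "B' \<in> carrier_mat (fst V) (fst V'')" "split_exact A B A' B'"
proof -
  obtain A B where AB: "A \<in> module_hom H V' V" "B \<in> module_hom H V V''"
    "inj_on (\<lambda>v. A *\<^sub>v v) (carrier_vec (fst V'))"
    "(\<lambda>v. A *\<^sub>v v) ` carrier_vec (fst V') = mat_kernel B"
    "(\<lambda>v. B *\<^sub>v v) ` carrier_vec (fst V) = carrier_vec (fst V'')"
    using assms unfolding short_exact_def by blast
  show thesis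
    using exact_imp_split_exact[OF module_homD(1)[OF AB(1)] module_homD(1)[OF AB(2)] AB(3-5)] that AB(1,2)
    by metis
qed

definition vec_subspace :: "nat \<Rightarrow> complex vec set \<Rightarrow> bool" where
  "vec_subspace n T \<longleftrightarrow> T \<subseteq> carrier_vec n \<and> 0\<^sub>v n \<in> T
     \<and> (\<forall>v\<in>T. \<forall>w\<in>T. v + w \<in> T) \<and> (\<forall>c. \<forall>v\<in>T. c \<cdot>\<^sub>v v \<in> T)"

text \<open>The block matrix with \<open>E\<close> to the left of \<open>Y\<close>, written with empty lower blocks.\<close>

definition hcat :: "complex mat \<Rightarrow> complex mat \<Rightarrow> complex mat" where
  "hcat E Y = four_block_mat E Y (0\<^sub>m 0 (dim_col E)) (0\<^sub>m 0 (dim_col Y))"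

lemma hcat_carrier:
  "E \<in> carrier_mat n p \<Longrightarrow> Y \<in> carrier_mat n m \<Longrightarrow> hcat E Y \<in> carrier_mat n (p + m)"
  unfolding hcat_def using four_block_carrier_mat[of E n p "0\<^sub>m 0 m :: complex mat" 0 m] by auto

lemma hcat_index:
  "E \<in> carrier_mat n p \<Longrightarrow> Y \<in> carrier_mat n m \<Longrightarrow> i < n \<Longrightarrow> j < p + m \<Longrightarrow>
    hcat E Y $$ (i, j) = (if j < p then E $$ (i, j) else Y $$ (i, j - p))"
  unfolding hcat_def by auto

lemma hcat_mult_vec:
  assumes E: "E \<in> carrier_mat n p" and Y: "Y \<in> carrier_mat n m"
    and v: "v \<in> carrier_vec p" and w: "w \<in> carrier_vec m"
  shows "hcat E Y *\<^sub>v (v @\<^sub>v w) = E *\<^sub>v v + Y *\<^sub>v w"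
proof -
  have "hcat E Y *\<^sub>v (v @\<^sub>v w)
      = (E *\<^sub>v v + Y *\<^sub>v w) @\<^sub>v (0\<^sub>m 0 p *\<^sub>v v + 0\<^sub>m 0 m *\<^sub>v w)"
    unfolding hcat_def using E Y v w by (subst four_block_mat_mult_vec[of _ n p _ m _ 0]) auto
  then show ?thesis using E Y v w by (intro eq_vecI) auto
qed

text \<open>The sum of the images is direct, and \<open>Y\<close> itself is injective because \<open>0\<close> lies in the image of \<open>E\<close>.\<close>

lemma injective_hcat:
  assumes E: "E \<in> carrier_mat n p" "injective_mat E" and Y: "Y \<in> carrier_mat n m"
    and indep: "\<And>w. w \<in> carrier_vec m \<Longrightarrow> Y *\<^sub>v w \<in> (\<lambda>v. E *\<^sub>v v) ` carrier_vec p \<Longrightarrow> w = 0\<^sub>v m"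
  shows "injective_mat (hcat E Y)"
  unfolding injective_mat_def
proof (intro ballI impI)
  note c = hcat_carrier[OF E(1) Y]
  fix u assume u: "u \<in> carrier_vec (dim_col (hcat E Y))"
    and 0: "hcat E Y *\<^sub>v u = 0\<^sub>v (dim_row (hcat E Y))"
  define v w where "v = vec_first u p" and "w = vec_last u m"
  have vw: "v \<in> carrier_vec p" "w \<in> carrier_vec m" unfolding v_def w_def by auto
  have uvw: "u = v @\<^sub>v w" unfolding v_def w_def using u c by simp
  have 0: "E *\<^sub>v v + Y *\<^sub>v w = 0\<^sub>v n"
    using 0 hcat_mult_vec[OF E(1) Y vw] c uvw by simp
  have "(Y *\<^sub>v w) = E *\<^sub>v (- v)"
  proof (rule eq_vecI)
    fix i assume "i < dim_vec (E *\<^sub>v (- v))"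
    then have i: "i < n" using E by simp
    have "(E *\<^sub>v (- v)) $ i = - ((E *\<^sub>v v) $ i)" using i E vw by simp
    moreover have "(E *\<^sub>v v) $ i + (Y *\<^sub>v w) $ i = 0" using arg_cong[OF 0, of "\<lambda>u. u $ i"] i E Y vw by simp
    ultimately show "(Y *\<^sub>v w) $ i = (E *\<^sub>v (- v)) $ i" by (metis add_eq_0_iff)
  qed (use E Y in auto)
  then have w0: "w = 0\<^sub>v m" using indep[OF vw(2)] vw by auto
  moreover have "Y *\<^sub>v 0\<^sub>v m = 0\<^sub>v n" using Y by auto
  ultimately have "E *\<^sub>v v = 0\<^sub>v n" using 0 E vw by simp
  then have "v = 0\<^sub>v p" using injective_matD[OF E(2,1) vw(1)] by blast
  then show "u = 0\<^sub>v (dim_col (hcat E Y))" using uvw w0 c by (intro eq_vecI) auto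
qed

text \<open>Completion of a linearly independent family in \<open>T\<close> to a basis of \<open>T\<close>, with the families given as
  the columns of matrices. A family of maximal size spans \<open>T\<close>, since a vector outside its span could
  be appended.\<close>

lemma extend_injective_mat:
  assumes T: "vec_subspace n T" and A: "A \<in> carrier_mat n p" "injective_mat A"
    and AT: "\<And>v. v \<in> carrier_vec p \<Longrightarrow> A *\<^sub>v v \<in> T"
  obtains q C where "p \<le> q" "C \<in> carrier_mat n q" "injective_mat C"
    "(\<lambda>v. C *\<^sub>v v) ` carrier_vec q = T"
    "\<And>i j. i < n \<Longrightarrow> j < p \<Longrightarrow> C $$ (i, j) = A $$ (i, j)"
proof -
  define P where "P = (\<lambda>q. \<exists>C. p \<le> q \<and> C \<in> carrier_mat n q \<and> injective_mat C
    \<and> (\<forall>v\<in>carrier_vec q. C *\<^sub>v v \<in> T) \<and> (\<forall>i<n. \<forall>j<p. C $$ (i, j) = A $$ (i, j)))"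
  have "P p" unfolding P_def using A AT by blast
  moreover have "q \<le> n" if "P q" for q using that injective_mat_dim_le unfolding P_def by blast
  ultimately obtain q where q: "P q" "\<And>q'. P q' \<Longrightarrow> q' \<le> q"
    using Greatest_le_nat[of P _ n] GreatestI_nat[of P _ n] by blast
  obtain C where C: "p \<le> q" "C \<in> carrier_mat n q" "injective_mat C"
    "\<And>v. v \<in> carrier_vec q \<Longrightarrow> C *\<^sub>v v \<in> T" "\<And>i j. i < n \<Longrightarrow> j < p \<Longrightarrow> C $$ (i, j) = A $$ (i, j)"
    using q(1) unfolding P_def by blast
  have "t \<in> (\<lambda>v. C *\<^sub>v v) ` carrier_vec q" if t: "t \<in> T" for t
  proof (rule ccontr)
    assume nt: "t \<notin> (\<lambda>v. C *\<^sub>v v) ` carrier_vec q"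
    have tc: "t \<in> carrier_vec n" using T t unfolding vec_subspace_def by blast
    define Y where "Y = mat n 1 (\<lambda>(i, j). t $ i)"
    have Y: "Y \<in> carrier_mat n 1" unfolding Y_def by simp
    have Yw: "Y *\<^sub>v w = (w $ 0) \<cdot>\<^sub>v t" if "w \<in> carrier_vec 1" for w
      using tc that unfolding Y_def by (intro eq_vecI) (auto simp: scalar_prod_def)
    have inj: "injective_mat (hcat C Y)"
    proof (rule injective_hcat[OF C(2,3) Y])
      fix w :: "complex vec" assume w: "w \<in> carrier_vec 1" and "Y *\<^sub>v w \<in> (\<lambda>v. C *\<^sub>v v) ` carrier_vec q"
      then obtain v where v: "v \<in> carrier_vec q" "(w $ 0) \<cdot>\<^sub>v t = C *\<^sub>v v" using Yw by auto
      have "w $ 0 = 0"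
      proof (rule ccontr)
        assume nz: "w $ 0 \<noteq> 0"
        have "t = (1 / w $ 0) \<cdot>\<^sub>v ((w $ 0) \<cdot>\<^sub>v t)" using nz tc by (simp add: smult_smult_assoc)
        also have "\<dots> = C *\<^sub>v ((1 / w $ 0) \<cdot>\<^sub>v v)" unfolding v(2) using C v by (simp add: mult_mat_vec)
        finally show False using nt v by auto
      qed
      then show "w = 0\<^sub>v 1" using w by (intro eq_vecI) auto
    qed
    have "P (q + 1)" unfolding P_def
    proof (intro exI conjI ballI allI impI)
      show "hcat C Y \<in> carrier_mat n (q + 1)" using hcat_carrier[OF C(2) Y] .
      show "injective_mat (hcat C Y)" by (rule inj)
      fix u :: "complex vec" assume u: "u \<in> carrier_vec (q + 1)"
      have "u = vec_first u q @\<^sub>v vec_last u 1" using u by simp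
      then have "hcat C Y *\<^sub>v u = C *\<^sub>v vec_first u q + Y *\<^sub>v vec_last u 1"
        using hcat_mult_vec[OF C(2) Y vec_first_carrier vec_last_carrier] by metis
      also have "\<dots> \<in> T" using C(4)[OF vec_first_carrier] Yw[OF vec_last_carrier] t T
        unfolding vec_subspace_def by simp
      finally show "hcat C Y *\<^sub>v u \<in> T" .
    next
      fix i j assume "i < n" "j < p"
      then show "hcat C Y $$ (i, j) = A $$ (i, j)" using hcat_index[OF C(2) Y] C by simp
    qed (use C in simp)
    then show False using q(2) by fastforce
  qed
  then have "(\<lambda>v. C *\<^sub>v v) ` carrier_vec q = T" using C by blast
  then show thesis using that C by blast
qed

lemma injective_square_mat_surj:
  assumes A: "A \<in> carrier_mat n n" "injective_mat A"
  shows "(\<lambda>v. A *\<^sub>v v) ` carrier_vec n = carrier_vec n"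
proof -
  have "vec_subspace n (carrier_vec n)" unfolding vec_subspace_def by auto
  then obtain q C where C: "n \<le> q" "C \<in> carrier_mat n q" "injective_mat C"
    "(\<lambda>v. C *\<^sub>v v) ` carrier_vec q = carrier_vec n" "\<And>i j. i < n \<Longrightarrow> j < n \<Longrightarrow> C $$ (i, j) = A $$ (i, j)"
    using extend_injective_mat[OF _ A] A(1) by (metis mult_mat_vec_carrier)
  then have "q = n" using injective_mat_dim_le[OF C(3,2)] by simp
  moreover from this have "C = A" using C A by (intro eq_matI) auto
  ultimately show ?thesis using C(4) by simp
qed

text \<open>A basis of \<open>T\<close>, completed to a basis of the whole space, is an invertible matrix. Its first \<open>p\<close>
  columns and the first \<open>p\<close> rows of its inverse give \<open>A\<close> and \<open>A'\<close>, the other ones \<open>B'\<close> and \<open>B\<close>.\<close>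

lemma subspace_split_exact:
  assumes T: "vec_subspace n T"
  obtains p q A B A' B' where "A \<in> carrier_mat n p" "B \<in> carrier_mat q n"
    "A' \<in> carrier_mat p n" "B' \<in> carrier_mat n q" "split_exact A B A' B'"
    "(\<lambda>v. A *\<^sub>v v) ` carrier_vec p = T" "p + q = n"
proof -
  have "injective_mat (0\<^sub>m n 0)" unfolding injective_mat_def by auto
  moreover have "0\<^sub>m n 0 *\<^sub>v v \<in> T" if "v \<in> carrier_vec 0" for v
  proof -
    have "0\<^sub>m n 0 *\<^sub>v v = 0\<^sub>v n" using that by (intro eq_vecI) (auto simp: scalar_prod_def)
    then show ?thesis using T unfolding vec_subspace_def by simp
  qed
  ultimately obtain p A where A: "A \<in> carrier_mat n p" "injective_mat A" "(\<lambda>v. A *\<^sub>v v) ` carrier_vec p = T"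
    using extend_injective_mat[OF T, of "0\<^sub>m n 0" 0] by (metis zero_carrier_mat)
  have full: "vec_subspace n (carrier_vec n)" unfolding vec_subspace_def by auto
  obtain q C where C: "p \<le> q" "C \<in> carrier_mat n q" "injective_mat C"
    "(\<lambda>v. C *\<^sub>v v) ` carrier_vec q = carrier_vec n" "\<And>i j. i < n \<Longrightarrow> j < p \<Longrightarrow> C $$ (i, j) = A $$ (i, j)"
    using extend_injective_mat[OF full A(1,2)] A(1) by (metis mult_mat_vec_carrier)
  obtain C' where C': "C' \<in> carrier_mat q n" and CC': "C * C' = 1\<^sub>m n"
  proof (rule factor_through_image[OF C(2), of "1\<^sub>m n" n])
    show "col (1\<^sub>m n) j \<in> (\<lambda>v. C *\<^sub>v v) ` carrier_vec q" if "j < n" for j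
      unfolding C(4) using that by simp
  qed (use that in auto)
  \<comment> \<open>a right inverse of a surjective \<open>C\<close> is injective, so the dimensions agree and it is two-sided\<close>
  have "injective_mat C'" using injective_mat_left_inverse[OF C' C(2) CC'] .
  then have qn: "q = n" using injective_mat_dim_le[OF _ C'] injective_mat_dim_le[OF C(3,2)] by simp
  note C = C[unfolded qn] and C' = C'[unfolded qn]
  have C'C: "C' * C = 1\<^sub>m n" using mat_mult_left_right_inverse[OF C(2) C' CC'] .
  define A' where "A' = mat p n (\<lambda>(i, j). C' $$ (i, j))"
  define B where "B = mat (n - p) n (\<lambda>(i, j). C' $$ (p + i, j))"
  define B' where "B' = mat n (n - p) (\<lambda>(i, j). C $$ (i, p + j))"
  have c: "A' \<in> carrier_mat p n" "B \<in> carrier_mat (n - p) n" "B' \<in> carrier_mat n (n - p)"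
    unfolding A'_def B_def B'_def by auto
  have e1: "(\<Sum>k<n. C' $$ (i, k) * C $$ (k, j)) = (if i = j then 1 else 0)" if "i < n" "j < n" for i j
  proof -
    have "(C' * C) $$ (i, j) = (\<Sum>k<n. C' $$ (i, k) * C $$ (k, j))"
      using C C' that by (simp add: scalar_prod_def atLeast0LessThan)
    then show ?thesis using C'C that by simp
  qed
  have e2: "(\<Sum>k<n. C $$ (i, k) * C' $$ (k, j)) = (if i = j then 1 else 0)" if "i < n" "j < n" for i j
  proof -
    have "(C * C') $$ (i, j) = (\<Sum>k<n. C $$ (i, k) * C' $$ (k, j))"
      using C C' that by (simp add: scalar_prod_def atLeast0LessThan)
    then show ?thesis using CC' that by simp
  qed
  have "A' * A = 1\<^sub>m p"
  proof (rule eq_matI)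
    fix i j assume "i < dim_row (1\<^sub>m p :: complex mat)" "j < dim_col (1\<^sub>m p :: complex mat)"
    then have ij: "i < p" "j < p" by auto
    have "(A' * A) $$ (i, j) = (\<Sum>k<n. C' $$ (i, k) * C $$ (k, j))"
      using ij c A C(1,5) by (simp add: scalar_prod_def atLeast0LessThan A'_def)
    then show "(A' * A) $$ (i, j) = 1\<^sub>m p $$ (i, j)" using e1 ij C(1) by simp
  qed (use c A in auto)
  moreover have "B * B' = 1\<^sub>m (n - p)"
  proof (rule eq_matI)
    fix i j assume "i < dim_row (1\<^sub>m (n - p) :: complex mat)" "j < dim_col (1\<^sub>m (n - p) :: complex mat)"
    then have ij: "i < n - p" "j < n - p" by auto
    have "(B * B') $$ (i, j) = (\<Sum>k<n. C' $$ (p + i, k) * C $$ (k, p + j))"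
      using ij c by (simp add: scalar_prod_def atLeast0LessThan B_def B'_def)
    then show "(B * B') $$ (i, j) = 1\<^sub>m (n - p) $$ (i, j)" using e1[of "p + i" "p + j"] ij C(1) by simp
  qed (use c in auto)
  moreover have "B * A = 0\<^sub>m (n - p) p"
  proof (rule eq_matI)
    fix i j assume "i < dim_row (0\<^sub>m (n - p) p :: complex mat)" "j < dim_col (0\<^sub>m (n - p) p :: complex mat)"
    then have ij: "i < n - p" "j < p" by auto
    have "(B * A) $$ (i, j) = (\<Sum>k<n. C' $$ (p + i, k) * C $$ (k, j))"
      using ij c A C(1,5) by (simp add: scalar_prod_def atLeast0LessThan B_def)
    then show "(B * A) $$ (i, j) = 0\<^sub>m (n - p) p $$ (i, j)" using e1[of "p + i" j] ij C(1) by simp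
  qed (use c A in auto)
  moreover have "A * A' + B' * B = 1\<^sub>m n"
  proof (rule eq_matI)
    fix i j assume "i < dim_row (1\<^sub>m n :: complex mat)" "j < dim_col (1\<^sub>m n :: complex mat)"
    then have ij: "i < n" "j < n" by auto
    have "(A * A' + B' * B) $$ (i, j) = (\<Sum>k<p. C $$ (i, k) * C' $$ (k, j))
        + (\<Sum>k<n - p. C $$ (i, p + k) * C' $$ (p + k, j))"
      using ij c A C(1,5) by (simp add: scalar_prod_def atLeast0LessThan A'_def B_def B'_def)
    also have "(\<Sum>k<n - p. C $$ (i, p + k) * C' $$ (p + k, j)) = (\<Sum>k\<in>{p..<n}. C $$ (i, k) * C' $$ (k, j))"
      by (rule sum.reindex_bij_witness[of _ "\<lambda>k. k - p" "\<lambda>k. p + k"]) auto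
    also have "(\<Sum>k<p. C $$ (i, k) * C' $$ (k, j)) + (\<Sum>k\<in>{p..<n}. C $$ (i, k) * C' $$ (k, j))
        = (\<Sum>k<n. C $$ (i, k) * C' $$ (k, j))"
      using sum.atLeastLessThan_concat[of 0 p n "\<lambda>k. C $$ (i, k) * C' $$ (k, j)"] C(1)
      by (simp add: atLeast0LessThan)
    finally show "(A * A' + B' * B) $$ (i, j) = 1\<^sub>m n $$ (i, j)" using e2 ij by simp
  qed (use c A in auto)
  ultimately have "split_exact A B A' B'" unfolding split_exact_def using A c by simp
  then show thesis using that[OF A(1) c(2) c(1) c(3) _ A(3)] C(1) by simp
qed

definition invariant_subspace :: "'a monoid \<Rightarrow> 'a rep \<Rightarrow> complex vec set \<Rightarrow> bool" where
  "invariant_subspace H V T \<longleftrightarrow> vec_subspace (fst V) T \<and> (\<forall>h\<in>carrier H. \<forall>v\<in>T. snd V h *\<^sub>v v \<in> T)"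

lemma invariant_subspace_image:
  assumes U: "U \<in> reps H" and V: "V \<in> reps H" and E: "E \<in> module_hom H U V"
  shows "invariant_subspace H V ((\<lambda>v. E *\<^sub>v v) ` carrier_vec (fst U))" (is "invariant_subspace H V ?I")
  unfolding invariant_subspace_def vec_subspace_def
proof (intro conjI ballI allI)
  note Ec = module_homD(1)[OF E]
  show "?I \<subseteq> carrier_vec (fst V)" using Ec by auto
  have "E *\<^sub>v 0\<^sub>v (fst U) = 0\<^sub>v (fst V)" using Ec by auto
  then show "0\<^sub>v (fst V) \<in> ?I" by (metis imageI zero_carrier_vec)
  fix v assume "v \<in> ?I"
  then obtain x where x: "x \<in> carrier_vec (fst U)" "v = E *\<^sub>v x" by auto
  show "v + w \<in> ?I" if "w \<in> ?I" for w
  proof -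
    obtain y where y: "y \<in> carrier_vec (fst U)" "w = E *\<^sub>v y" using \<open>w \<in> ?I\<close> by auto
    then have "v + w = E *\<^sub>v (x + y)" using mult_add_distrib_mat_vec[OF Ec x(1) y(1)] x by simp
    then show ?thesis using x y by auto
  qed
  show "c \<cdot>\<^sub>v v \<in> ?I" for c
  proof -
    have "c \<cdot>\<^sub>v v = E *\<^sub>v (c \<cdot>\<^sub>v x)" using mult_mat_vec[OF Ec x(1)] x by simp
    then show ?thesis using x by auto
  qed
  fix h assume h: "h \<in> carrier H"
  note u = repsD(1)[OF U h] and v = repsD(1)[OF V h]
  have "snd V h *\<^sub>v v = (snd V h * E) *\<^sub>v x" using assoc_mult_mat_vec[OF v Ec x(1)] x by simp
  also have "\<dots> = E *\<^sub>v (snd U h *\<^sub>v x)"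
    unfolding module_homD(2)[OF E h, symmetric] by (rule assoc_mult_mat_vec[OF Ec u x(1)])
  finally show "snd V h *\<^sub>v v \<in> ?I" using mult_mat_vec_carrier[OF u x(1)] by auto
qed

text \<open>The sequence of the submodule \<open>T\<close> and the quotient by it. In the coordinates of a linear
  splitting the actions on these are \<open>A' \<rho> A\<close> and \<open>B \<rho> B'\<close>; invariance of \<open>T\<close> means that \<open>\<rho> A\<close> factors through
  \<open>A\<close>, equivalently \<open>B \<rho> A = 0\<close>, and this makes both of them multiplicative.\<close>

lemma invariant_subspace_short_exact:
  assumes V: "V \<in> reps H" and T: "invariant_subspace H V T"
  obtains V' V'' A where "V' \<in> reps H" "V'' \<in> reps H" "short_exact H V' V V''"
    "fst V' + fst V'' = fst V" "A \<in> module_hom H V' V" "injective_mat A"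
    "(\<lambda>v. A *\<^sub>v v) ` carrier_vec (fst V') = T"
proof -
  define n \<rho> where "n = fst V" and "\<rho> = snd V"
  note \<rho> = repsD[OF V, folded n_def \<rho>_def]
  have Ts: "vec_subspace n T" and inv: "\<And>h v. h \<in> carrier H \<Longrightarrow> v \<in> T \<Longrightarrow> \<rho> h *\<^sub>v v \<in> T"
    using T unfolding invariant_subspace_def n_def \<rho>_def by auto
  obtain p q A B A' B' where A: "A \<in> carrier_mat n p" and B: "B \<in> carrier_mat q n"
    and A': "A' \<in> carrier_mat p n" and B': "B' \<in> carrier_mat n q" and s: "split_exact A B A' B'"
    and im: "(\<lambda>v. A *\<^sub>v v) ` carrier_vec p = T" and pq: "p + q = n"
    using subspace_split_exact[OF Ts] .
  have s': "A' * A = 1\<^sub>m p" "B * B' = 1\<^sub>m q" "B * A = 0\<^sub>m q p" "A * A' + B' * B = 1\<^sub>m n"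
    using s A B unfolding split_exact_def by auto
  have \<rho>A: "A * (A' * \<rho> h * A) = \<rho> h * A" "B * \<rho> h * A = 0\<^sub>m q p" if h: "h \<in> carrier H" for h
  proof -
    have r: "\<rho> h \<in> carrier_mat n n" using \<rho> h by blast
    have rA: "\<rho> h * A \<in> carrier_mat n p" using r A by simp
    obtain Z where Z: "Z \<in> carrier_mat p p" "\<rho> h * A = A * Z"
    proof (rule factor_through_image[OF A rA])
      fix j assume j: "j < p"
      have "A *\<^sub>v unit_vec p j \<in> T" using im by auto
      then have "\<rho> h *\<^sub>v (A *\<^sub>v unit_vec p j) \<in> T" using inv h by blast
      moreover have "col (\<rho> h * A) j = \<rho> h *\<^sub>v (A *\<^sub>v unit_vec p j)"
        using col_mult2[OF r A j] col_mult2[OF A one_carrier_mat j] A j by simp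
      ultimately show "col (\<rho> h * A) j \<in> (\<lambda>v. A *\<^sub>v v) ` carrier_vec p" using im by simp
    qed
    have "A' * \<rho> h * A = A' * (A * Z)" using assoc_mult_mat[OF A' r A] Z by simp
    also have "\<dots> = Z" using assoc_mult_mat[OF A' A Z(1)] s'(1) Z by simp
    finally show "A * (A' * \<rho> h * A) = \<rho> h * A" using Z by simp
    have "B * \<rho> h * A = B * (A * Z)" using assoc_mult_mat[OF B r A] Z by simp
    then show "B * \<rho> h * A = 0\<^sub>m q p" using assoc_mult_mat[OF B A Z(1)] s'(3) Z by simp
  qed
  have \<rho>B: "B * \<rho> h * B' * B = B * \<rho> h" if h: "h \<in> carrier H" for h
  proof -
    have r: "\<rho> h \<in> carrier_mat n n" using \<rho> h by blast
    have Br: "B * \<rho> h \<in> carrier_mat q n" using B r by simp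
    have "B * \<rho> h = B * \<rho> h * (A * A' + B' * B)" unfolding s'(4) by (rule right_mult_one_mat[OF Br, symmetric])
    also have "\<dots> = B * \<rho> h * (A * A') + B * \<rho> h * (B' * B)"
      by (rule mult_add_distrib_mat[OF Br mult_carrier_mat[OF A A'] mult_carrier_mat[OF B' B]])
    also have "B * \<rho> h * (A * A') = 0\<^sub>m q n"
      unfolding assoc_mult_mat[OF Br A A', symmetric] \<rho>A(2)[OF h] by (rule left_mult_zero_mat[OF A'])
    also have "B * \<rho> h * (B' * B) = B * \<rho> h * B' * B"
      by (rule assoc_mult_mat[OF Br B' B, symmetric])
    also have "0\<^sub>m q n + B * \<rho> h * B' * B = B * \<rho> h * B' * B"
      by (rule left_add_zero_mat) (use Br B B' in auto)
    finally show ?thesis by (rule sym)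
  qed
  define V' where "V' = (p, \<lambda>h. A' * \<rho> h * A)"
  define V'' where "V'' = (q, \<lambda>h. B * \<rho> h * B')"
  have V': "V' \<in> reps H" unfolding V'_def
  proof (rule repsI)
    fix h k assume hk: "h \<in> carrier H" "k \<in> carrier H"
    have r: "\<rho> h \<in> carrier_mat n n" "\<rho> k \<in> carrier_mat n n" using \<rho> hk by auto
    have "A' * \<rho> (h \<otimes>\<^bsub>H\<^esub> k) * A = A' * \<rho> h * (\<rho> k * A)"
      unfolding \<rho>(3)[OF hk] assoc_mult_mat[OF A' r, symmetric]
      by (rule assoc_mult_mat[OF mult_carrier_mat[OF A' r(1)] r(2) A])
    also have "\<dots> = A' * \<rho> h * (A * (A' * \<rho> k * A))" using \<rho>A(1)[OF hk(2)] by simp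
    also have "\<dots> = A' * \<rho> h * A * (A' * \<rho> k * A)"
      by (rule assoc_mult_mat[symmetric, of _ p n _ p _ p]) (use r A A' in auto)
    finally show "A' * \<rho> (h \<otimes>\<^bsub>H\<^esub> k) * A = A' * \<rho> h * A * (A' * \<rho> k * A)" .
  qed (use \<rho> A A' s' in auto)
  have V'': "V'' \<in> reps H" unfolding V''_def
  proof (rule repsI)
    fix h k assume hk: "h \<in> carrier H" "k \<in> carrier H"
    have r: "\<rho> h \<in> carrier_mat n n" "\<rho> k \<in> carrier_mat n n" using \<rho> hk by auto
    have "B * \<rho> (h \<otimes>\<^bsub>H\<^esub> k) * B' = B * \<rho> h * (\<rho> k * B')"
      unfolding \<rho>(3)[OF hk] assoc_mult_mat[OF B r, symmetric]
      by (rule assoc_mult_mat[OF mult_carrier_mat[OF B r(1)] r(2) B'])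
    also have "\<dots> = B * \<rho> h * B' * B * (\<rho> k * B')" using \<rho>B[OF hk(1)] by simp
    also have "\<dots> = B * \<rho> h * B' * (B * (\<rho> k * B'))"
      by (rule assoc_mult_mat[of _ q q _ n _ q]) (use r B B' in auto)
    also have "B * (\<rho> k * B') = B * \<rho> k * B'"
      by (rule assoc_mult_mat[symmetric, of _ q n _ n _ q]) (use r B B' in auto)
    finally show "B * \<rho> (h \<otimes>\<^bsub>H\<^esub> k) * B' = B * \<rho> h * B' * (B * \<rho> k * B')" .
  qed (use \<rho> B B' s' in auto)
  have Ah: "A \<in> module_hom H V' V"
    using A \<rho>A(1) by (intro module_homI) (auto simp: V'_def n_def \<rho>_def)
  have Bh: "B \<in> module_hom H V V''"
    using B \<rho>B by (intro module_homI) (auto simp: V''_def n_def \<rho>_def)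
  have "short_exact H V' V V''"
    by (rule short_exactI[OF Ah Bh _ _ s]) (use A' B' in \<open>auto simp: V'_def V''_def n_def\<close>)
  moreover have "injective_mat A" using injective_mat_left_inverse[OF A A' s'(1)] .
  ultimately show thesis using that[OF V' V'' _ _ Ah] im pq by (simp add: V'_def V''_def n_def)
qed

section \<open>Irreducible modules and Schur's lemma\<close>

lemma mult_unit_vec: "A \<in> carrier_mat n p \<Longrightarrow> j < p \<Longrightarrow> A *\<^sub>v unit_vec p j = col (A :: complex mat) j"
  using col_mult2[of A n p "1\<^sub>m p" p j] by simp

definition irreducible_rep :: "'a monoid \<Rightarrow> 'a rep \<Rightarrow> bool" where
  "irreducible_rep H V \<longleftrightarrow> 0 < fst V \<and>
     (\<forall>T. invariant_subspace H V T \<longrightarrow> T = {0\<^sub>v (fst V)} \<or> T = carrier_vec (fst V))"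

text \<open>The eigenspace of any eigenvalue of \<open>Z\<close> is a nonzero invariant subspace.\<close>

lemma schur:
  assumes V: "V \<in> reps H" "irreducible_rep H V" and Z: "Z \<in> module_hom H V V"
  obtains c where "Z = c \<cdot>\<^sub>m 1\<^sub>m (fst V)"
proof -
  define n where "n = fst V"
  note V = V[unfolded irreducible_rep_def, folded n_def]
  have Zc: "Z \<in> carrier_mat n n" using module_homD(1)[OF Z] by (simp add: n_def)
  obtain c where "c \<in> spectrum Z" using spectrum_non_empty[OF Zc] V by blast
  then obtain u where u: "u \<in> carrier_vec n" "u \<noteq> 0\<^sub>v n" "Z *\<^sub>v u = c \<cdot>\<^sub>v u"
    unfolding spectrum_def eigenvalue_def eigenvector_def using Zc by auto
  define T where "T = {v \<in> carrier_vec n. Z *\<^sub>v v = c \<cdot>\<^sub>v v}"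
  have "invariant_subspace H V T" unfolding invariant_subspace_def vec_subspace_def
  proof (intro conjI ballI allI)
    show "0\<^sub>v (fst V) \<in> T" unfolding T_def n_def[symmetric] using Zc by auto
    fix v assume v: "v \<in> T"
    show "v + w \<in> T" if "w \<in> T" for w
      using v that Zc unfolding T_def by (auto simp: mult_add_distrib_mat_vec smult_add_distrib_vec)
    show "d \<cdot>\<^sub>v v \<in> T" for d
      using v Zc unfolding T_def by (auto simp: mult_mat_vec smult_smult_assoc mult.commute)
    fix h assume h: "h \<in> carrier H"
    have r: "snd V h \<in> carrier_mat n n" using repsD(1)[OF V(1) h] by (simp add: n_def)
    have vc: "v \<in> carrier_vec n" "Z *\<^sub>v v = c \<cdot>\<^sub>v v" using v unfolding T_def by auto
    have "Z *\<^sub>v (snd V h *\<^sub>v v) = (Z * snd V h) *\<^sub>v v" using assoc_mult_mat_vec[OF Zc r vc(1)] by simp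
    also have "\<dots> = snd V h *\<^sub>v (Z *\<^sub>v v)" unfolding module_homD(2)[OF Z h] by (rule assoc_mult_mat_vec[OF r Zc vc(1)])
    also have "\<dots> = c \<cdot>\<^sub>v (snd V h *\<^sub>v v)" unfolding vc(2) using r vc by (simp add: mult_mat_vec)
    finally show "snd V h *\<^sub>v v \<in> T" unfolding T_def using r vc by simp
  qed (auto simp: T_def n_def)
  then have "T = carrier_vec n" using V(2) u unfolding T_def by blast
  then have Zv: "Z *\<^sub>v v = c \<cdot>\<^sub>v v" if "v \<in> carrier_vec n" for v using that unfolding T_def by blast
  have "Z = c \<cdot>\<^sub>m 1\<^sub>m n"
  proof (rule mat_eqI_mult_vec[OF Zc])
    fix v :: "complex vec" assume v: "v \<in> carrier_vec n"
    have "c \<cdot>\<^sub>m 1\<^sub>m n *\<^sub>v v = c \<cdot>\<^sub>v v" using v by (intro eq_vecI) auto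
    then show "Z *\<^sub>v v = c \<cdot>\<^sub>m 1\<^sub>m n *\<^sub>v v" using Zv[OF v] by simp
  qed simp
  then show thesis using that by (simp add: n_def)
qed

lemma reducible_short_exact:
  assumes V: "V \<in> reps H" and red: "\<not> irreducible_rep H V" and pos: "0 < fst V"
  obtains V' V'' A where "V' \<in> reps H" "V'' \<in> reps H" "short_exact H V' V V''"
    "0 < fst V'" "fst V' < fst V" "fst V'' < fst V" "A \<in> module_hom H V' V" "injective_mat A"
proof -
  obtain T where T: "invariant_subspace H V T" "T \<noteq> {0\<^sub>v (fst V)}" "T \<noteq> carrier_vec (fst V)"
    using red pos unfolding irreducible_rep_def by blast
  obtain V' V'' A where V': "V' \<in> reps H" "V'' \<in> reps H" "short_exact H V' V V''"
    and dim: "fst V' + fst V'' = fst V" and A: "A \<in> module_hom H V' V" "injective_mat A"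
    and im: "(\<lambda>v. A *\<^sub>v v) ` carrier_vec (fst V') = T"
    by (rule invariant_subspace_short_exact[OF V T(1)])
  note Ac = module_homD(1)[OF A(1)]
  have "fst V' \<noteq> 0"
  proof
    assume 0: "fst V' = 0"
    have "carrier_vec 0 = {0\<^sub>v 0 :: complex vec}" by auto
    moreover have "A *\<^sub>v 0\<^sub>v (fst V') = 0\<^sub>v (fst V)" using Ac by auto
    ultimately show False using im T(2) 0 by auto
  qed
  moreover have "fst V' \<noteq> fst V"
  proof
    assume eq: "fst V' = fst V"
    have "T = carrier_vec (fst V)"
      using injective_square_mat_surj[OF _ A(2), of "fst V"] Ac im unfolding eq by simp
    then show False using T(3) by simp
  qed
  ultimately show thesis using that[OF V' _ _ _ A] dim by simp
qed

lemma exists_irreducible_subrep: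
  "V \<in> reps H \<Longrightarrow> 0 < fst V \<Longrightarrow>
    \<exists>U A. U \<in> reps H \<and> irreducible_rep H U \<and> A \<in> module_hom H U V \<and> injective_mat A"
proof (induction "fst V" arbitrary: V rule: less_induct)
  case less
  show ?case
  proof (cases "irreducible_rep H V")
    case True
    have "1\<^sub>m (fst V) \<in> module_hom H V V"
      by (rule module_homI) (auto dest!: repsD(1)[OF less.prems(1)])
    moreover have "injective_mat (1\<^sub>m (fst V))" unfolding injective_mat_def by simp
    ultimately show ?thesis using True less.prems by blast
  next
    case False
    obtain V' V'' A where V': "V' \<in> reps H" "0 < fst V'" "fst V' < fst V"
      and A: "A \<in> module_hom H V' V" "injective_mat A"
      using reducible_short_exact[OF less.prems(1) False less.prems(2)] by metis
    note Ac = module_homD(1)[OF A(1)]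
    obtain U B where UB: "U \<in> reps H" "irreducible_rep H U" "B \<in> module_hom H U V'" "injective_mat B"
      using less.hyps V' by blast
    note Bc = module_homD(1)[OF UB(3)]
    have "A * B \<in> module_hom H U V"
    proof (rule module_homI)
      fix h assume h: "h \<in> carrier H"
      note r = repsD(1)[OF UB(1) h] repsD(1)[OF V'(1) h] repsD(1)[OF less.prems(1) h]
      have "A * B * snd U h = A * (snd V' h * B)"
        using assoc_mult_mat[OF Ac Bc r(1)] module_homD(2)[OF UB(3) h] by simp
      also have "\<dots> = snd V h * A * B"
        using assoc_mult_mat[OF Ac r(2) Bc] module_homD(2)[OF A(1) h] by simp
      finally show "A * B * snd U h = snd V h * (A * B)" using assoc_mult_mat[OF r(3) Ac Bc] by simp
    qed (use Ac Bc in simp)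
    then show ?thesis using UB injective_mat_mult[OF A(2) Ac UB(4) Bc] by blast
  qed
qed

lemma mult_add_less_mult:
  fixes j l :: nat assumes "j < r" "l < m" shows "j * m + l < r * m"
proof -
  have "j * m + l < Suc j * m" using assms by simp
  also have "\<dots> \<le> r * m" using assms by (intro mult_le_mono1) simp
  finally show ?thesis .
qed

text \<open>With the indices \<open>j * m + l\<close> the matrix \<open>1 \<otimes> S\<close> is block diagonal with \<open>r\<close> blocks \<open>S\<close>. It is the
  action on a sum of \<open>r\<close> copies of a module of dimension \<open>m\<close>.\<close>

lemma kronecker_one_index:
  assumes S: "S \<in> carrier_mat m m" and "i < r" "k < m" "j < r" "l < m"
  shows "kronecker (1\<^sub>m r) S $$ (i * m + k, j * m + l) = (if i = j then S $$ (k, l) else 0)"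
proof -
  have "i * m + k < r * m" "j * m + l < r * m" 
    using assms by (simp_all add: mult_add_less_mult)
  then show ?thesis using assms kronecker_index[OF one_carrier_mat S, of "i * m + k" r "j * m + l"] by simp
qed

lemma mult_kronecker_one_index:
  assumes N: "N \<in> carrier_mat n (r * m)" and S: "S \<in> carrier_mat m m"
    and i: "i < n" and j: "j < r" and l: "l < m"
  shows "(N * kronecker (1\<^sub>m r) S) $$ (i, j * m + l) = (\<Sum>k<m. N $$ (i, j * m + k) * S $$ (k, l))"
proof -
  let ?K = "kronecker (1\<^sub>m r) S"
  have K: "?K \<in> carrier_mat (r * m) (r * m)" using kronecker_carrier[OF one_carrier_mat S] .
  have jl: "j * m + l < r * m" using mult_add_less_mult[OF j l] .
  have "(N * ?K) $$ (i, j * m + l) = (\<Sum>q<r * m. N $$ (i, q) * ?K $$ (q, j * m + l))"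
    using N K i jl by (simp add: scalar_prod_def atLeast0LessThan)
  also have "\<dots> = (\<Sum>q<r * m. N $$ (i, q div m * m + q mod m) * ?K $$ (q div m * m + q mod m, j * m + l))"
    by simp
  also have "\<dots> = (\<Sum>j'<r. \<Sum>k<m. N $$ (i, j' * m + k) * ?K $$ (j' * m + k, j * m + l))"
    by (rule sum_div_mod[of "\<lambda>j' k. N $$ (i, j' * m + k) * ?K $$ (j' * m + k, j * m + l)"])
  also have "\<dots> = (\<Sum>j'<r. if j' = j then (\<Sum>k<m. N $$ (i, j' * m + k) * S $$ (k, l)) else 0)"
    by (intro sum.cong refl) (use kronecker_one_index[OF S _ _ j l] in auto)
  also have "\<dots> = (\<Sum>k<m. N $$ (i, j * m + k) * S $$ (k, l))" using j by simp
  finally show ?thesis .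
qed

lemma mult_hcat:
  assumes R: "R \<in> carrier_mat k n" and E: "E \<in> carrier_mat n p" and Y: "Y \<in> carrier_mat n m"
  shows "R * hcat E Y = hcat (R * E) (R * Y)"
proof (rule eq_matI)
  note h = hcat_carrier[OF E Y] and RE = mult_carrier_mat[OF R E] and RY = mult_carrier_mat[OF R Y]
  note h' = hcat_carrier[OF RE RY]
  fix i j assume "i < dim_row (hcat (R * E) (R * Y))" "j < dim_col (hcat (R * E) (R * Y))"
  then have ij: "i < k" "j < p + m" using h' by auto
  have "(R * hcat E Y) $$ (i, j) = (\<Sum>x<n. R $$ (i, x) * hcat E Y $$ (x, j))"
    using R h ij by (simp add: scalar_prod_def atLeast0LessThan)
  also have "\<dots> = (\<Sum>x<n. R $$ (i, x) * (if j < p then E $$ (x, j) else Y $$ (x, j - p)))"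
    using hcat_index[OF E Y _ ij(2)] by simp
  also have "\<dots> = hcat (R * E) (R * Y) $$ (i, j)"
    using hcat_index[OF RE RY ij] R E Y ij by (simp add: scalar_prod_def atLeast0LessThan)
  finally show "(R * hcat E Y) $$ (i, j) = hcat (R * E) (R * Y) $$ (i, j)" .
qed (use hcat_carrier[OF E Y] hcat_carrier[OF mult_carrier_mat[OF R E] mult_carrier_mat[OF R Y]] R in auto)

lemma hcat_mult_kronecker_one:
  assumes E: "E \<in> carrier_mat n (r * m)" and Y: "Y \<in> carrier_mat n m" and S: "S \<in> carrier_mat m m"
  shows "hcat E Y * kronecker (1\<^sub>m (Suc r)) S = hcat (E * kronecker (1\<^sub>m r) S) (Y * S)"
proof (rule eq_matI)
  have h: "hcat E Y \<in> carrier_mat n (Suc r * m)" using hcat_carrier[OF E Y] by (simp add: add.commute)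
  note EK = mult_carrier_mat[OF E kronecker_carrier[OF one_carrier_mat S]] and YS = mult_carrier_mat[OF Y S]
  note h' = hcat_carrier[OF EK YS]
  fix i q assume "i < dim_row (hcat (E * kronecker (1\<^sub>m r) S) (Y * S))"
    "q < dim_col (hcat (E * kronecker (1\<^sub>m r) S) (Y * S))"
  then have i: "i < n" and q: "q < r * m + m" using h' by auto
  then have q': "q < Suc r * m" by (simp add: add.commute)
  define j l where "j = q div m" and "l = q mod m"
  have jl: "j < Suc r" "l < m" "q = j * m + l" using div_mod_less_mult[OF q'] unfolding j_def l_def by auto
  have lhs: "(hcat E Y * kronecker (1\<^sub>m (Suc r)) S) $$ (i, q) = (\<Sum>k<m. hcat E Y $$ (i, j * m + k) * S $$ (k, l))"
    unfolding jl(3) by (rule mult_kronecker_one_index[OF h S i jl(1,2)])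
  show "(hcat E Y * kronecker (1\<^sub>m (Suc r)) S) $$ (i, q) = hcat (E * kronecker (1\<^sub>m r) S) (Y * S) $$ (i, q)"
  proof (cases "j < r")
    case True
    have lt: "j * m + k < r * m" if "k < m" for k using mult_add_less_mult[OF True that] .
    have "hcat E Y $$ (i, j * m + k) = E $$ (i, j * m + k)" if "k < m" for k
      using hcat_index[OF E Y i, of "j * m + k"] lt[OF that] by simp
    moreover have "hcat (E * kronecker (1\<^sub>m r) S) (Y * S) $$ (i, q) = (E * kronecker (1\<^sub>m r) S) $$ (i, j * m + l)"
      using hcat_index[OF EK YS i q] lt[OF jl(2)] jl(3) by simp
    ultimately show ?thesis unfolding lhs using mult_kronecker_one_index[OF E S i True jl(2)] by simp
  next
    case False
    then have j: "j = r" using jl(1) by simp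
    have "hcat E Y $$ (i, j * m + k) = Y $$ (i, k)" if "k < m" for k
      using hcat_index[OF E Y i, of "j * m + k"] that j by simp
    moreover have "hcat (E * kronecker (1\<^sub>m r) S) (Y * S) $$ (i, q) = (Y * S) $$ (i, l)"
      using hcat_index[OF EK YS i q] jl(3) j by simp
    ultimately show ?thesis unfolding lhs using Y S i jl(2) by (simp add: scalar_prod_def atLeast0LessThan)
  qed
qed (use hcat_carrier[OF E Y] kronecker_carrier[OF one_carrier_mat[of "Suc r"] S]
      hcat_carrier[OF mult_carrier_mat[OF E kronecker_carrier[OF one_carrier_mat S]] mult_carrier_mat[OF Y S]]
    in \<open>auto simp: add.commute\<close>)

lemma kronecker_one_mult_index:
  assumes N: "N \<in> carrier_mat (r * m) n" and S: "S \<in> carrier_mat m m"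
    and i: "i < n" and j: "j < r" and l: "l < m"
  shows "(kronecker (1\<^sub>m r) S * N) $$ (j * m + l, i) = (\<Sum>k<m. S $$ (l, k) * N $$ (j * m + k, i))"
proof -
  let ?K = "kronecker (1\<^sub>m r) S"
  have K: "?K \<in> carrier_mat (r * m) (r * m)" using kronecker_carrier[OF one_carrier_mat S] .
  have jl: "j * m + l < r * m" using mult_add_less_mult[OF j l] .
  have "(?K * N) $$ (j * m + l, i) = (\<Sum>q<r * m. ?K $$ (j * m + l, q) * N $$ (q, i))"
    using N K i jl by (simp add: scalar_prod_def atLeast0LessThan)
  also have "\<dots> = (\<Sum>q<r * m. ?K $$ (j * m + l, q div m * m + q mod m) * N $$ (q div m * m + q mod m, i))"
    by simp
  also have "\<dots> = (\<Sum>j'<r. \<Sum>k<m. ?K $$ (j * m + l, j' * m + k) * N $$ (j' * m + k, i))"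
    by (rule sum_div_mod[of "\<lambda>j' k. ?K $$ (j * m + l, j' * m + k) * N $$ (j' * m + k, i)"])
  also have "\<dots> = (\<Sum>j'<r. if j' = j then (\<Sum>k<m. S $$ (l, k) * N $$ (j' * m + k, i)) else 0)"
    by (intro sum.cong refl) (use kronecker_one_index[OF S j l] in auto)
  also have "\<dots> = (\<Sum>k<m. S $$ (l, k) * N $$ (j * m + k, i))" using j by simp
  finally show ?thesis .
qed

text \<open>Each of the \<open>m \<times> m\<close> blocks of \<open>Z\<close> commutes with the irreducible action \<open>\<sigma>\<close> and is therefore a
  scalar. These scalars are the entries of \<open>X\<close>.\<close>

lemma commutant_kronecker_one:
  assumes U: "(m, \<sigma>) \<in> reps H" "irreducible_rep H (m, \<sigma>)"
    and Z: "Z \<in> carrier_mat (r * m) (r * m)"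
    and comm: "\<And>h. h \<in> carrier H \<Longrightarrow> Z * kronecker (1\<^sub>m r) (\<sigma> h) = kronecker (1\<^sub>m r) (\<sigma> h) * Z"
  obtains X where "X \<in> carrier_mat r r" "Z = kronecker X (1\<^sub>m m)"
proof -
  define B where "B = (\<lambda>i j. mat m m (\<lambda>(k, l). Z $$ (i * m + k, j * m + l)))"
  have "\<exists>c. B i j = c \<cdot>\<^sub>m 1\<^sub>m m" if i: "i < r" and j: "j < r" for i j
  proof -
    have "B i j \<in> module_hom H (m, \<sigma>) (m, \<sigma>)"
    proof (rule module_homI)
      fix h assume h: "h \<in> carrier H"
      have S: "\<sigma> h \<in> carrier_mat m m" using repsD(1)[OF U(1) h] by simp
      have "B i j * \<sigma> h = \<sigma> h * B i j"
      proof (rule eq_matI)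
        fix k l assume "k < dim_row (\<sigma> h * B i j)" "l < dim_col (\<sigma> h * B i j)"
        then have kl: "k < m" "l < m" using S by (auto simp: B_def)
        have "(B i j * \<sigma> h) $$ (k, l) = (Z * kronecker (1\<^sub>m r) (\<sigma> h)) $$ (i * m + k, j * m + l)"
          using mult_kronecker_one_index[OF Z S mult_add_less_mult[OF i kl(1)] j kl(2)] kl S
          by (simp add: B_def scalar_prod_def atLeast0LessThan)
        also have "\<dots> = (\<sigma> h * B i j) $$ (k, l)"
          unfolding comm[OF h]
          using kronecker_one_mult_index[OF Z S mult_add_less_mult[OF j kl(2)] i kl(1)] kl S
          by (simp add: B_def scalar_prod_def atLeast0LessThan)
        finally show "(B i j * \<sigma> h) $$ (k, l) = (\<sigma> h * B i j) $$ (k, l)" .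
      qed (use S in \<open>auto simp: B_def\<close>)
      then show "B i j * snd (m, \<sigma>) h = snd (m, \<sigma>) h * B i j" by simp
    qed (simp add: B_def)
    then show ?thesis using schur[OF U] by (metis fst_conv)
  qed
  then obtain c where c: "\<And>i j. i < r \<Longrightarrow> j < r \<Longrightarrow> B i j = c i j \<cdot>\<^sub>m 1\<^sub>m m" by metis
  define X where "X = mat r r (\<lambda>(i, j). c i j)"
  have X: "X \<in> carrier_mat r r" unfolding X_def by simp
  have "Z = kronecker X (1\<^sub>m m)"
  proof (rule eq_matI)
    fix p q assume "p < dim_row (kronecker X (1\<^sub>m m))" "q < dim_col (kronecker X (1\<^sub>m m))"
    then have pq: "p < r * m" "q < r * m" using kronecker_carrier[OF X one_carrier_mat[of m]] by auto
    note d = div_mod_less_mult[OF pq(1)] div_mod_less_mult[OF pq(2)]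
    have "Z $$ (p, q) = B (p div m) (q div m) $$ (p mod m, q mod m)" unfolding B_def using d by simp
    also have "\<dots> = kronecker X (1\<^sub>m m) $$ (p, q)"
      using c[OF d(1,3)] kronecker_index[OF X one_carrier_mat[of m] pq] d by (simp add: X_def)
    finally show "Z $$ (p, q) = kronecker X (1\<^sub>m m) $$ (p, q)" .
  qed (use Z kronecker_carrier[OF X one_carrier_mat[of m]] in auto)
  then show thesis using that X by blast
qed

lemma kronecker_one_right_cancel:
  assumes X: "X \<in> carrier_mat r s" and Y: "Y \<in> carrier_mat r s" and m: "0 < m"
    and eq: "kronecker X (1\<^sub>m m) = kronecker Y (1\<^sub>m m)"
  shows "X = Y"
proof (rule eq_matI)
  fix i j assume "i < dim_row Y" "j < dim_col Y"
  then have ij: "i < r" "j < s" using Y by auto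
  have "i * m < r * m" "j * m < s * m" using ij m by auto
  then show "X $$ (i, j) = Y $$ (i, j)"
    using arg_cong[OF eq, of "\<lambda>A. A $$ (i * m, j * m)"] m
    by (simp add: kronecker_index[OF X one_carrier_mat] kronecker_index[OF Y one_carrier_mat])
qed (use X Y in auto)

section \<open>Irreducible modules of direct products\<close>

lemma reps_DirProd_restrict:
  assumes A: "group A" and B: "group B" and V: "(n, \<rho>) \<in> reps (A \<times>\<times> B)"
  shows "a \<in> carrier A \<Longrightarrow> b \<in> carrier B \<Longrightarrow> \<rho> (a, b) \<in> carrier_mat n n"
    and "(n, \<lambda>b. \<rho> (\<one>\<^bsub>A\<^esub>, b)) \<in> reps B"
    and "(n, \<lambda>a. \<rho> (a, \<one>\<^bsub>B\<^esub>)) \<in> reps A"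
    and "a \<in> carrier A \<Longrightarrow> b \<in> carrier B \<Longrightarrow> \<rho> (a, \<one>\<^bsub>B\<^esub>) * \<rho> (\<one>\<^bsub>A\<^esub>, b) = \<rho> (a, b)"
    and "a \<in> carrier A \<Longrightarrow> b \<in> carrier B \<Longrightarrow> \<rho> (\<one>\<^bsub>A\<^esub>, b) * \<rho> (a, \<one>\<^bsub>B\<^esub>) = \<rho> (a, b)"
proof -
  interpret A: group A by (rule A)
  interpret B: group B by (rule B)
  have mult: "\<rho> (a \<otimes>\<^bsub>A\<^esub> a', b \<otimes>\<^bsub>B\<^esub> b') = \<rho> (a, b) * \<rho> (a', b')"
    if "a \<in> carrier A" "a' \<in> carrier A" "b \<in> carrier B" "b' \<in> carrier B" for a a' b b'
    using repsD(3)[OF V, of "(a, b)" "(a', b')"] that by simp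
  have one: "\<rho> (\<one>\<^bsub>A\<^esub>, \<one>\<^bsub>B\<^esub>) = 1\<^sub>m n" using repsD(2)[OF V] by simp
  show c: "a \<in> carrier A \<Longrightarrow> b \<in> carrier B \<Longrightarrow> \<rho> (a, b) \<in> carrier_mat n n" for a b
    using repsD(1)[OF V, of "(a, b)"] by simp
  show "(n, \<lambda>b. \<rho> (\<one>\<^bsub>A\<^esub>, b)) \<in> reps B"
    by (rule repsI) (use c one mult[of "\<one>\<^bsub>A\<^esub>" "\<one>\<^bsub>A\<^esub>"] in auto)
  show "(n, \<lambda>a. \<rho> (a, \<one>\<^bsub>B\<^esub>)) \<in> reps A"
    by (rule repsI) (use c one mult[of _ _ "\<one>\<^bsub>B\<^esub>" "\<one>\<^bsub>B\<^esub>"] in auto)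
  show "a \<in> carrier A \<Longrightarrow> b \<in> carrier B \<Longrightarrow> \<rho> (a, \<one>\<^bsub>B\<^esub>) * \<rho> (\<one>\<^bsub>A\<^esub>, b) = \<rho> (a, b)"
    using mult[of a "\<one>\<^bsub>A\<^esub>" "\<one>\<^bsub>B\<^esub>" b] by simp
  show "a \<in> carrier A \<Longrightarrow> b \<in> carrier B \<Longrightarrow> \<rho> (\<one>\<^bsub>A\<^esub>, b) * \<rho> (a, \<one>\<^bsub>B\<^esub>) = \<rho> (a, b)"
    using mult[of "\<one>\<^bsub>A\<^esub>" a b "\<one>\<^bsub>B\<^esub>"] by simp
qed

definition outer_tensor :: "'a rep \<Rightarrow> 'b rep \<Rightarrow> ('a \<times> 'b) rep" where
  "outer_tensor V W = (fst V * fst W, \<lambda>(a, b). kronecker (snd V a) (snd W b))"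

lemma outer_tensor_reps:
  assumes V: "V \<in> reps A" and W: "W \<in> reps B"
  shows "outer_tensor V W \<in> reps (A \<times>\<times> B)"
  unfolding outer_tensor_def
proof (rule repsI)
  show "(\<lambda>(a, b). kronecker (snd V a) (snd W b)) \<one>\<^bsub>A \<times>\<times> B\<^esub> = 1\<^sub>m (fst V * fst W)"
    using repsD(2)[OF V] repsD(2)[OF W] kronecker_one by simp
  fix h assume h: "h \<in> carrier (A \<times>\<times> B)"
  then show "(\<lambda>(a, b). kronecker (snd V a) (snd W b)) h \<in> carrier_mat (fst V * fst W) (fst V * fst W)"
    using kronecker_carrier[OF repsD(1)[OF V] repsD(1)[OF W]] by auto
  fix k assume k: "k \<in> carrier (A \<times>\<times> B)"
  show "(\<lambda>(a, b). kronecker (snd V a) (snd W b)) (h \<otimes>\<^bsub>A \<times>\<times> B\<^esub> k)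
    = (\<lambda>(a, b). kronecker (snd V a) (snd W b)) h * (\<lambda>(a, b). kronecker (snd V a) (snd W b)) k"
  proof -
    obtain a b a' b' where hk: "h = (a, b)" "k = (a', b')" and ab: "a \<in> carrier A" "b \<in> carrier B"
      "a' \<in> carrier A" "b' \<in> carrier B" using h k by auto
    show ?thesis unfolding hk
      using kronecker_mult[OF repsD(1)[OF V ab(1)] repsD(1)[OF W ab(2)] repsD(1)[OF V ab(3)] repsD(1)[OF W ab(4)]]
        repsD(3)[OF V ab(1,3)] repsD(3)[OF W ab(2,4)] by simp
  qed
qed

text \<open>The blocks of \<open>E\<close> form a basis of the space of \<open>B\<close>-homomorphisms from \<open>U\<close> to \<open>V\<close>, and \<open>W\<close> is the
  action of \<open>A\<close> on this space in the coordinates of that basis.\<close>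

lemma irreducible_rep_DirProd:
  assumes A: "group A" and B: "group B" and V: "V \<in> reps (A \<times>\<times> B)" "irreducible_rep (A \<times>\<times> B) V"
  obtains U W E where "W \<in> reps A" "U \<in> reps B" "E \<in> module_hom (A \<times>\<times> B) (outer_tensor W U) V"
    "injective_mat E" "(\<lambda>v. E *\<^sub>v v) ` carrier_vec (fst W * fst U) = carrier_vec (fst V)"
proof -
  interpret A: group A by (rule A)
  interpret B: group B by (rule B)
  obtain n \<rho> where Vn: "V = (n, \<rho>)" by (cases V)
  note R = reps_DirProd_restrict[OF A B V(1)[unfolded Vn]]
  let ?R = "(n, \<lambda>b. \<rho> (\<one>\<^bsub>A\<^esub>, b))"
  have n: "0 < n" using V(2) unfolding irreducible_rep_def Vn by simp
  obtain U Y where U: "U \<in> reps B" "irreducible_rep B U" and Y: "Y \<in> module_hom B U ?R" "injective_mat Y"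
    using exists_irreducible_subrep[OF R(2)] n by auto
  obtain m \<sigma> where Um: "U = (m, \<sigma>)" by (cases U)
  have m: "0 < m" using U(2) unfolding irreducible_rep_def Um by simp
  have S: "\<sigma> b \<in> carrier_mat m m" if "b \<in> carrier B" for b using repsD(1)[OF U(1) that] by (simp add: Um)
  have KS: "kronecker (1\<^sub>m r) (\<sigma> b) \<in> carrier_mat (r * m) (r * m)" if "b \<in> carrier B" for r b
    using kronecker_carrier[OF one_carrier_mat S[OF that]] .
  \<comment> \<open>\<open>P r\<close>: the restriction to \<open>B\<close> contains a direct sum of \<open>r\<close> copies of \<open>U\<close>\<close>
  define P where "P = (\<lambda>r. \<exists>E. E \<in> carrier_mat n (r * m) \<and> injective_mat E \<and>
    (\<forall>b\<in>carrier B. E * kronecker (1\<^sub>m r) (\<sigma> b) = \<rho> (\<one>\<^bsub>A\<^esub>, b) * E))"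
  have "P 0" unfolding P_def
  proof (intro exI conjI ballI)
    show "0\<^sub>m n 0 \<in> carrier_mat n (0 * m)" by simp
    show "injective_mat (0\<^sub>m n 0)" unfolding injective_mat_def by auto
    show "0\<^sub>m n 0 * kronecker (1\<^sub>m 0) (\<sigma> b) = \<rho> (\<one>\<^bsub>A\<^esub>, b) * 0\<^sub>m n 0" if "b \<in> carrier B" for b
      using KS[OF that, of 0] R(1)[OF A.one_closed that] by (intro eq_matI) auto
  qed
  moreover have "r \<le> n" if "P r" for r
  proof -
    have "r * m \<le> n" using that injective_mat_dim_le unfolding P_def by blast
    then show ?thesis using m by (metis Suc_leI le_trans mult.right_neutral mult_le_mono2 One_nat_def)
  qed
  ultimately obtain r where r: "P r" "\<And>r'. P r' \<Longrightarrow> r' \<le> r"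
    using Greatest_le_nat[of P _ n] GreatestI_nat[of P _ n] by blast
  obtain E where E: "E \<in> carrier_mat n (r * m)" "injective_mat E"
    and EB: "\<And>b. b \<in> carrier B \<Longrightarrow> E * kronecker (1\<^sub>m r) (\<sigma> b) = \<rho> (\<one>\<^bsub>A\<^esub>, b) * E"
    using r(1) unfolding P_def by blast
  let ?I = "(\<lambda>v. E *\<^sub>v v) ` carrier_vec (r * m)"
  have hom_image: "Y *\<^sub>v w \<in> ?I" if Y: "Y \<in> module_hom B U ?R" and w: "w \<in> carrier_vec m" for Y w
  proof -
    have Yc: "Y \<in> carrier_mat n m" using module_homD(1)[OF Y] by (simp add: Um)
    \<comment> \<open>the part of \<open>U\<close> that \<open>Y\<close> maps into the image of \<open>E\<close>; it is either zero or everything\<close>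
    define T where "T = {w \<in> carrier_vec m. Y *\<^sub>v w \<in> ?I}"
    have "invariant_subspace B U T" unfolding invariant_subspace_def vec_subspace_def Um fst_conv snd_conv
    proof (intro conjI ballI allI)
      have "Y *\<^sub>v 0\<^sub>v m = E *\<^sub>v 0\<^sub>v (r * m)" using Yc E by auto
      then show "0\<^sub>v m \<in> T" unfolding T_def by auto
      fix v assume "v \<in> T"
      then obtain x where v: "v \<in> carrier_vec m" and x: "x \<in> carrier_vec (r * m)" "Y *\<^sub>v v = E *\<^sub>v x"
        unfolding T_def by auto
      show "v + w \<in> T" if "w \<in> T" for w
      proof -
        obtain y where w: "w \<in> carrier_vec m" and y: "y \<in> carrier_vec (r * m)" "Y *\<^sub>v w = E *\<^sub>v y"
          using \<open>w \<in> T\<close> unfolding T_def by auto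
        have "Y *\<^sub>v (v + w) = E *\<^sub>v (x + y)"
          using mult_add_distrib_mat_vec[OF Yc v w] mult_add_distrib_mat_vec[OF E(1) x(1) y(1)] x y by simp
        then show ?thesis unfolding T_def using v w x y by auto
      qed
      show "c \<cdot>\<^sub>v v \<in> T" for c
      proof -
        have "Y *\<^sub>v (c \<cdot>\<^sub>v v) = E *\<^sub>v (c \<cdot>\<^sub>v x)"
          using mult_mat_vec[OF Yc v] mult_mat_vec[OF E(1) x(1)] x by simp
        then show ?thesis unfolding T_def using v x by auto
      qed
      fix b assume b: "b \<in> carrier B"
      note rb = R(1)[OF A.one_closed b]
      have "Y *\<^sub>v (\<sigma> b *\<^sub>v v) = (Y * \<sigma> b) *\<^sub>v v" using assoc_mult_mat_vec[OF Yc S[OF b] v] by simp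
      also have "Y * \<sigma> b = \<rho> (\<one>\<^bsub>A\<^esub>, b) * Y" using module_homD(2)[OF Y b] by (simp add: Um)
      also have "\<dots> *\<^sub>v v = \<rho> (\<one>\<^bsub>A\<^esub>, b) *\<^sub>v (E *\<^sub>v x)" using assoc_mult_mat_vec[OF rb Yc v] x by simp
      also have "\<dots> = (\<rho> (\<one>\<^bsub>A\<^esub>, b) * E) *\<^sub>v x" using assoc_mult_mat_vec[OF rb E(1) x(1)] by simp
      also have "\<dots> = E *\<^sub>v (kronecker (1\<^sub>m r) (\<sigma> b) *\<^sub>v x)"
        unfolding EB[OF b, symmetric] by (rule assoc_mult_mat_vec[OF E(1) KS[OF b] x(1)])
      finally have "Y *\<^sub>v (\<sigma> b *\<^sub>v v) = E *\<^sub>v (kronecker (1\<^sub>m r) (\<sigma> b) *\<^sub>v x)" .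
      then show "\<sigma> b *\<^sub>v v \<in> T" unfolding T_def
        using mult_mat_vec_carrier[OF S[OF b] v] mult_mat_vec_carrier[OF KS[OF b] x(1)] by auto
    qed (auto simp: T_def)
    then consider "T = {0\<^sub>v m}" | "T = carrier_vec m" using U(2) unfolding irreducible_rep_def Um by auto
    then show ?thesis
    proof cases
      case 1
      have "injective_mat (hcat E Y)"
        by (rule injective_hcat[OF E Yc]) (use 1 in \<open>auto simp: T_def\<close>)
      moreover have "hcat E Y \<in> carrier_mat n (Suc r * m)"
        using hcat_carrier[OF E(1) Yc] by (simp add: add.commute)
      moreover have "hcat E Y * kronecker (1\<^sub>m (Suc r)) (\<sigma> b) = \<rho> (\<one>\<^bsub>A\<^esub>, b) * hcat E Y"
        if b: "b \<in> carrier B" for b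
        unfolding hcat_mult_kronecker_one[OF E(1) Yc S[OF b]] mult_hcat[OF R(1)[OF A.one_closed b] E(1) Yc]
        using EB[OF b] module_homD(2)[OF Y b] by (simp add: Um)
      ultimately have "P (Suc r)" unfolding P_def by blast
      then show ?thesis using r(2) by fastforce
    next
      case 2
      then show ?thesis using w unfolding T_def by blast
    qed
  qed
  have "\<exists>X. X \<in> carrier_mat r r \<and> \<rho> (a, \<one>\<^bsub>B\<^esub>) * E = E * kronecker X (1\<^sub>m m)" if a: "a \<in> carrier A" for a
  proof -
    note ra = R(1)[OF a B.one_closed]
    define N where "N = \<rho> (a, \<one>\<^bsub>B\<^esub>) * E"
    have N: "N \<in> carrier_mat n (r * m)" unfolding N_def using ra E by simp
    have NB: "N * kronecker (1\<^sub>m r) (\<sigma> b) = \<rho> (\<one>\<^bsub>A\<^esub>, b) * N" if b: "b \<in> carrier B" for b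
    proof -
      note rb = R(1)[OF A.one_closed b]
      have "N * kronecker (1\<^sub>m r) (\<sigma> b) = \<rho> (a, \<one>\<^bsub>B\<^esub>) * (\<rho> (\<one>\<^bsub>A\<^esub>, b) * E)"
        unfolding N_def EB[OF b, symmetric] by (rule assoc_mult_mat[OF ra E(1) KS[OF b]])
      also have "\<dots> = \<rho> (\<one>\<^bsub>A\<^esub>, b) * N"
        unfolding N_def using assoc_mult_mat[OF ra rb E(1)] assoc_mult_mat[OF rb ra E(1)] R(4)[OF a b] R(5)[OF a b]
        by simp
      finally show ?thesis .
    qed
    obtain Z where Z: "Z \<in> carrier_mat (r * m) (r * m)" "N = E * Z"
    proof (rule factor_through_image[OF E(1) N])
      fix q assume q: "q < r * m"
      note d = div_mod_less_mult[OF q]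
      define j where "j = q div m"
      \<comment> \<open>the restriction of \<open>N\<close> to the copy of \<open>U\<close> that contains the column \<open>q\<close>\<close>
      define Yj where "Yj = mat n m (\<lambda>(i, k). N $$ (i, j * m + k))"
      have Yc: "Yj \<in> carrier_mat n m" unfolding Yj_def by simp
      have "Yj \<in> module_hom B U ?R"
      proof (rule module_homI)
        fix b assume b: "b \<in> carrier B"
        note rb = R(1)[OF A.one_closed b]
        have "Yj * \<sigma> b = \<rho> (\<one>\<^bsub>A\<^esub>, b) * Yj"
        proof (rule eq_matI)
          fix i l assume "i < dim_row (\<rho> (\<one>\<^bsub>A\<^esub>, b) * Yj)" "l < dim_col (\<rho> (\<one>\<^bsub>A\<^esub>, b) * Yj)"
          then have il: "i < n" "l < m" using rb Yc by auto
          have jl: "j * m + l < r * m" using mult_add_less_mult d(1) il(2) unfolding j_def by blast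
          have "(Yj * \<sigma> b) $$ (i, l) = (N * kronecker (1\<^sub>m r) (\<sigma> b)) $$ (i, j * m + l)"
            using mult_kronecker_one_index[OF N S[OF b] il(1) d(1) il(2)] il S[OF b]
            by (simp add: Yj_def scalar_prod_def atLeast0LessThan j_def)
          also have "\<dots> = (\<rho> (\<one>\<^bsub>A\<^esub>, b) * Yj) $$ (i, l)"
            unfolding NB[OF b] using N il rb jl by (simp add: Yj_def scalar_prod_def)
          finally show "(Yj * \<sigma> b) $$ (i, l) = (\<rho> (\<one>\<^bsub>A\<^esub>, b) * Yj) $$ (i, l)" .
        qed (use S[OF b] rb Yc in auto)
        then show "Yj * snd U b = snd ?R b * Yj" by (simp add: Um)
      qed (simp add: Yj_def Um)
      then have "Yj *\<^sub>v unit_vec m (q mod m) \<in> ?I" by (rule hom_image) simp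
      moreover have "Yj *\<^sub>v unit_vec m (q mod m) = col N q"
        unfolding mult_unit_vec[OF Yc d(2)] using N q d by (intro eq_vecI) (auto simp: Yj_def j_def)
      ultimately show "col N q \<in> ?I" by simp
    qed
    have "Z * kronecker (1\<^sub>m r) (\<sigma> b) = kronecker (1\<^sub>m r) (\<sigma> b) * Z" if b: "b \<in> carrier B" for b
    proof (rule injective_mat_cancel[OF E(2,1)])
      note rb = R(1)[OF A.one_closed b]
      have "E * (Z * kronecker (1\<^sub>m r) (\<sigma> b)) = \<rho> (\<one>\<^bsub>A\<^esub>, b) * (E * Z)"
        using assoc_mult_mat[OF E(1) Z(1) KS[OF b]] NB[OF b] Z(2) by simp
      also have "\<dots> = E * (kronecker (1\<^sub>m r) (\<sigma> b) * Z)"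
        using assoc_mult_mat[OF rb E(1) Z(1)] assoc_mult_mat[OF E(1) KS[OF b] Z(1)] EB[OF b] by simp
      finally show "E * (Z * kronecker (1\<^sub>m r) (\<sigma> b)) = E * (kronecker (1\<^sub>m r) (\<sigma> b) * Z)" .
    qed (rule mult_carrier_mat[OF Z(1) KS[OF b]], rule mult_carrier_mat[OF KS[OF b] Z(1)])
    then show ?thesis
      using commutant_kronecker_one[OF U[unfolded Um] Z(1)] Z(2) unfolding N_def by metis
  qed
  then obtain \<tau> where \<tau>: "\<And>a. a \<in> carrier A \<Longrightarrow> \<tau> a \<in> carrier_mat r r"
    "\<And>a. a \<in> carrier A \<Longrightarrow> \<rho> (a, \<one>\<^bsub>B\<^esub>) * E = E * kronecker (\<tau> a) (1\<^sub>m m)"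
    by metis
  note K\<tau> = kronecker_carrier[OF \<tau>(1) one_carrier_mat]
  have W: "(r, \<tau>) \<in> reps A"
  proof (rule repsI)
    show "\<tau> \<one>\<^bsub>A\<^esub> = 1\<^sub>m r"
    proof (rule kronecker_one_right_cancel[OF \<tau>(1) one_carrier_mat m])
      show "kronecker (\<tau> \<one>\<^bsub>A\<^esub>) (1\<^sub>m m) = kronecker (1\<^sub>m r) (1\<^sub>m m)"
      proof (rule injective_mat_cancel[OF E(2,1) K\<tau>])
        show "E * kronecker (\<tau> \<one>\<^bsub>A\<^esub>) (1\<^sub>m m) = E * kronecker (1\<^sub>m r) (1\<^sub>m m)"
          using \<tau>(2)[OF A.one_closed] repsD(2)[OF R(3)] E(1) kronecker_one by simp
      qed (use kronecker_carrier in auto)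
    qed simp
    fix a a' assume a: "a \<in> carrier A" and a': "a' \<in> carrier A"
    then have aa': "a \<otimes>\<^bsub>A\<^esub> a' \<in> carrier A" by simp
    note ra = R(1)[OF a B.one_closed] and ra' = R(1)[OF a' B.one_closed]
    show "\<tau> (a \<otimes>\<^bsub>A\<^esub> a') = \<tau> a * \<tau> a'"
    proof (rule kronecker_one_right_cancel[OF \<tau>(1)[OF aa'] mult_carrier_mat[OF \<tau>(1)[OF a] \<tau>(1)[OF a']] m])
      show "kronecker (\<tau> (a \<otimes>\<^bsub>A\<^esub> a')) (1\<^sub>m m) = kronecker (\<tau> a * \<tau> a') (1\<^sub>m m)"
      proof (rule injective_mat_cancel[OF E(2,1) K\<tau>[OF aa']])
        have "E * kronecker (\<tau> (a \<otimes>\<^bsub>A\<^esub> a')) (1\<^sub>m m) = \<rho> (a, \<one>\<^bsub>B\<^esub>) * (\<rho> (a', \<one>\<^bsub>B\<^esub>) * E)"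
          unfolding \<tau>(2)[OF aa', symmetric]
          using repsD(3)[OF R(3) a a'] assoc_mult_mat[OF ra ra' E(1)] by simp
        also have "\<dots> = \<rho> (a, \<one>\<^bsub>B\<^esub>) * E * kronecker (\<tau> a') (1\<^sub>m m)"
          unfolding \<tau>(2)[OF a'] using assoc_mult_mat[OF ra E(1) K\<tau>[OF a']] by simp
        also have "\<dots> = E * (kronecker (\<tau> a) (1\<^sub>m m) * kronecker (\<tau> a') (1\<^sub>m m))"
          unfolding \<tau>(2)[OF a] by (rule assoc_mult_mat[OF E(1) K\<tau>[OF a] K\<tau>[OF a']])
        finally show "E * kronecker (\<tau> (a \<otimes>\<^bsub>A\<^esub> a')) (1\<^sub>m m) = E * kronecker (\<tau> a * \<tau> a') (1\<^sub>m m)"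
          using kronecker_mult[OF \<tau>(1)[OF a] one_carrier_mat \<tau>(1)[OF a'] one_carrier_mat] by simp
      qed (use kronecker_carrier[OF mult_carrier_mat[OF \<tau>(1)[OF a] \<tau>(1)[OF a']] one_carrier_mat] in auto)
    qed
  qed (use \<tau> in auto)
  have Eh: "E \<in> module_hom (A \<times>\<times> B) (outer_tensor (r, \<tau>) U) V"
  proof (rule module_homI)
    fix h assume "h \<in> carrier (A \<times>\<times> B)"
    then obtain a b where ab: "h = (a, b)" "a \<in> carrier A" "b \<in> carrier B" by auto
    note ra = R(1)[OF ab(2) B.one_closed] and rb = R(1)[OF A.one_closed ab(3)]
    have "E * kronecker (\<tau> a) (\<sigma> b) = E * (kronecker (\<tau> a) (1\<^sub>m m) * kronecker (1\<^sub>m r) (\<sigma> b))"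
      using kronecker_mult[OF \<tau>(1)[OF ab(2)] one_carrier_mat one_carrier_mat S[OF ab(3)]]
        \<tau>(1)[OF ab(2)] S[OF ab(3)] by simp
    also have "\<dots> = \<rho> (a, \<one>\<^bsub>B\<^esub>) * E * kronecker (1\<^sub>m r) (\<sigma> b)"
      unfolding \<tau>(2)[OF ab(2)] by (rule assoc_mult_mat[symmetric, OF E(1) K\<tau>[OF ab(2)] KS[OF ab(3)]])
    also have "\<dots> = \<rho> (a, \<one>\<^bsub>B\<^esub>) * (\<rho> (\<one>\<^bsub>A\<^esub>, b) * E)"
      unfolding EB[OF ab(3), symmetric] by (rule assoc_mult_mat[OF ra E(1) KS[OF ab(3)]])
    also have "\<dots> = \<rho> (a, b) * E" using assoc_mult_mat[OF ra rb E(1)] R(4)[OF ab(2,3)] by simp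
    finally show "E * snd (outer_tensor (r, \<tau>) U) h = snd V h * E"
      unfolding outer_tensor_def Um Vn ab by simp
  qed (use E in \<open>simp add: outer_tensor_def Um Vn\<close>)
  have "invariant_subspace (A \<times>\<times> B) V ?I"
    using invariant_subspace_image[OF outer_tensor_reps[OF W U(1)] V(1) Eh] by (simp add: outer_tensor_def Um)
  moreover have "?I \<noteq> {0\<^sub>v n}"
  proof
    assume I: "?I = {0\<^sub>v n}"
    have Yc: "Y \<in> carrier_mat n m" using module_homD(1)[OF Y(1)] by (simp add: Um)
    have "Y *\<^sub>v unit_vec m 0 = 0\<^sub>v n" using hom_image[OF Y(1), of "unit_vec m 0"] I by simp
    then have "unit_vec m 0 = (0\<^sub>v m :: complex vec)" using injective_matD[OF Y(2) Yc] by simp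
    then show False using m by (metis index_unit_vec(1) index_zero_vec(1) zero_neq_one)
  qed
  ultimately have "?I = carrier_vec n" using V(2) unfolding irreducible_rep_def Vn by auto
  then show thesis using that[OF W U(1) Eh E(2)] by (simp add: Um Vn)
qed

section \<open>Quotients of free abelian groups\<close>

lemma rcoset_free_Abelian_group:
  "N #>\<^bsub>free_Abelian_group S\<^esub> x = (\<lambda>n. n + x) ` N"
  unfolding r_coset_def by auto

lemma free_subgroup:
  assumes N: "subgroup N (free_Abelian_group S)"
  shows "0 \<in> N" and "x \<in> N \<Longrightarrow> y \<in> N \<Longrightarrow> x + y \<in> N"
    and "x \<in> N \<Longrightarrow> - x \<in> N" and "x \<in> N \<Longrightarrow> y \<in> N \<Longrightarrow> x - y \<in> N"
    and "x \<in> N \<Longrightarrow> Poly_Mapping.keys x \<subseteq> S"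
proof -
  show z: "0 \<in> N" using subgroup.one_closed[OF N] by simp
  show add: "x \<in> N \<Longrightarrow> y \<in> N \<Longrightarrow> x + y \<in> N" for x y using subgroup.m_closed[OF N] by simp
  show k: "x \<in> N \<Longrightarrow> Poly_Mapping.keys x \<subseteq> S" for x
    using subsetD[OF subgroup.subset[OF N], of x] by simp
  show neg: "x \<in> N \<Longrightarrow> - x \<in> N" for x using subgroup.m_inv_closed[OF N, of x] k[of x] by simp
  show "x \<in> N \<Longrightarrow> y \<in> N \<Longrightarrow> x - y \<in> N" using add[OF _ neg, of x y] by simp
qed

lemma free_coset_eq_iff:
  assumes N: "subgroup N (free_Abelian_group S)"
  shows "N #>\<^bsub>free_Abelian_group S\<^esub> x = N #>\<^bsub>free_Abelian_group S\<^esub> y \<longleftrightarrow> x - y \<in> N"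
proof
  assume "N #>\<^bsub>free_Abelian_group S\<^esub> x = N #>\<^bsub>free_Abelian_group S\<^esub> y"
  then have "0 + x \<in> (\<lambda>n. n + y) ` N"
    unfolding rcoset_free_Abelian_group using free_subgroup(1)[OF N] by blast
  then show "x - y \<in> N" by auto
next
  assume d: "x - y \<in> N"
  show "N #>\<^bsub>free_Abelian_group S\<^esub> x = N #>\<^bsub>free_Abelian_group S\<^esub> y"
    unfolding rcoset_free_Abelian_group
  proof (intro equalityI subsetI)
    fix z assume "z \<in> (\<lambda>n. n + x) ` N"
    then obtain n where n: "n \<in> N" "z = n + x" by auto
    then have "z = (n + (x - y)) + y" by simp
    then show "z \<in> (\<lambda>n. n + y) ` N" using free_subgroup(2)[OF N n(1) d] by blast
  next
    fix z assume "z \<in> (\<lambda>n. n + y) ` N"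
    then obtain n where n: "n \<in> N" "z = n + y" by auto
    then have "z = (n - (x - y)) + x" by simp
    then show "z \<in> (\<lambda>n. n + x) ` N" using free_subgroup(4)[OF N n(1) d] by blast
  qed
qed

lemma generate_free_subgroup:
  "R \<subseteq> carrier (free_Abelian_group S) \<Longrightarrow> subgroup (generate (free_Abelian_group S) R) (free_Abelian_group S)"
  by (rule group.generate_is_subgroup) auto

lemma generate_free_induct [consumes 2, case_names zero rel diff]:
  assumes x: "x \<in> generate (free_Abelian_group S) R" and R: "R \<subseteq> carrier (free_Abelian_group S)"
    and zero: "P 0" and rel: "\<And>r. r \<in> R \<Longrightarrow> P r" and diff: "\<And>x y. P x \<Longrightarrow> P y \<Longrightarrow> P (x - y)"
  shows "P x"
  using x
proof (induction rule: generate.induct)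
  case one
  then show ?case using zero by simp
next
  case (incl h)
  then show ?case by (rule rel)
next
  case (inv h)
  then have "P (0 - h)" using diff zero rel by blast
  moreover have "Poly_Mapping.keys h \<subseteq> S" using subsetD[OF R inv] by simp
  ultimately show ?case by simp
next
  case (eng x y)
  have "P (x - (0 - y))" using diff[OF eng.IH(1) diff[OF zero eng.IH(2)]] .
  then show ?case by simp
qed

lemma free_quotient:
  assumes N: "subgroup N (free_Abelian_group S)"
  shows "comm_group (free_Abelian_group S Mod N)"
    and "carrier (free_Abelian_group S Mod N) = {N #>\<^bsub>free_Abelian_group S\<^esub> x | x. Poly_Mapping.keys x \<subseteq> S}"
    and "Poly_Mapping.keys x \<subseteq> S \<Longrightarrow> Poly_Mapping.keys y \<subseteq> S \<Longrightarrow>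
      (N #>\<^bsub>free_Abelian_group S\<^esub> x) \<otimes>\<^bsub>free_Abelian_group S Mod N\<^esub> (N #>\<^bsub>free_Abelian_group S\<^esub> y)
        = N #>\<^bsub>free_Abelian_group S\<^esub> (x + y)"
    and "\<one>\<^bsub>free_Abelian_group S Mod N\<^esub> = N #>\<^bsub>free_Abelian_group S\<^esub> 0"
proof -
  interpret F: comm_group "free_Abelian_group S" by (rule abelian_free_Abelian_group)
  interpret normal N "free_Abelian_group S" using F.subgroup_imp_normal[OF N] .
  show "comm_group (free_Abelian_group S Mod N)" using F.abelian_FactGroup[OF N] .
  show "carrier (free_Abelian_group S Mod N) = {N #>\<^bsub>free_Abelian_group S\<^esub> x | x. Poly_Mapping.keys x \<subseteq> S}"
    unfolding carrier_FactGroup by auto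
  show "Poly_Mapping.keys x \<subseteq> S \<Longrightarrow> Poly_Mapping.keys y \<subseteq> S \<Longrightarrow>
      (N #>\<^bsub>free_Abelian_group S\<^esub> x) \<otimes>\<^bsub>free_Abelian_group S Mod N\<^esub> (N #>\<^bsub>free_Abelian_group S\<^esub> y)
        = N #>\<^bsub>free_Abelian_group S\<^esub> (x + y)"
    using rcos_sum[of x y] by simp
  show "\<one>\<^bsub>free_Abelian_group S Mod N\<^esub> = N #>\<^bsub>free_Abelian_group S\<^esub> 0"
    by (simp add: rcoset_free_Abelian_group)
qed

lemma frag_bilinear_simps [simp]:
  fixes f :: "'a \<Rightarrow> 'b \<Rightarrow> 'c"
  shows "frag_bilinear f 0 y = 0" "frag_bilinear f x 0 = 0"
  "frag_bilinear f (x + x') y = frag_bilinear f x y + frag_bilinear f x' y"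
  "frag_bilinear f (x - x') y = frag_bilinear f x y - frag_bilinear f x' y"
  "frag_bilinear f x (y + y') = frag_bilinear f x y + frag_bilinear f x y'"
  "frag_bilinear f x (y - y') = frag_bilinear f x y - frag_bilinear f x y'"
  "frag_bilinear f (frag_of a) (frag_of b) = frag_of (f a b)"
proof -
  show "frag_bilinear f x 0 = 0" unfolding frag_bilinear_def by (rule frag_extend_eq_0) simp
  have add: "frag_extend (\<lambda>a. g a + h a) x = frag_extend g x + frag_extend h x" for g h :: "'a \<Rightarrow> 'c \<Rightarrow>\<^sub>0 int"
    by (simp add: frag_extend_def frag_cmul_distrib2 sum.distrib)
  have "frag_extend (\<lambda>a. g a - h a) x = frag_extend g x - frag_extend h x" for g h :: "'a \<Rightarrow> 'c \<Rightarrow>\<^sub>0 int"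
    using add[of "\<lambda>a. g a - h a" h] by (simp add: eq_diff_eq)
  then show "frag_bilinear f x (y + y') = frag_bilinear f x y + frag_bilinear f x y'"
    "frag_bilinear f x (y - y') = frag_bilinear f x y - frag_bilinear f x y'"
    unfolding frag_bilinear_def by (simp_all add: frag_extend_add frag_extend_diff add)
qed (simp_all add: frag_bilinear_def frag_extend_add frag_extend_diff)

lemma keys_frag_bilinear:
  assumes x: "Poly_Mapping.keys x \<subseteq> S" and y: "Poly_Mapping.keys y \<subseteq> T"
    and f: "\<And>a b. a \<in> S \<Longrightarrow> b \<in> T \<Longrightarrow> f a b \<in> U"
  shows "Poly_Mapping.keys (frag_bilinear f x y) \<subseteq> U"
  using x
proof (induction x rule: frag_induction)
  case (one a)
  show ?case using y
  proof (induction y rule: frag_induction)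
    case (one b)
    then show ?case using f[OF \<open>a \<in> S\<close>] by simp
  next
    case (diff b c)
    then show ?case using keys_diff[of "frag_bilinear f (frag_of a) b" "frag_bilinear f (frag_of a) c"] by auto
  qed simp
next
  case (diff a b)
  then show ?case using keys_diff[of "frag_bilinear f a y" "frag_bilinear f b y"] by auto
qed simp

lemma frag_bilinear_left_relations:
  assumes N: "subgroup N (free_Abelian_group U)" and R: "R \<subseteq> carrier (free_Abelian_group S)"
    and rel: "\<And>r b. r \<in> R \<Longrightarrow> b \<in> T \<Longrightarrow> frag_bilinear f r (frag_of b) \<in> N"
    and x: "x \<in> generate (free_Abelian_group S) R" and y: "Poly_Mapping.keys y \<subseteq> T"
  shows "frag_bilinear f x y \<in> N"
  using x R
proof (induction rule: generate_free_induct)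
  case (rel r)
  show ?case using y
    by (induction y rule: frag_induction) (use assms(3)[OF rel] free_subgroup[OF N] in auto)
qed (use free_subgroup[OF N] in auto)

lemma frag_bilinear_right_relations:
  assumes N: "subgroup N (free_Abelian_group U)" and R: "R \<subseteq> carrier (free_Abelian_group T)"
    and rel: "\<And>r a. r \<in> R \<Longrightarrow> a \<in> S \<Longrightarrow> frag_bilinear f (frag_of a) r \<in> N"
    and y: "y \<in> generate (free_Abelian_group T) R" and x: "Poly_Mapping.keys x \<subseteq> S"
  shows "frag_bilinear f x y \<in> N"
  using y R
proof (induction rule: generate_free_induct)
  case (rel r)
  show ?case using x
    by (induction x rule: frag_induction) (use assms(3)[OF rel] free_subgroup[OF N] in auto)
qed (use free_subgroup[OF N] in auto)

text \<open>A bilinear map that sends relations, paired with generators, to relations induces a map of the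
  quotients. The union in the definition of the induced map then consists of a single coset.\<close>

lemma quotient_map2_frag_bilinear:
  assumes N: "subgroup N (free_Abelian_group U)"
    and R1: "R1 \<subseteq> carrier (free_Abelian_group S)" and R2: "R2 \<subseteq> carrier (free_Abelian_group T)"
    and rel1: "\<And>r b. r \<in> R1 \<Longrightarrow> b \<in> T \<Longrightarrow> frag_bilinear f r (frag_of b) \<in> N"
    and rel2: "\<And>r a. r \<in> R2 \<Longrightarrow> a \<in> S \<Longrightarrow> frag_bilinear f (frag_of a) r \<in> N"
    and x: "Poly_Mapping.keys x \<subseteq> S" and y: "Poly_Mapping.keys y \<subseteq> T"
  shows "quotient_map2 (free_Abelian_group U) N (frag_bilinear f)
      (generate (free_Abelian_group S) R1 #>\<^bsub>free_Abelian_group S\<^esub> x)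
      (generate (free_Abelian_group T) R2 #>\<^bsub>free_Abelian_group T\<^esub> y)
    = N #>\<^bsub>free_Abelian_group U\<^esub> frag_bilinear f x y"
proof -
  let ?N1 = "generate (free_Abelian_group S) R1" and ?N2 = "generate (free_Abelian_group T) R2"
  note N1 = generate_free_subgroup[OF R1] and N2 = generate_free_subgroup[OF R2]
  have eq: "N #>\<^bsub>free_Abelian_group U\<^esub> frag_bilinear f (m + x) (n + y)
      = N #>\<^bsub>free_Abelian_group U\<^esub> frag_bilinear f x y" if m: "m \<in> ?N1" and n: "n \<in> ?N2" for m n
  proof -
    \<comment> \<open>each of the three terms has a relation as one of its arguments\<close>
    have "frag_bilinear f (m + x) (n + y) - frag_bilinear f x y
        = frag_bilinear f m n + frag_bilinear f m y + frag_bilinear f x n" by simp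
    also have "\<dots> \<in> N"
      using frag_bilinear_left_relations[OF N R1 rel1 m y] frag_bilinear_right_relations[OF N R2 rel2 n x]
        frag_bilinear_left_relations[OF N R1 rel1 m free_subgroup(5)[OF N2 n]] free_subgroup[OF N] by auto
    finally show ?thesis using free_coset_eq_iff[OF N] by blast
  qed
  then show ?thesis
    unfolding quotient_map2_def rcoset_free_Abelian_group[where N = ?N1] rcoset_free_Abelian_group[where N = ?N2]
    using free_subgroup(1)[OF N1] free_subgroup(1)[OF N2] eq by (auto simp del: frag_bilinear_simps)
qed

lemma quotient_map1_frag_extend:
  assumes R: "R \<subseteq> carrier (free_Abelian_group S)" and N: "subgroup N (free_Abelian_group U)"
    and rel: "\<And>r. r \<in> R \<Longrightarrow> frag_extend f r \<in> N"
  shows "quotient_map1 (free_Abelian_group U) N (frag_extend f)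
      (generate (free_Abelian_group S) R #>\<^bsub>free_Abelian_group S\<^esub> x)
    = N #>\<^bsub>free_Abelian_group U\<^esub> frag_extend f x"
proof -
  let ?M = "generate (free_Abelian_group S) R"
  have "frag_extend f m \<in> N" if "m \<in> ?M" for m
    using that R by (induction rule: generate_free_induct) (use rel free_subgroup[OF N] in \<open>auto simp: frag_extend_diff\<close>)
  then have "N #>\<^bsub>free_Abelian_group U\<^esub> frag_extend f (m + x) = N #>\<^bsub>free_Abelian_group U\<^esub> frag_extend f x"
    if "m \<in> ?M" for m
    using that by (subst free_coset_eq_iff[OF N]) (simp add: frag_extend_add)
  then show ?thesis
    unfolding quotient_map1_def rcoset_free_Abelian_group[where N = ?M]
    using free_subgroup(1)[OF generate_free_subgroup[OF R]] by auto
qed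

section \<open>The complexification as a module\<close>

definition tensor_relators :: "'a monoid \<Rightarrow> (complex \<times> 'a \<Rightarrow>\<^sub>0 int) set" where
  "tensor_relators A = {frag_of (c + d, a) - frag_of (c, a) - frag_of (d, a) | c d a. a \<in> carrier A} \<union>
      {frag_of (c, a \<otimes>\<^bsub>A\<^esub> b) - frag_of (c, a) - frag_of (c, b) | c a b. a \<in> carrier A \<and> b \<in> carrier A}"

lemma tensor_relations_generate:
  "tensor_relations A = generate (free_Abelian_group (UNIV \<times> carrier A)) (tensor_relators A)"
  unfolding tensor_relations_def tensor_relators_def ..

lemma keys_diff_subset:
  "Poly_Mapping.keys x \<subseteq> S \<Longrightarrow> Poly_Mapping.keys y \<subseteq> S \<Longrightarrow> Poly_Mapping.keys (x - y :: 'a \<Rightarrow>\<^sub>0 int) \<subseteq> S"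
  using keys_diff[of x y] by auto

lemma keys_add_subset:
  "Poly_Mapping.keys x \<subseteq> S \<Longrightarrow> Poly_Mapping.keys y \<subseteq> S \<Longrightarrow> Poly_Mapping.keys (x + y :: 'a \<Rightarrow>\<^sub>0 int) \<subseteq> S"
  using Poly_Mapping.keys_add[of x y] by auto

lemma tensor_relators_carrier:
  assumes "group A"
  shows "tensor_relators A \<subseteq> carrier (free_Abelian_group (UNIV \<times> carrier A))"
proof -
  interpret group A by fact
  show ?thesis
  proof (rule subsetI)
    fix r assume "r \<in> tensor_relators A"
    then have "Poly_Mapping.keys r \<subseteq> UNIV \<times> carrier A"
      unfolding tensor_relators_def
      by (elim UnE CollectE exE conjE; hypsubst; intro keys_diff_subset) simp_all
    then show "r \<in> carrier (free_Abelian_group (UNIV \<times> carrier A))" by simp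
  qed
qed

lemma tensor_relations_subgroup:
  "group A \<Longrightarrow> subgroup (tensor_relations A) (free_Abelian_group (UNIV \<times> carrier A))"
  unfolding tensor_relations_generate by (intro generate_free_subgroup tensor_relators_carrier)

text \<open>The element of \<open>\<complex> \<otimes>\<^sub>\<int> A\<close> given by a formal combination of symbols \<open>c \<otimes> a\<close>.\<close>

definition tensor_class :: "'a monoid \<Rightarrow> (complex \<times> 'a \<Rightarrow>\<^sub>0 int) \<Rightarrow> (complex \<times> 'a \<Rightarrow>\<^sub>0 int) set" where
  "tensor_class A x = tensor_relations A #>\<^bsub>free_Abelian_group (UNIV \<times> carrier A)\<^esub> x"

text \<open>The action of the scalar \<open>c\<close> on representatives of elements of \<open>\<complex> \<otimes>\<^sub>\<int> A\<close>.\<close>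

definition tensor_scale :: "complex \<Rightarrow> (complex \<times> 'a \<Rightarrow>\<^sub>0 int) \<Rightarrow> (complex \<times> 'a \<Rightarrow>\<^sub>0 int)" where
  "tensor_scale c = frag_extend (\<lambda>(d, a). frag_of (c * d, a))"

lemma tensor_scale_simps [simp]:
  "tensor_scale c 0 = 0" "tensor_scale c (x + y) = tensor_scale c x + tensor_scale c y"
  "tensor_scale c (x - y) = tensor_scale c x - tensor_scale c y"
  "tensor_scale c (frag_of (d, a)) = frag_of (c * d, a)"
  unfolding tensor_scale_def by (simp_all add: frag_extend_add frag_extend_diff)

lemma keys_tensor_scale:
  "Poly_Mapping.keys x \<subseteq> UNIV \<times> S \<Longrightarrow> Poly_Mapping.keys (tensor_scale c x) \<subseteq> UNIV \<times> S"
proof (induction x rule: frag_induction)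
  case (one e)
  then show ?case by (cases e) simp
next
  case (diff a b)
  then show ?case using keys_diff_subset[OF diff] by simp
qed simp

lemma tensor_class_eq_iff:
  "group A \<Longrightarrow> tensor_class A x = tensor_class A y \<longleftrightarrow> x - y \<in> tensor_relations A"
  unfolding tensor_class_def by (intro free_coset_eq_iff tensor_relations_subgroup)

lemma tensor_relation_scalar:
  "a \<in> carrier A \<Longrightarrow> frag_of (c + d, a) - frag_of (c, a) - frag_of (d, a) \<in> tensor_relations A"
  unfolding tensor_relations_generate tensor_relators_def by (rule generate.incl) blast

lemma tensor_relation_add:
  "a \<in> carrier A \<Longrightarrow> b \<in> carrier A \<Longrightarrow>
    frag_of (c, a \<otimes>\<^bsub>A\<^esub> b) - frag_of (c, a) - frag_of (c, b) \<in> tensor_relations A"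
  unfolding tensor_relations_generate tensor_relators_def by (rule generate.incl) blast

lemma complexification_simps:
  assumes A: "group A"
  shows "carrier (complexification A) = {tensor_class A x | x. Poly_Mapping.keys x \<subseteq> UNIV \<times> carrier A}"
    and "\<zero>\<^bsub>complexification A\<^esub> = tensor_class A 0"
    and "Poly_Mapping.keys x \<subseteq> UNIV \<times> carrier A \<Longrightarrow> Poly_Mapping.keys y \<subseteq> UNIV \<times> carrier A \<Longrightarrow>
      tensor_class A x \<oplus>\<^bsub>complexification A\<^esub> tensor_class A y = tensor_class A (x + y)"
    and "c \<odot>\<^bsub>complexification A\<^esub> tensor_class A x = tensor_class A (tensor_scale c x)"
proof -
  note T = tensor_relations_subgroup[OF A] and Q = free_quotient[OF tensor_relations_subgroup[OF A]]
  show "carrier (complexification A) = {tensor_class A x | x. Poly_Mapping.keys x \<subseteq> UNIV \<times> carrier A}"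
    unfolding complexification_def Let_def tensor_class_def using Q(2) by simp
  show "\<zero>\<^bsub>complexification A\<^esub> = tensor_class A 0"
    unfolding complexification_def Let_def tensor_class_def using Q(4) by simp
  show "Poly_Mapping.keys x \<subseteq> UNIV \<times> carrier A \<Longrightarrow> Poly_Mapping.keys y \<subseteq> UNIV \<times> carrier A \<Longrightarrow>
      tensor_class A x \<oplus>\<^bsub>complexification A\<^esub> tensor_class A y = tensor_class A (x + y)"
    unfolding complexification_def Let_def tensor_class_def using Q(3)[of x y] by simp
  have "frag_extend (\<lambda>(d, a). frag_of (c * d, a)) r \<in> tensor_relations A" if "r \<in> tensor_relators A" for r
  proof -
    from that consider d e a where "a \<in> carrier A" "r = frag_of (d + e, a) - frag_of (d, a) - frag_of (e, a)"
      | d a b where "a \<in> carrier A" "b \<in> carrier A" "r = frag_of (d, a \<otimes>\<^bsub>A\<^esub> b) - frag_of (d, a) - frag_of (d, b)"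
      unfolding tensor_relators_def by auto
    then show ?thesis
    proof cases
      case 1
      then show ?thesis using tensor_relation_scalar[of a A "c * d" "c * e"]
        by (simp add: frag_extend_diff distrib_left)
    next
      case 2
      then show ?thesis using tensor_relation_add[of a A b "c * d"] by (simp add: frag_extend_diff)
    qed
  qed
  from quotient_map1_frag_extend[OF tensor_relators_carrier[OF A] T this, of x]
  show "c \<odot>\<^bsub>complexification A\<^esub> tensor_class A x = tensor_class A (tensor_scale c x)"
    unfolding complexification_def Let_def tensor_class_def tensor_scale_def
    by (simp flip: tensor_relations_generate)
qed

text \<open>All laws except one hold for formal combinations already. The exception is distributivity over sums
  of scalars, which needs the relations \<open>(c + d) \<otimes> a = c \<otimes> a + d \<otimes> a\<close>.\<close>

lemma complexification_module:
  assumes A: "group A"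
  shows "Module.module class_ring (complexification A)"
proof -
  let ?C = "complexification A"
  note s = complexification_simps[OF A]
  note sub = free_subgroup[OF tensor_relations_subgroup[OF A]]
  have carrierE: "\<exists>x. X = tensor_class A x \<and> Poly_Mapping.keys x \<subseteq> UNIV \<times> carrier A" if "X \<in> carrier ?C" for X
    using that s(1) by auto
  have carrierI: "tensor_class A x \<in> carrier ?C" if "Poly_Mapping.keys x \<subseteq> UNIV \<times> carrier A" for x
    using that s(1) by auto
  have scale_add: "tensor_scale (c + d) x - (tensor_scale c x + tensor_scale d x) \<in> tensor_relations A"
    if "Poly_Mapping.keys x \<subseteq> UNIV \<times> carrier A" for c d x using that
  proof (induction x rule: frag_induction)
    case zero
    then show ?case using sub(1) by simp
  next
    case (one e)
    then show ?case using tensor_relation_scalar[of "snd e" A "c * fst e" "d * fst e"]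
      by (cases e) (simp add: distrib_right algebra_simps)
  next
    case (diff a b)
    then show ?case using sub(4)[OF diff] by (simp add: algebra_simps)
  qed
  have scale_scale: "tensor_scale (c * d) x = tensor_scale c (tensor_scale d x)" for c d and x :: "complex \<times> 'a \<Rightarrow>\<^sub>0 int"
    using subset_UNIV by (induction x rule: frag_induction) (auto simp: mult.assoc)
  have scale_one: "tensor_scale 1 x = x" for x :: "complex \<times> 'a \<Rightarrow>\<^sub>0 int"
    using subset_UNIV by (induction x rule: frag_induction) auto
  show ?thesis
  proof (rule moduleI)
    show "cring (class_ring :: complex ring)" using class_field unfolding field_def domain_def by blast
    show "abelian_group ?C"
    proof (rule abelian_groupI)
      fix X Y Z assume "X \<in> carrier ?C" "Y \<in> carrier ?C" "Z \<in> carrier ?C"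
      then obtain x y z where x: "X = tensor_class A x" "Poly_Mapping.keys x \<subseteq> UNIV \<times> carrier A"
        and y: "Y = tensor_class A y" "Poly_Mapping.keys y \<subseteq> UNIV \<times> carrier A"
        and z: "Z = tensor_class A z" "Poly_Mapping.keys z \<subseteq> UNIV \<times> carrier A"
        using carrierE by metis
      show "X \<oplus>\<^bsub>?C\<^esub> Y \<oplus>\<^bsub>?C\<^esub> Z = X \<oplus>\<^bsub>?C\<^esub> (Y \<oplus>\<^bsub>?C\<^esub> Z)"
        using x y z by (simp add: s(3) keys_add_subset add.assoc)
    next
      fix X Y assume "X \<in> carrier ?C" "Y \<in> carrier ?C"
      then obtain x y where x: "X = tensor_class A x" "Poly_Mapping.keys x \<subseteq> UNIV \<times> carrier A"
        and y: "Y = tensor_class A y" "Poly_Mapping.keys y \<subseteq> UNIV \<times> carrier A"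
        using carrierE by metis
      show "X \<oplus>\<^bsub>?C\<^esub> Y \<in> carrier ?C" using x y by (simp add: s(3) keys_add_subset carrierI)
      show "X \<oplus>\<^bsub>?C\<^esub> Y = Y \<oplus>\<^bsub>?C\<^esub> X" using x y by (simp add: s(3) add.commute)
    next
      show "\<zero>\<^bsub>?C\<^esub> \<in> carrier ?C" unfolding s(2) by (rule carrierI) simp
      fix X assume "X \<in> carrier ?C"
      then obtain x where x: "X = tensor_class A x" "Poly_Mapping.keys x \<subseteq> UNIV \<times> carrier A"
        using carrierE by metis
      show "\<zero>\<^bsub>?C\<^esub> \<oplus>\<^bsub>?C\<^esub> X = X" unfolding s(2) x(1) using s(3)[of 0 x] x by simp
      have "Poly_Mapping.keys (- x) \<subseteq> UNIV \<times> carrier A" using x by simp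
      then show "\<exists>Y\<in>carrier ?C. Y \<oplus>\<^bsub>?C\<^esub> X = \<zero>\<^bsub>?C\<^esub>"
        unfolding s(2) x(1) using s(3)[of "- x" x] x carrierI[of "- x"] by force
    qed
  next
    fix c X assume "X \<in> carrier ?C"
    then obtain x where x: "X = tensor_class A x" "Poly_Mapping.keys x \<subseteq> UNIV \<times> carrier A"
      using carrierE by metis
    show "c \<odot>\<^bsub>?C\<^esub> X \<in> carrier ?C" using x by (simp add: s(4) carrierI keys_tensor_scale)
    show "\<one>\<^bsub>class_ring\<^esub> \<odot>\<^bsub>?C\<^esub> X = X" using x by (simp add: s(4) scale_one)
    fix d
    show "(c \<oplus>\<^bsub>class_ring\<^esub> d) \<odot>\<^bsub>?C\<^esub> X = c \<odot>\<^bsub>?C\<^esub> X \<oplus>\<^bsub>?C\<^esub> d \<odot>\<^bsub>?C\<^esub> X"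
      using x scale_add[OF x(2)] by (simp add: s(3,4) keys_tensor_scale tensor_class_eq_iff[OF A])
    show "(c \<otimes>\<^bsub>class_ring\<^esub> d) \<odot>\<^bsub>?C\<^esub> X = c \<odot>\<^bsub>?C\<^esub> (d \<odot>\<^bsub>?C\<^esub> X)"
      using x by (simp add: s(4) scale_scale)
  next
    fix c X Y assume "X \<in> carrier ?C" "Y \<in> carrier ?C"
    then obtain x y where x: "X = tensor_class A x" "Poly_Mapping.keys x \<subseteq> UNIV \<times> carrier A"
      and y: "Y = tensor_class A y" "Poly_Mapping.keys y \<subseteq> UNIV \<times> carrier A"
      using carrierE by metis
    show "c \<odot>\<^bsub>?C\<^esub> (X \<oplus>\<^bsub>?C\<^esub> Y) = c \<odot>\<^bsub>?C\<^esub> X \<oplus>\<^bsub>?C\<^esub> c \<odot>\<^bsub>?C\<^esub> Y"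
      using x y by (simp add: s(3,4) keys_tensor_scale)
  qed
qed

section \<open>The Grothendieck group\<close>

definition exact_relators :: "'a monoid \<Rightarrow> ('a rep \<Rightarrow>\<^sub>0 int) set" where
  "exact_relators H = {frag_of V - frag_of V' - frag_of V'' | V' V V''.
        V' \<in> reps H \<and> V \<in> reps H \<and> V'' \<in> reps H \<and> short_exact H V' V V''}"

lemma exact_relations_generate:
  "exact_relations H = generate (free_Abelian_group (reps H)) (exact_relators H)"
  unfolding exact_relations_def exact_relators_def ..

lemma exact_relators_carrier: "exact_relators H \<subseteq> carrier (free_Abelian_group (reps H))"
proof (rule subsetI)
  fix r assume "r \<in> exact_relators H"
  then have "Poly_Mapping.keys r \<subseteq> reps H"
    unfolding exact_relators_def
    by (elim CollectE exE conjE; hypsubst; intro keys_diff_subset) simp_all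
  then show "r \<in> carrier (free_Abelian_group (reps H))" by simp
qed

lemma exact_relations_subgroup: "subgroup (exact_relations H) (free_Abelian_group (reps H))"
  unfolding exact_relations_generate by (intro generate_free_subgroup exact_relators_carrier)

lemma exact_relation:
  "short_exact H V' V V'' \<Longrightarrow> V' \<in> reps H \<Longrightarrow> V \<in> reps H \<Longrightarrow> V'' \<in> reps H \<Longrightarrow>
    frag_of V - frag_of V' - frag_of V'' \<in> exact_relations H"
  unfolding exact_relations_generate exact_relators_def by (rule generate.incl) blast

definition rep_class :: "'a monoid \<Rightarrow> ('a rep \<Rightarrow>\<^sub>0 int) \<Rightarrow> ('a rep \<Rightarrow>\<^sub>0 int) set" where
  "rep_class H x = exact_relations H #>\<^bsub>free_Abelian_group (reps H)\<^esub> x"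

lemma rep_class_eq_iff: "rep_class H x = rep_class H y \<longleftrightarrow> x - y \<in> exact_relations H"
  unfolding rep_class_def by (rule free_coset_eq_iff[OF exact_relations_subgroup])

lemma grothendieck_simps:
  shows "comm_group (grothendieck H)"
    and "carrier (grothendieck H) = {rep_class H x | x. Poly_Mapping.keys x \<subseteq> reps H}"
    and "Poly_Mapping.keys x \<subseteq> reps H \<Longrightarrow> Poly_Mapping.keys y \<subseteq> reps H \<Longrightarrow>
      rep_class H x \<otimes>\<^bsub>grothendieck H\<^esub> rep_class H y = rep_class H (x + y)"
    and "\<one>\<^bsub>grothendieck H\<^esub> = rep_class H 0"
  unfolding grothendieck_def rep_class_def
  by (fact free_quotient[OF exact_relations_subgroup])+

lemma grothendieck_group: "group (grothendieck H)"
  using grothendieck_simps(1) by (rule comm_group.axioms(2))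

text \<open>A zero module \<open>V\<close> is the middle term of an exact sequence \<open>0 \<rightarrow> V \<rightarrow> V \<rightarrow> V \<rightarrow> 0\<close>.\<close>

lemma exact_relation_zero_dim:
  assumes V: "V \<in> reps H" and 0: "fst V = 0"
  shows "frag_of V \<in> exact_relations H"
proof -
  have hom: "1\<^sub>m 0 \<in> module_hom H V V"
  proof (rule module_homI)
    fix h assume "h \<in> carrier H"
    then have "snd V h \<in> carrier_mat 0 0" using repsD(1)[OF V] 0 by auto
    then show "1\<^sub>m 0 * snd V h = snd V h * 1\<^sub>m 0" by simp
  qed (use 0 in simp)
  have "split_exact (1\<^sub>m 0) (1\<^sub>m 0) (1\<^sub>m 0) (1\<^sub>m 0)"
    unfolding split_exact_def by (auto intro!: eq_matI)
  then have "short_exact H V V V" by (rule short_exactI[OF hom hom, rotated -1]) (use 0 in auto)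
  from free_subgroup(3)[OF exact_relations_subgroup exact_relation[OF this V V V]]
  show ?thesis by simp
qed

text \<open>An isomorphism is a short exact sequence with third term zero.\<close>

lemma exact_relation_iso:
  assumes V: "V \<in> reps H" and W: "W \<in> reps H" and E: "E \<in> module_hom H V W"
    and inj: "inj_on (\<lambda>v. E *\<^sub>v v) (carrier_vec (fst V))"
    and surj: "(\<lambda>v. E *\<^sub>v v) ` carrier_vec (fst V) = carrier_vec (fst W)"
  shows "frag_of W - frag_of V \<in> exact_relations H"
proof -
  define Z where "Z = (0 :: nat, \<lambda>_ :: 'a. 1\<^sub>m 0 :: complex mat)"
  have Z: "Z \<in> reps H" unfolding Z_def by (rule repsI) auto
  have 0: "0\<^sub>m 0 (fst W) \<in> module_hom H W Z"
  proof (rule module_homI)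
    fix h assume "h \<in> carrier H"
    then have "snd W h \<in> carrier_mat (fst W) (fst W)" by (rule repsD(1)[OF W])
    then show "0\<^sub>m 0 (fst W) * snd W h = snd Z h * 0\<^sub>m 0 (fst W)" by (intro eq_matI) (auto simp: Z_def)
  qed (simp add: Z_def)
  have "short_exact H V W Z"
    unfolding short_exact_def
  proof (intro bexI[OF _ E] bexI[OF _ 0] conjI)
    show "(\<lambda>v. E *\<^sub>v v) ` carrier_vec (fst V) = mat_kernel (0\<^sub>m 0 (fst W) :: complex mat)"
      unfolding surj mat_kernel_def by auto
    show "(\<lambda>v. 0\<^sub>m 0 (fst W) *\<^sub>v v) ` carrier_vec (fst W) = (carrier_vec (fst Z) :: complex vec set)"
    proof (intro equalityI subsetI)
      fix u :: "complex vec" assume "u \<in> carrier_vec (fst Z)"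
      then have "dim_vec u = 0" by (simp add: Z_def)
      then have "u = 0\<^sub>m 0 (fst W) *\<^sub>v 0\<^sub>v (fst W)" by (intro eq_vecI) simp_all
      then show "u \<in> (\<lambda>v. 0\<^sub>m 0 (fst W) *\<^sub>v v) ` carrier_vec (fst W)"
        by (rule image_eqI) (rule zero_carrier_vec)
    qed (auto simp: Z_def intro!: carrier_vecI)
  qed (rule inj)
  from free_subgroup(2)[OF exact_relations_subgroup exact_relation[OF this V W Z]
      exact_relation_zero_dim[OF Z]]
  show ?thesis by (simp add: Z_def)
qed

section \<open>Composition through the trivial group\<close>

lemma one_group_simps [simp]:
  "carrier one_group = {()}" "\<one>\<^bsub>one_group\<^esub> = ()"
  by (auto simp: singleton_group_def)

text \<open>The composite of modules through the trivial group before any choice of coinvariants: the outer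
  tensor product over \<open>L \<times> G\<close> and \<open>H \<times> G\<close>, restricted to the diagonal of \<open>G\<close>.\<close>

definition comp_tensor ::
    "('l \<times> unit \<times> 'g) rep \<Rightarrow> (unit \<times> 'h \<times> 'g) rep \<Rightarrow> ('l \<times> 'h \<times> 'g) rep" where
  "comp_tensor V W =
     (fst V * fst W, \<lambda>(l, h, g). kronecker (snd V (l, (), g)) (snd W ((), h, g)))"

lemma comp_tensor_reps:
  assumes V: "V \<in> reps (L \<times>\<times> one_group \<times>\<times> G)" and W: "W \<in> reps (one_group \<times>\<times> H \<times>\<times> G)"
  shows "comp_tensor V W \<in> reps (L \<times>\<times> H \<times>\<times> G)"
  unfolding comp_tensor_def
proof (rule repsI)
  let ?\<rho> = "\<lambda>(l, h, g). kronecker (snd V (l, (), g)) (snd W ((), h, g))"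
  show "?\<rho> \<one>\<^bsub>L \<times>\<times> H \<times>\<times> G\<^esub> = 1\<^sub>m (fst V * fst W)"
    using repsD(2)[OF V] repsD(2)[OF W] kronecker_one by simp
  fix x assume "x \<in> carrier (L \<times>\<times> H \<times>\<times> G)"
  then obtain l h g where x: "x = (l, h, g)" "(l, (), g) \<in> carrier (L \<times>\<times> one_group \<times>\<times> G)"
    "((), h, g) \<in> carrier (one_group \<times>\<times> H \<times>\<times> G)" by auto
  show "?\<rho> x \<in> carrier_mat (fst V * fst W) (fst V * fst W)"
    using kronecker_carrier[OF repsD(1)[OF V x(2)] repsD(1)[OF W x(3)]] x(1) by simp
  fix y assume "y \<in> carrier (L \<times>\<times> H \<times>\<times> G)"
  then obtain l' h' g' where y: "y = (l', h', g')" "(l', (), g') \<in> carrier (L \<times>\<times> one_group \<times>\<times> G)"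
    "((), h', g') \<in> carrier (one_group \<times>\<times> H \<times>\<times> G)" by auto
  show "?\<rho> (x \<otimes>\<^bsub>L \<times>\<times> H \<times>\<times> G\<^esub> y) = ?\<rho> x * ?\<rho> y"
    using kronecker_mult[OF repsD(1)[OF V x(2)] repsD(1)[OF W x(3)] repsD(1)[OF V y(2)] repsD(1)[OF W y(3)]]
      repsD(3)[OF V x(2) y(2)] repsD(3)[OF W x(3) y(3)] x(1) y(1) by simp
qed

text \<open>The trivial group acts by the identity matrix, so all generators \<open>x v - v\<close> vanish.\<close>

lemma coinvariant_relators:
  assumes V: "V \<in> reps (L \<times>\<times> one_group \<times>\<times> G)" and W: "W \<in> reps (one_group \<times>\<times> H \<times>\<times> G)"
  shows "LinearCombinations.module.span class_ring (module_vec TYPE(complex) (fst V * fst W))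
      {kronecker (snd V (\<one>\<^bsub>L\<^esub>, x, \<one>\<^bsub>G\<^esub>)) (snd W (x, \<one>\<^bsub>H\<^esub>, \<one>\<^bsub>G\<^esub>)) *\<^sub>v v - v | x v.
         x \<in> carrier one_group \<and> v \<in> carrier_vec (fst V * fst W)} = {0\<^sub>v (fst V * fst W)}" (is "LinearCombinations.module.span _ _ ?S = _")
proof -
  let ?n = "fst V * fst W"
  interpret vec_space "TYPE(complex)" ?n .
  have "snd V (\<one>\<^bsub>L\<^esub>, (), \<one>\<^bsub>G\<^esub>) = 1\<^sub>m (fst V)" "snd W ((), \<one>\<^bsub>H\<^esub>, \<one>\<^bsub>G\<^esub>) = 1\<^sub>m (fst W)"
    using repsD(2)[OF V] repsD(2)[OF W] by simp_all
  then have zero: "kronecker (snd V (\<one>\<^bsub>L\<^esub>, (), \<one>\<^bsub>G\<^esub>)) (snd W ((), \<one>\<^bsub>H\<^esub>, \<one>\<^bsub>G\<^esub>)) *\<^sub>v v - v = 0\<^sub>v ?n"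
    if "v \<in> carrier_vec ?n" for v
    using that by (simp add: kronecker_one)
  have "?S = {0\<^sub>v ?n}"
  proof (intro equalityI subsetI)
    show "u \<in> ?S" if "u \<in> {0\<^sub>v ?n}" for u
      using that zero[OF zero_carrier_vec] by (intro CollectI exI[of _ "()"] exI[of _ "0\<^sub>v ?n"]) simp
  qed (use zero in auto)
  moreover have "span {0\<^sub>v ?n} \<subseteq> {0\<^sub>v ?n}"
  proof (rule span_is_subset)
    show "submodule class_ring {0\<^sub>v ?n} (module_vec TYPE(complex) ?n)"
      by (intro submodule.intro) (auto simp: module_vec_simps intro: vec_module)
  qed simp
  ultimately show ?thesis using span_zero[of "{0\<^sub>v ?n}"] by (auto simp: module_vec_simps)
qed

lemma is_coinvariants_comp_tensor:
  assumes V: "V \<in> reps (L \<times>\<times> one_group \<times>\<times> G)" and W: "W \<in> reps (one_group \<times>\<times> H \<times>\<times> G)"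
  shows "is_coinvariants G H one_group L V W (comp_tensor V W)"
  unfolding is_coinvariants_def
proof (intro conjI comp_tensor_reps[OF V W] bexI[of _ "1\<^sub>m (fst V * fst W)"] ballI)
  let ?n = "fst V * fst W"
  show "(\<lambda>v. 1\<^sub>m ?n *\<^sub>v v) ` carrier_vec ?n = (carrier_vec (fst (comp_tensor V W)) :: complex vec set)"
    unfolding comp_tensor_def by (auto simp: image_iff)
  show "mat_kernel (1\<^sub>m ?n :: complex mat) = LinearCombinations.module.span class_ring (module_vec TYPE(complex) ?n)
      {kronecker (snd V (\<one>\<^bsub>L\<^esub>, x, \<one>\<^bsub>G\<^esub>)) (snd W (x, \<one>\<^bsub>H\<^esub>, \<one>\<^bsub>G\<^esub>)) *\<^sub>v v - v | x v.
         x \<in> carrier one_group \<and> v \<in> carrier_vec ?n}"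
    unfolding coinvariant_relators[OF V W] mat_kernel_def by auto
  fix l h g assume "l \<in> carrier L" "h \<in> carrier H" "g \<in> carrier G"
  then have "kronecker (snd V (l, (), g)) (snd W ((), h, g)) \<in> carrier_mat ?n ?n"
    using kronecker_carrier[OF repsD(1)[OF V] repsD(1)[OF W]] by simp
  then show "1\<^sub>m ?n * kronecker (snd V (l, \<one>\<^bsub>one_group\<^esub>, g)) (snd W (\<one>\<^bsub>one_group\<^esub>, h, g))
      = snd (comp_tensor V W) (l, h, g) * 1\<^sub>m ?n"
    unfolding comp_tensor_def by simp
qed (simp add: comp_tensor_def)

text \<open>The chosen coinvariants need not equal the tensor product, but they are isomorphic to it: the projection
  onto them has kernel zero. Their classes agree.\<close>

lemma coinvariants_comp_tensor:
  assumes V: "V \<in> reps (L \<times>\<times> one_group \<times>\<times> G)" and W: "W \<in> reps (one_group \<times>\<times> H \<times>\<times> G)"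
  shows "coinvariants G H one_group L V W \<in> reps (L \<times>\<times> H \<times>\<times> G)"
    and "frag_of (coinvariants G H one_group L V W) - frag_of (comp_tensor V W) \<in> exact_relations (L \<times>\<times> H \<times>\<times> G)"
proof -
  let ?n = "fst V * fst W"
  define U where "U = coinvariants G H one_group L V W"
  have U: "is_coinvariants G H one_group L V W U"
    unfolding U_def coinvariants_def by (rule someI[of "is_coinvariants G H one_group L V W", OF is_coinvariants_comp_tensor[OF V W]])
  then show Ur: "U \<in> reps (L \<times>\<times> H \<times>\<times> G)" unfolding is_coinvariants_def by blast
  obtain Q where Q: "Q \<in> carrier_mat (fst U) ?n"
    and surj: "(\<lambda>v. Q *\<^sub>v v) ` carrier_vec ?n = carrier_vec (fst U)"
    and ker: "mat_kernel Q = {0\<^sub>v ?n}"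
    and eq: "\<And>l h g. l \<in> carrier L \<Longrightarrow> h \<in> carrier H \<Longrightarrow> g \<in> carrier G \<Longrightarrow>
      Q * kronecker (snd V (l, (), g)) (snd W ((), h, g)) = snd U (l, h, g) * Q"
    using U unfolding is_coinvariants_def coinvariant_relators[OF V W] by auto
  have hom: "Q \<in> module_hom (L \<times>\<times> H \<times>\<times> G) (comp_tensor V W) U"
    by (rule module_homI) (use Q eq in \<open>auto simp: comp_tensor_def\<close>)
  have "injective_mat Q"
    unfolding injective_mat_def using Q ker mat_kernelI[OF Q] by auto
  then have "inj_on (\<lambda>v. Q *\<^sub>v v) (carrier_vec ?n)" by (rule injective_mat_inj_on[OF _ Q])
  then show "frag_of U - frag_of (comp_tensor V W) \<in> exact_relations (L \<times>\<times> H \<times>\<times> G)"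
    using exact_relation_iso[OF comp_tensor_reps[OF V W] Ur hom] surj by (simp add: comp_tensor_def)
qed

lemma comp_tensor_exact_left:
  assumes V: "V' \<in> reps (L \<times>\<times> one_group \<times>\<times> G)" "V \<in> reps (L \<times>\<times> one_group \<times>\<times> G)"
      "V'' \<in> reps (L \<times>\<times> one_group \<times>\<times> G)"
    and W: "W \<in> reps (one_group \<times>\<times> H \<times>\<times> G)"
    and ex: "short_exact (L \<times>\<times> one_group \<times>\<times> G) V' V V''"
  shows "short_exact (L \<times>\<times> H \<times>\<times> G) (comp_tensor V' W) (comp_tensor V W) (comp_tensor V'' W)"
proof -
  obtain A B A' B' where A: "A \<in> module_hom (L \<times>\<times> one_group \<times>\<times> G) V' V"
    and B: "B \<in> module_hom (L \<times>\<times> one_group \<times>\<times> G) V V''"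
    and A': "A' \<in> carrier_mat (fst V') (fst V)" and B': "B' \<in> carrier_mat (fst V) (fst V'')"
    and s: "split_exact A B A' B'" using ex by (rule short_exactE)
  have hom: "kronecker M (1\<^sub>m (fst W)) \<in> module_hom (L \<times>\<times> H \<times>\<times> G) (comp_tensor X W) (comp_tensor Y W)"
    if X: "X \<in> reps (L \<times>\<times> one_group \<times>\<times> G)" and Y: "Y \<in> reps (L \<times>\<times> one_group \<times>\<times> G)"
      and M: "M \<in> module_hom (L \<times>\<times> one_group \<times>\<times> G) X Y" for M X Y
  proof (rule module_homI)
    note Mc = module_homD(1)[OF M] and I = one_carrier_mat[of "fst W", where 'a = complex]
    fix x assume "x \<in> carrier (L \<times>\<times> H \<times>\<times> G)"
    then obtain l h g where x: "x = (l, h, g)" "(l, (), g) \<in> carrier (L \<times>\<times> one_group \<times>\<times> G)"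
      "((), h, g) \<in> carrier (one_group \<times>\<times> H \<times>\<times> G)" by auto
    note w = repsD(1)[OF W x(3)] and xc = repsD(1)[OF X x(2)] and yc = repsD(1)[OF Y x(2)]
    show "kronecker M (1\<^sub>m (fst W)) * snd (comp_tensor X W) x = snd (comp_tensor Y W) x * kronecker M (1\<^sub>m (fst W))"
      unfolding comp_tensor_def x(1) snd_conv prod.case
      unfolding kronecker_mult[OF Mc I xc w] kronecker_mult[OF yc w Mc I] module_homD(2)[OF M x(2)]
      using w by simp
  qed (use kronecker_carrier[OF module_homD(1)[OF M] one_carrier_mat] in \<open>simp add: comp_tensor_def\<close>)
  show ?thesis
    by (rule short_exactI[OF hom[OF V(1,2) A] hom[OF V(2,3) B] _ _
          split_exact_kronecker_left[OF module_homD(1)[OF A] module_homD(1)[OF B] A' B' s]])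
      (use kronecker_carrier[OF A' one_carrier_mat] kronecker_carrier[OF B' one_carrier_mat]
        in \<open>simp_all add: comp_tensor_def\<close>)
qed

lemma comp_tensor_exact_right:
  assumes V: "V \<in> reps (L \<times>\<times> one_group \<times>\<times> G)"
    and W: "W' \<in> reps (one_group \<times>\<times> H \<times>\<times> G)" "W \<in> reps (one_group \<times>\<times> H \<times>\<times> G)"
      "W'' \<in> reps (one_group \<times>\<times> H \<times>\<times> G)"
    and ex: "short_exact (one_group \<times>\<times> H \<times>\<times> G) W' W W''"
  shows "short_exact (L \<times>\<times> H \<times>\<times> G) (comp_tensor V W') (comp_tensor V W) (comp_tensor V W'')"
proof -
  obtain A B A' B' where A: "A \<in> module_hom (one_group \<times>\<times> H \<times>\<times> G) W' W"
    and B: "B \<in> module_hom (one_group \<times>\<times> H \<times>\<times> G) W W''"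
    and A': "A' \<in> carrier_mat (fst W') (fst W)" and B': "B' \<in> carrier_mat (fst W) (fst W'')"
    and s: "split_exact A B A' B'" using ex by (rule short_exactE)
  have hom: "kronecker (1\<^sub>m (fst V)) M \<in> module_hom (L \<times>\<times> H \<times>\<times> G) (comp_tensor V X) (comp_tensor V Y)"
    if X: "X \<in> reps (one_group \<times>\<times> H \<times>\<times> G)" and Y: "Y \<in> reps (one_group \<times>\<times> H \<times>\<times> G)"
      and M: "M \<in> module_hom (one_group \<times>\<times> H \<times>\<times> G) X Y" for M X Y
  proof (rule module_homI)
    note Mc = module_homD(1)[OF M] and I = one_carrier_mat[of "fst V", where 'a = complex]
    fix x assume "x \<in> carrier (L \<times>\<times> H \<times>\<times> G)"
    then obtain l h g where x: "x = (l, h, g)" "(l, (), g) \<in> carrier (L \<times>\<times> one_group \<times>\<times> G)"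
      "((), h, g) \<in> carrier (one_group \<times>\<times> H \<times>\<times> G)" by auto
    note v = repsD(1)[OF V x(2)] and xc = repsD(1)[OF X x(3)] and yc = repsD(1)[OF Y x(3)]
    show "kronecker (1\<^sub>m (fst V)) M * snd (comp_tensor V X) x = snd (comp_tensor V Y) x * kronecker (1\<^sub>m (fst V)) M"
      unfolding comp_tensor_def x(1) snd_conv prod.case
      unfolding kronecker_mult[OF I Mc v xc] kronecker_mult[OF v yc I Mc] module_homD(2)[OF M x(3)]
      using v by simp
  qed (use kronecker_carrier[OF one_carrier_mat module_homD(1)[OF M]] in \<open>simp add: comp_tensor_def\<close>)
  show ?thesis
    by (rule short_exactI[OF hom[OF W(1,2) A] hom[OF W(2,3) B] _ _
          split_exact_kronecker_right[OF module_homD(1)[OF A] module_homD(1)[OF B] A' B' s]])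
      (use kronecker_carrier[OF one_carrier_mat A'] kronecker_carrier[OF one_carrier_mat B']
        in \<open>simp_all add: comp_tensor_def\<close>)
qed

text \<open>Modulo the relations of the target the chosen coinvariants may be replaced by tensor products, and
  these are exact in both arguments.\<close>

lemma grothendieck_comp_rep_class:
  assumes x: "Poly_Mapping.keys x \<subseteq> reps (L \<times>\<times> one_group \<times>\<times> G)"
    and y: "Poly_Mapping.keys y \<subseteq> reps (one_group \<times>\<times> H \<times>\<times> G)"
  shows "grothendieck_comp G H one_group L (rep_class (L \<times>\<times> one_group \<times>\<times> G) x)
      (rep_class (one_group \<times>\<times> H \<times>\<times> G) y)
    = rep_class (L \<times>\<times> H \<times>\<times> G) (frag_bilinear (coinvariants G H one_group L) x y)"
  unfolding grothendieck_comp_def rep_class_def exact_relations_generate[of "L \<times>\<times> one_group \<times>\<times> G"]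
    exact_relations_generate[of "one_group \<times>\<times> H \<times>\<times> G"]
proof (rule quotient_map2_frag_bilinear[OF exact_relations_subgroup exact_relators_carrier exact_relators_carrier _ _ x y])
  let ?N = "exact_relations (L \<times>\<times> H \<times>\<times> G)" and ?co = "coinvariants G H one_group L"
  note sub = free_subgroup[OF exact_relations_subgroup]
  fix r W assume r: "r \<in> exact_relators (L \<times>\<times> one_group \<times>\<times> G)" and W: "W \<in> reps (one_group \<times>\<times> H \<times>\<times> G)"
  then obtain V V' V'' where V: "V' \<in> reps (L \<times>\<times> one_group \<times>\<times> G)" "V \<in> reps (L \<times>\<times> one_group \<times>\<times> G)"
      "V'' \<in> reps (L \<times>\<times> one_group \<times>\<times> G)" and ex: "short_exact (L \<times>\<times> one_group \<times>\<times> G) V' V V''"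
      and r: "r = frag_of V - frag_of V' - frag_of V''"
    unfolding exact_relators_def by blast
  have 1: "frag_of (comp_tensor V W) - frag_of (comp_tensor V' W) - frag_of (comp_tensor V'' W) \<in> ?N"
    using exact_relation[OF comp_tensor_exact_left[OF V W ex]] comp_tensor_reps V W by blast
  have "frag_bilinear ?co r (frag_of W)
      = (frag_of (comp_tensor V W) - frag_of (comp_tensor V' W) - frag_of (comp_tensor V'' W))
        + (frag_of (?co V W) - frag_of (comp_tensor V W)) - (frag_of (?co V' W) - frag_of (comp_tensor V' W))
        - (frag_of (?co V'' W) - frag_of (comp_tensor V'' W))" unfolding r by simp
  also have "\<dots> \<in> ?N" by (intro sub(2) sub(4) 1 coinvariants_comp_tensor(2) V W)
  finally show "frag_bilinear ?co r (frag_of W) \<in> ?N" .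
next
  let ?N = "exact_relations (L \<times>\<times> H \<times>\<times> G)" and ?co = "coinvariants G H one_group L"
  note sub = free_subgroup[OF exact_relations_subgroup]
  fix r V assume r: "r \<in> exact_relators (one_group \<times>\<times> H \<times>\<times> G)" and V: "V \<in> reps (L \<times>\<times> one_group \<times>\<times> G)"
  then obtain W W' W'' where W: "W' \<in> reps (one_group \<times>\<times> H \<times>\<times> G)" "W \<in> reps (one_group \<times>\<times> H \<times>\<times> G)"
      "W'' \<in> reps (one_group \<times>\<times> H \<times>\<times> G)" and ex: "short_exact (one_group \<times>\<times> H \<times>\<times> G) W' W W''"
      and r: "r = frag_of W - frag_of W' - frag_of W''"
    unfolding exact_relators_def by blast
  have 1: "frag_of (comp_tensor V W) - frag_of (comp_tensor V W') - frag_of (comp_tensor V W'') \<in> ?N"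
    using exact_relation[OF comp_tensor_exact_right[OF V W ex]] comp_tensor_reps V W by blast
  have "frag_bilinear ?co (frag_of V) r
      = (frag_of (comp_tensor V W) - frag_of (comp_tensor V W') - frag_of (comp_tensor V W''))
        + (frag_of (?co V W) - frag_of (comp_tensor V W)) - (frag_of (?co V W') - frag_of (comp_tensor V W'))
        - (frag_of (?co V W'') - frag_of (comp_tensor V W''))" unfolding r by simp
  also have "\<dots> \<in> ?N" by (intro sub(2) sub(4) 1 coinvariants_comp_tensor(2) V W)
  finally show "frag_bilinear ?co (frag_of V) r \<in> ?N" .
qed

lemma keys_frag_bilinear_coinvariants:
  assumes x: "Poly_Mapping.keys x \<subseteq> reps (L \<times>\<times> one_group \<times>\<times> G)"
    and y: "Poly_Mapping.keys y \<subseteq> reps (one_group \<times>\<times> H \<times>\<times> G)"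
  shows "Poly_Mapping.keys (frag_bilinear (coinvariants G H one_group L) x y) \<subseteq> reps (L \<times>\<times> H \<times>\<times> G)"
  using keys_frag_bilinear[OF x y] coinvariants_comp_tensor(1) by blast

lemma grothendieck_comp_biadditive:
  assumes a: "a \<in> carrier (grothendieck (L \<times>\<times> one_group \<times>\<times> G))"
      "a' \<in> carrier (grothendieck (L \<times>\<times> one_group \<times>\<times> G))"
    and b: "b \<in> carrier (grothendieck (one_group \<times>\<times> H \<times>\<times> G))"
      "b' \<in> carrier (grothendieck (one_group \<times>\<times> H \<times>\<times> G))"
  shows "grothendieck_comp G H one_group L a b \<in> carrier (grothendieck (L \<times>\<times> H \<times>\<times> G))"
    and "grothendieck_comp G H one_group L (a \<otimes>\<^bsub>grothendieck (L \<times>\<times> one_group \<times>\<times> G)\<^esub> a') b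
      = grothendieck_comp G H one_group L a b \<otimes>\<^bsub>grothendieck (L \<times>\<times> H \<times>\<times> G)\<^esub> grothendieck_comp G H one_group L a' b"
    and "grothendieck_comp G H one_group L a (b \<otimes>\<^bsub>grothendieck (one_group \<times>\<times> H \<times>\<times> G)\<^esub> b')
      = grothendieck_comp G H one_group L a b \<otimes>\<^bsub>grothendieck (L \<times>\<times> H \<times>\<times> G)\<^esub> grothendieck_comp G H one_group L a b'"
proof -
  obtain x x' where x: "a = rep_class (L \<times>\<times> one_group \<times>\<times> G) x" "Poly_Mapping.keys x \<subseteq> reps (L \<times>\<times> one_group \<times>\<times> G)"
    and x': "a' = rep_class (L \<times>\<times> one_group \<times>\<times> G) x'" "Poly_Mapping.keys x' \<subseteq> reps (L \<times>\<times> one_group \<times>\<times> G)"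
    using a unfolding grothendieck_simps(2) by blast
  obtain y y' where y: "b = rep_class (one_group \<times>\<times> H \<times>\<times> G) y" "Poly_Mapping.keys y \<subseteq> reps (one_group \<times>\<times> H \<times>\<times> G)"
    and y': "b' = rep_class (one_group \<times>\<times> H \<times>\<times> G) y'" "Poly_Mapping.keys y' \<subseteq> reps (one_group \<times>\<times> H \<times>\<times> G)"
    using b unfolding grothendieck_simps(2) by blast
  note s = grothendieck_comp_rep_class grothendieck_simps(3) keys_frag_bilinear_coinvariants keys_add_subset
  show "grothendieck_comp G H one_group L a b \<in> carrier (grothendieck (L \<times>\<times> H \<times>\<times> G))"
    unfolding grothendieck_simps(2) x(1) y(1) grothendieck_comp_rep_class[OF x(2) y(2)]
    using keys_frag_bilinear_coinvariants[OF x(2) y(2)] by blast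
  show "grothendieck_comp G H one_group L (a \<otimes>\<^bsub>grothendieck (L \<times>\<times> one_group \<times>\<times> G)\<^esub> a') b
      = grothendieck_comp G H one_group L a b \<otimes>\<^bsub>grothendieck (L \<times>\<times> H \<times>\<times> G)\<^esub> grothendieck_comp G H one_group L a' b"
    unfolding x(1) x'(1) y(1) using x(2) x'(2) y(2) by (simp add: s)
  show "grothendieck_comp G H one_group L a (b \<otimes>\<^bsub>grothendieck (one_group \<times>\<times> H \<times>\<times> G)\<^esub> b')
      = grothendieck_comp G H one_group L a b \<otimes>\<^bsub>grothendieck (L \<times>\<times> H \<times>\<times> G)\<^esub> grothendieck_comp G H one_group L a b'"
    unfolding x(1) y(1) y'(1) using x(2) y(2) y'(2) by (simp add: s)
qed

lemma Comp_tensor_class: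
  fixes G :: "'g monoid" and H :: "'h monoid" and L :: "'l monoid"
    and x :: "complex \<times> (('l \<times> unit \<times> 'g) rep \<Rightarrow>\<^sub>0 int) set \<Rightarrow>\<^sub>0 int"
    and y :: "complex \<times> ((unit \<times> 'h \<times> 'g) rep \<Rightarrow>\<^sub>0 int) set \<Rightarrow>\<^sub>0 int"
  defines "\<phi> \<equiv> \<lambda>(c, a) (d, b). (c * d, grothendieck_comp G H one_group L a b)"
  assumes x: "Poly_Mapping.keys x \<subseteq> UNIV \<times> carrier (grothendieck (L \<times>\<times> one_group \<times>\<times> G))"
    and y: "Poly_Mapping.keys y \<subseteq> UNIV \<times> carrier (grothendieck (one_group \<times>\<times> H \<times>\<times> G))"
  shows "Comp G H one_group L (tensor_class (grothendieck (L \<times>\<times> one_group \<times>\<times> G)) x)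
      (tensor_class (grothendieck (one_group \<times>\<times> H \<times>\<times> G)) y)
    = tensor_class (grothendieck (L \<times>\<times> H \<times>\<times> G)) (frag_bilinear \<phi> x y)"
    and "Poly_Mapping.keys (frag_bilinear \<phi> x y) \<subseteq> UNIV \<times> carrier (grothendieck (L \<times>\<times> H \<times>\<times> G))"
proof -
  let ?A = "grothendieck (L \<times>\<times> one_group \<times>\<times> G)" and ?B = "grothendieck (one_group \<times>\<times> H \<times>\<times> G)"
    and ?C = "grothendieck (L \<times>\<times> H \<times>\<times> G)"
  note bi = grothendieck_comp_biadditive
  note carr = tensor_relators_carrier[OF grothendieck_group]
  show "Poly_Mapping.keys (frag_bilinear \<phi> x y) \<subseteq> UNIV \<times> carrier ?C"
    by (rule keys_frag_bilinear[OF x y]) (auto simp: \<phi>_def intro: bi(1))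
  show "Comp G H one_group L (tensor_class ?A x) (tensor_class ?B y) = tensor_class ?C (frag_bilinear \<phi> x y)"
    unfolding Comp_def Let_def tensor_class_def tensor_relations_generate[of ?A] tensor_relations_generate[of ?B]
      \<phi>_def[symmetric]
  proof (rule quotient_map2_frag_bilinear[OF tensor_relations_subgroup[OF grothendieck_group] carr carr _ _ x y])
    fix r e assume r: "r \<in> tensor_relators ?A" and e: "e \<in> (UNIV :: complex set) \<times> carrier ?B"
    obtain d' b where e: "e = (d', b)" "b \<in> carrier ?B" using e by auto
    from r consider c d a where "a \<in> carrier ?A" "r = frag_of (c + d, a) - frag_of (c, a) - frag_of (d, a)"
      | c a a' where "a \<in> carrier ?A" "a' \<in> carrier ?A" "r = frag_of (c, a \<otimes>\<^bsub>?A\<^esub> a') - frag_of (c, a) - frag_of (c, a')"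
      unfolding tensor_relators_def by auto
    then show "frag_bilinear \<phi> r (frag_of e) \<in> tensor_relations ?C"
    proof cases
      case 1
      then show ?thesis using tensor_relation_scalar[OF bi(1)[OF 1(1) 1(1) e(2) e(2)], of "c * d'" "d * d'"]
        by (simp add: e \<phi>_def distrib_right)
    next
      case 2
      then show ?thesis using tensor_relation_add[OF bi(1)[OF 2(1) 2(1) e(2) e(2)] bi(1)[OF 2(2) 2(2) e(2) e(2)], of "c * d'"]
        bi(2)[OF 2(1,2) e(2) e(2)] by (simp add: e \<phi>_def)
    qed
  next
    fix r e assume r: "r \<in> tensor_relators ?B" and e: "e \<in> (UNIV :: complex set) \<times> carrier ?A"
    obtain c' a where e: "e = (c', a)" "a \<in> carrier ?A" using e by auto
    from r consider c d b where "b \<in> carrier ?B" "r = frag_of (c + d, b) - frag_of (c, b) - frag_of (d, b)"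
      | c b b' where "b \<in> carrier ?B" "b' \<in> carrier ?B" "r = frag_of (c, b \<otimes>\<^bsub>?B\<^esub> b') - frag_of (c, b) - frag_of (c, b')"
      unfolding tensor_relators_def by auto
    then show "frag_bilinear \<phi> (frag_of e) r \<in> tensor_relations ?C"
    proof cases
      case 1
      then show ?thesis using tensor_relation_scalar[OF bi(1)[OF e(2) e(2) 1(1) 1(1)], of "c' * c" "c' * d"]
        by (simp add: e \<phi>_def distrib_left)
    next
      case 2
      then show ?thesis using tensor_relation_add[OF bi(1)[OF e(2) e(2) 2(1) 2(1)] bi(1)[OF e(2) e(2) 2(2) 2(2)], of "c' * c"]
        bi(3)[OF e(2) e(2) 2(1,2)] by (simp add: e \<phi>_def)
    qed
  qed
qed

section \<open>The span of the composites\<close>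

lemma tensor_class_one:
  assumes A: "group A"
  shows "tensor_class A (frag_of (c, \<one>\<^bsub>A\<^esub>)) = tensor_class A 0"
proof -
  interpret A: group A by (rule A)
  show ?thesis
    unfolding tensor_class_eq_iff[OF A]
    using free_subgroup(3)[OF tensor_relations_subgroup[OF A] tensor_relation_add[OF A.one_closed A.one_closed, of c]]
    by simp
qed

lemma tensor_class_minus_scale:
  assumes A: "group A" and y: "Poly_Mapping.keys y \<subseteq> UNIV \<times> carrier A"
  shows "tensor_class A (tensor_scale (- 1) y) = tensor_class A (- y)"
proof -
  note sub = free_subgroup[OF tensor_relations_subgroup[OF A]]
  have "tensor_scale (- 1) y + y \<in> tensor_relations A" using y
  proof (induction y rule: frag_induction)
    case zero
    then show ?case using sub(1) by simp
  next
    case (one e)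
    then obtain c a where e: "e = (c, a)" "a \<in> carrier A" by auto
    \<comment> \<open>\<open>0 \<otimes> a = 0\<close>, by \<open>0 + 0 = 0\<close> and additivity in the scalar\<close>
    have "frag_of (0, a) \<in> tensor_relations A" using sub(3)[OF tensor_relation_scalar[OF e(2), of 0 0]] by simp
    from sub(4)[OF this tensor_relation_scalar[OF e(2), of "- c" c]] show ?case unfolding e by (simp add: add.commute)
  next
    case (diff a b)
    then show ?case using sub(4)[OF diff] by (simp add: algebra_simps)
  qed
  then show ?thesis unfolding tensor_class_eq_iff[OF A] by simp
qed

text \<open>Membership of classes in a submodule, expressed through representatives. This allows induction over
  formal combinations.\<close>

lemma tensor_class_submodule:
  assumes A: "group A" and P: "submodule class_ring P (complexification A)"
  shows "tensor_class A 0 \<in> P"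
    and "Poly_Mapping.keys x \<subseteq> UNIV \<times> carrier A \<Longrightarrow> Poly_Mapping.keys y \<subseteq> UNIV \<times> carrier A \<Longrightarrow>
      tensor_class A x \<in> P \<Longrightarrow> tensor_class A y \<in> P \<Longrightarrow> tensor_class A (x + y) \<in> P"
    and "Poly_Mapping.keys x \<subseteq> UNIV \<times> carrier A \<Longrightarrow> Poly_Mapping.keys y \<subseteq> UNIV \<times> carrier A \<Longrightarrow>
      tensor_class A x \<in> P \<Longrightarrow> tensor_class A y \<in> P \<Longrightarrow> tensor_class A (x - y) \<in> P"
    and "tensor_class A x \<in> P \<Longrightarrow> tensor_class A (tensor_scale c x) \<in> P"
proof -
  interpret P: submodule "class_ring :: complex ring" P "complexification A" by (rule P)
  note s = complexification_simps[OF A]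
  show "tensor_class A 0 \<in> P" using P.zero_closed s(2) by simp
  show add: "Poly_Mapping.keys x \<subseteq> UNIV \<times> carrier A \<Longrightarrow> Poly_Mapping.keys y \<subseteq> UNIV \<times> carrier A \<Longrightarrow>
      tensor_class A x \<in> P \<Longrightarrow> tensor_class A y \<in> P \<Longrightarrow> tensor_class A (x + y) \<in> P" for x y
    using P.m_closed[of "tensor_class A x" "tensor_class A y"] s(3) by simp
  show scale: "tensor_class A x \<in> P \<Longrightarrow> tensor_class A (tensor_scale c x) \<in> P" for x c
    using P.smult_closed[of c "tensor_class A x"] s(4) by simp
  show "Poly_Mapping.keys x \<subseteq> UNIV \<times> carrier A \<Longrightarrow> Poly_Mapping.keys y \<subseteq> UNIV \<times> carrier A \<Longrightarrow>
      tensor_class A x \<in> P \<Longrightarrow> tensor_class A y \<in> P \<Longrightarrow> tensor_class A (x - y) \<in> P"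
  proof -
    assume k: "Poly_Mapping.keys x \<subseteq> UNIV \<times> carrier A" "Poly_Mapping.keys y \<subseteq> UNIV \<times> carrier A"
      and xy: "tensor_class A x \<in> P" "tensor_class A y \<in> P"
    have "tensor_class A (- y) \<in> P"
      using scale[OF xy(2), of "- 1"] tensor_class_minus_scale[OF A k(2)] by simp
    then show "tensor_class A (x - y) \<in> P" using add[OF k(1) _ xy(1), of "- y"] k(2) by simp
  qed
qed

text \<open>Inflation along the projections \<open>K \<times> 1 \<times> G \<rightarrow> K\<close> and \<open>1 \<times> H \<times> G \<rightarrow> H \<times> G\<close>: the group \<open>G\<close> acts
  trivially on the first factor, so its diagonal action on the product is the one on the second.\<close>

lemma rep_class_outer_tensor:
  fixes G :: "'g monoid" and H :: "'h monoid" and K :: "'k monoid"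
  assumes W: "W \<in> reps K" and U: "U \<in> reps (H \<times>\<times> G)"
  obtains W' U' where "W' \<in> reps (K \<times>\<times> one_group \<times>\<times> G)" "U' \<in> reps (one_group \<times>\<times> H \<times>\<times> G)"
    "rep_class (K \<times>\<times> H \<times>\<times> G) (frag_of (outer_tensor W U))
      = grothendieck_comp G H one_group K (rep_class (K \<times>\<times> one_group \<times>\<times> G) (frag_of W'))
          (rep_class (one_group \<times>\<times> H \<times>\<times> G) (frag_of U'))"
proof -
  define W' where "W' = (fst W, \<lambda>(k :: 'k, u :: unit, g :: 'g). snd W k)"
  define U' where "U' = (fst U, \<lambda>(u :: unit, hg). snd U hg)"
  have W': "W' \<in> reps (K \<times>\<times> one_group \<times>\<times> G)" unfolding W'_def
    by (rule repsI) (use repsD[OF W] in auto)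
  have U': "U' \<in> reps (one_group \<times>\<times> H \<times>\<times> G)" unfolding U'_def
    by (rule repsI) (use repsD[OF U] in auto)
  have eq: "comp_tensor W' U' = outer_tensor W U"
    unfolding comp_tensor_def outer_tensor_def W'_def U'_def by (auto simp: fun_eq_iff)
  have co: "rep_class (K \<times>\<times> H \<times>\<times> G) (frag_of (coinvariants G H one_group K W' U'))
      = rep_class (K \<times>\<times> H \<times>\<times> G) (frag_of (outer_tensor W U))"
    unfolding rep_class_eq_iff eq[symmetric] by (rule coinvariants_comp_tensor(2)[OF W' U'])
  have "Poly_Mapping.keys (frag_of W') \<subseteq> reps (K \<times>\<times> one_group \<times>\<times> G)"
    "Poly_Mapping.keys (frag_of U') \<subseteq> reps (one_group \<times>\<times> H \<times>\<times> G)"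
    using W' U' by simp_all
  from grothendieck_comp_rep_class[OF this]
  show thesis
    unfolding frag_bilinear_simps co by (rule that[OF W' U' sym])
qed

text \<open>Induction on the dimension: a reducible module has the same class as the sum of a proper
  submodule and the quotient by it, and an irreducible one is an outer tensor product, hence a
  composite.\<close>

lemma rep_class_in_submodule:
  fixes G :: "'g monoid" and H :: "'h monoid" and K :: "'k monoid"
  assumes G: "group G" and H: "group H" and K: "group K"
    and P: "submodule class_ring P (Mor G H K)"
    and comp: "\<And>x y. x \<in> carrier (Mor G one_group K) \<Longrightarrow> y \<in> carrier (Mor G H one_group) \<Longrightarrow>
      Comp G H one_group K x y \<in> P"
  shows "V \<in> reps (K \<times>\<times> H \<times>\<times> G) \<Longrightarrow>
    tensor_class (grothendieck (K \<times>\<times> H \<times>\<times> G)) (frag_of (1, rep_class (K \<times>\<times> H \<times>\<times> G) (frag_of V))) \<in> P"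
proof (induction "fst V" arbitrary: V rule: less_induct)
  case less
  let ?KHG = "K \<times>\<times> H \<times>\<times> G"
  let ?A = "grothendieck ?KHG" and ?A1 = "grothendieck (K \<times>\<times> one_group \<times>\<times> G)"
    and ?A2 = "grothendieck (one_group \<times>\<times> H \<times>\<times> G)"
  note gA = grothendieck_group[of ?KHG]
  have HG: "group (H \<times>\<times> G)" by (rule DirProd_group[OF H G])
  note P' = tensor_class_submodule[OF gA P[unfolded Mor_def CR_def]]
  have carrier_class: "rep_class L (frag_of U) \<in> carrier (grothendieck L)" if "U \<in> reps L"
    for L :: "'x monoid" and U
    using that unfolding grothendieck_simps(2) by force
  have split: "tensor_class ?A (frag_of (c, a \<otimes>\<^bsub>?A\<^esub> b)) = tensor_class ?A (frag_of (c, a) + frag_of (c, b))"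
    if "a \<in> carrier ?A" "b \<in> carrier ?A" for c a b
    using tensor_relation_add[OF that, of c] by (simp add: tensor_class_eq_iff[OF gA] diff_diff_add)
  show ?case
  proof (cases "fst V = 0")
    case True
    have eq: "rep_class ?KHG (frag_of V) = rep_class ?KHG 0"
      unfolding rep_class_eq_iff using exact_relation_zero_dim[OF less.prems True] by simp
    have "tensor_class ?A (frag_of (1, rep_class ?KHG (frag_of V))) = tensor_class ?A 0"
      unfolding eq grothendieck_simps(4)[symmetric] by (rule tensor_class_one[OF gA])
    then show ?thesis using P'(1) by simp
  next
    case pos: False
    show ?thesis
    proof (cases "irreducible_rep ?KHG V")
      case True
      obtain U W E where W: "W \<in> reps K" and U: "U \<in> reps (H \<times>\<times> G)"
        and E: "E \<in> module_hom ?KHG (outer_tensor W U) V" "injective_mat E"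
        "(\<lambda>v. E *\<^sub>v v) ` carrier_vec (fst W * fst U) = carrier_vec (fst V)"
        using irreducible_rep_DirProd[OF K HG less.prems True] by metis
      have fst: "fst (outer_tensor W U) = fst W * fst U" unfolding outer_tensor_def by simp
      have "frag_of V - frag_of (outer_tensor W U) \<in> exact_relations ?KHG"
        by (rule exact_relation_iso[OF outer_tensor_reps[OF W U] less.prems E(1)
              injective_mat_inj_on[OF E(2) module_homD(1)[OF E(1)]]]) (use E(3) fst in simp)
      then have eq: "rep_class ?KHG (frag_of V) = rep_class ?KHG (frag_of (outer_tensor W U))"
        unfolding rep_class_eq_iff .
      obtain W' U' where W': "W' \<in> reps (K \<times>\<times> one_group \<times>\<times> G)" and U': "U' \<in> reps (one_group \<times>\<times> H \<times>\<times> G)"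
        and gc: "rep_class ?KHG (frag_of (outer_tensor W U))
          = grothendieck_comp G H one_group K (rep_class (K \<times>\<times> one_group \<times>\<times> G) (frag_of W'))
              (rep_class (one_group \<times>\<times> H \<times>\<times> G) (frag_of U'))"
        by (rule rep_class_outer_tensor[OF W U])
      let ?x = "frag_of (1 :: complex, rep_class (K \<times>\<times> one_group \<times>\<times> G) (frag_of W'))"
        and ?y = "frag_of (1 :: complex, rep_class (one_group \<times>\<times> H \<times>\<times> G) (frag_of U'))"
      have kx: "Poly_Mapping.keys ?x \<subseteq> UNIV \<times> carrier ?A1" and ky: "Poly_Mapping.keys ?y \<subseteq> UNIV \<times> carrier ?A2"
        using carrier_class[OF W'] carrier_class[OF U'] by simp_all
      have "tensor_class ?A1 ?x \<in> carrier (Mor G one_group K)" "tensor_class ?A2 ?y \<in> carrier (Mor G H one_group)"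
        unfolding Mor_def CR_def complexification_simps(1)[OF grothendieck_group] using kx ky by blast+
      from comp[OF this] show ?thesis
        unfolding Comp_tensor_class(1)[OF kx ky] eq gc by simp
    next
      case False
      obtain V' V'' where V: "V' \<in> reps ?KHG" "V'' \<in> reps ?KHG" "short_exact ?KHG V' V V''"
        "fst V' < fst V" "fst V'' < fst V"
        using reducible_short_exact[OF less.prems False] pos by (metis neq0_conv)
      have "rep_class ?KHG (frag_of V) = rep_class ?KHG (frag_of V' + frag_of V'')"
        unfolding rep_class_eq_iff using exact_relation[OF V(3,1) less.prems V(2)] by (simp add: diff_diff_add)
      also have "\<dots> = rep_class ?KHG (frag_of V') \<otimes>\<^bsub>?A\<^esub> rep_class ?KHG (frag_of V'')"
        using grothendieck_simps(3)[of "frag_of V'" ?KHG "frag_of V''"] V by simp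
      finally show ?thesis
        using split[OF carrier_class[OF V(1)] carrier_class[OF V(2)], of 1] carrier_class[OF V(1)] carrier_class[OF V(2)]
          P'(2)[OF _ _ less.hyps[OF V(4,1)] less.hyps[OF V(5,2)]] by simp
    qed
  qed
qed

theorem proposition4p2:
  fixes G :: "'g monoid" and H :: "'h monoid" and K :: "'k monoid"
  assumes "group G" and "finite (carrier G)"
    and "group H" and "finite (carrier H)"
    and "group K" and "finite (carrier K)"
  shows "carrier (Mor G H K) =
    LinearCombinations.module.span class_ring (Mor G H K)
      {Comp G H one_group K x y | x y.
         x \<in> carrier (Mor G one_group K) \<and> y \<in> carrier (Mor G H one_group)}"
proof -
  note G = assms(1) and H = assms(3) and K = assms(5)
  let ?KHG = "K \<times>\<times> H \<times>\<times> G"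
  let ?A = "grothendieck ?KHG"
  note gA = grothendieck_group[of ?KHG]
  define S where "S = {Comp G H one_group K x y | x y.
         x \<in> carrier (Mor G one_group K) \<and> y \<in> carrier (Mor G H one_group)}"
  interpret M: Module.module "class_ring :: complex ring" "Mor G H K"
    unfolding Mor_def CR_def by (rule complexification_module[OF gA])
  note carrier_M = complexification_simps(1)[OF grothendieck_group]
  have S: "S \<subseteq> carrier (Mor G H K)"
  proof
    fix z assume "z \<in> S"
    then obtain x y where z: "z = Comp G H one_group K x y"
      and xy: "x \<in> carrier (Mor G one_group K)" "y \<in> carrier (Mor G H one_group)"
      unfolding S_def by blast
    then obtain x' y' where
      x: "x = tensor_class (grothendieck (K \<times>\<times> one_group \<times>\<times> G)) x'"
      "Poly_Mapping.keys x' \<subseteq> UNIV \<times> carrier (grothendieck (K \<times>\<times> one_group \<times>\<times> G))" and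
      y: "y = tensor_class (grothendieck (one_group \<times>\<times> H \<times>\<times> G)) y'"
      "Poly_Mapping.keys y' \<subseteq> UNIV \<times> carrier (grothendieck (one_group \<times>\<times> H \<times>\<times> G))"
      unfolding Mor_def CR_def carrier_M by blast
    show "z \<in> carrier (Mor G H K)"
      unfolding z x(1) y(1) Mor_def CR_def carrier_M Comp_tensor_class(1)[OF x(2) y(2)]
      unfolding mem_Collect_eq
      by (rule exI, rule conjI[OF refl], rule Comp_tensor_class(2)[OF x(2) y(2)])
  qed
  define P where "P = M.span S"
  have P: "submodule class_ring P (Mor G H K)" unfolding P_def by (rule M.span_is_submodule[OF S])
  note P' = tensor_class_submodule[OF gA P[unfolded Mor_def CR_def]]
  have comp: "Comp G H one_group K x y \<in> P"
    if "x \<in> carrier (Mor G one_group K)" "y \<in> carrier (Mor G H one_group)" for x y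
    unfolding P_def using M.in_own_span[OF S] that unfolding S_def by blast
  have unit: "tensor_class ?A (frag_of (1, rep_class ?KHG x)) \<in> P"
    if "Poly_Mapping.keys x \<subseteq> reps ?KHG" for x
  proof -
    have "Poly_Mapping.keys x \<subseteq> reps ?KHG \<and> tensor_class ?A (frag_of (1, rep_class ?KHG x)) \<in> P"
      using that
    proof (induction x rule: frag_induction)
      case zero
      have "tensor_class ?A (frag_of (1, rep_class ?KHG 0)) = tensor_class ?A 0"
        unfolding grothendieck_simps(4)[symmetric] by (rule tensor_class_one[OF gA])
      then show ?case using P'(1) by simp
    next
      case (one V)
      then show ?case using rep_class_in_submodule[OF G H K P comp] by simp
    next
      case (diff x y)
      then have k: "Poly_Mapping.keys (x - y) \<subseteq> reps ?KHG" using keys_diff_subset by blast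
      have c: "rep_class ?KHG z \<in> carrier ?A" if "Poly_Mapping.keys z \<subseteq> reps ?KHG" for z
        using that unfolding grothendieck_simps(2) by blast
      have "rep_class ?KHG x = rep_class ?KHG (x - y) \<otimes>\<^bsub>?A\<^esub> rep_class ?KHG y"
        using grothendieck_simps(3)[OF k, of y] diff by simp
      then have "frag_of (1, rep_class ?KHG x) - frag_of (1, rep_class ?KHG (x - y)) - frag_of (1, rep_class ?KHG y)
          \<in> tensor_relations ?A"
        using tensor_relation_add[OF c[OF k] c[of y]] diff by simp
      from free_subgroup(3)[OF tensor_relations_subgroup[OF gA] this]
      have "tensor_class ?A (frag_of (1, rep_class ?KHG (x - y)))
          = tensor_class ?A (frag_of (1, rep_class ?KHG x) - frag_of (1, rep_class ?KHG y))"
        unfolding tensor_class_eq_iff[OF gA] by (simp add: algebra_simps)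
      also have "\<dots> \<in> P" using P'(3) c diff by simp
      finally show ?case using k by blast
    qed
    then show ?thesis by blast
  qed
  have all: "tensor_class ?A z \<in> P" if "Poly_Mapping.keys z \<subseteq> UNIV \<times> carrier ?A" for z
  proof -
    have "Poly_Mapping.keys z \<subseteq> UNIV \<times> carrier ?A \<and> tensor_class ?A z \<in> P"
      using that
    proof (induction z rule: frag_induction)
      case (one e)
      then obtain c x where e: "e = (c, rep_class ?KHG x)" "Poly_Mapping.keys x \<subseteq> reps ?KHG"
        unfolding grothendieck_simps(2) by auto
      show ?case using one P'(4)[OF unit[OF e(2)], of c] e(1) by simp
    next
      case (diff x y)
      then show ?case using P'(3) keys_diff_subset by blast
    qed (use P'(1) in simp)
    then show ?thesis by blast
  qed
  have "carrier (Mor G H K) \<subseteq> P"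
    unfolding Mor_def CR_def carrier_M using all by blast
  moreover have "P \<subseteq> carrier (Mor G H K)" using P by (rule submodule.subset)
  ultimately show ?thesis unfolding P_def S_def by blast
qed

end
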